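(* Let $m\in\mathbb{C}$ with $\mathrm{Re}(m)=1$. (1) $\mathcal{H}_0^2(\mathbb{R}_+)$ is a dense subspace of $\mathcal{D}(H_m)$ (for the graph norm) of infinite codimension. (2) If $\xi$ is a $C_c^2[0,\infty[$ function equal to $1$ near zero, then $x^{\frac12+m}\xi\in\mathcal{D}(H_m)$ but $x^{\frac12+m}\xi\notin\mathcal{H}_0^2(\mathbb{R}_+)$. (3) If $m'\in\mathbb{C}$, $\mathrm{Re}(m')=1$ and $m\neq m'$, then $\mathcal{D}(H_m)\cap\mathcal{D}(H_{m'})=\mathcal{H}_0^2(\mathbb{R}_+)$.
   Context: $\mathbb{R}_+=]0,\infty[$; all operators act in the complex Hilbert space $L^2(\mathbb{R}_+)$, and $\mathcal{D}(T)$ is the domain of $T$, equipped with the graph norm. For $\alpha\in\mathbb{C}$, $L_\alpha$ is the differential expression $L_\alpha=-\frac{d^2}{dx^2}+\left(\alpha-\frac14\right)\frac1{x^2}$ (in the distributional sense on $\mathbb{R}_+$). $L_\alpha^{\max}$ is the operator given by $L_\alpha$ on $\mathcal{D}(L_\alpha^{\max})=\{f\in L^2(\mathbb{R}_+) : L_\alpha f\in L^2(\mathbb{R}_+)\}$, and $L_\alpha^{\min}$ is the closure of the restriction of $L_\alpha^{\max}$ to $C_c^\infty(\mathbb{R}_+)$. For $\mathrm{Re}(m)>-1$, $H_m$ is the restriction of $L_{m^2}^{\max}$ to $\mathcal{D}(H_m):=\mathcal{D}(L_{m^2}^{\min})+\mathbb{C}\,x^{\frac12+m}\xi_0$, where $\xi_0$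 is any $C_c^\infty[0,\infty[$ function with $\xi_0=1$ near $0$. It is known that for $\mathrm{Re}(m)\ge 1$ one has $L_{m^2}^{\min}=H_m=L_{m^2}^{\max}$. $\mathcal{H}^2(\mathbb{R}_+)=\{f\in L^2(\mathbb{R}_+) : f''\in L^2(\mathbb{R}_+)\}$ and $\mathcal{H}^2_0(\mathbb{R}_+)=\{f\in\mathcal{H}^2(\mathbb{R}_+) : f(0)=f'(0)=0\}$. *)

theory Defs
  imports "HOL-Analysis.Analysis" "HOL-Library.Function_Algebras"
begin

text \<open>
  Elements of \<open>L\<^sup>2(\<real>\<^sub>+)\<close>, with \<open>\<real>\<^sub>+ = ]0,\<infinity>[\<close>, are represented by functions on the real line whose
  values outside \<open>{0<..}\<close> are irrelevant; no quotient by almost everywhere equality is taken.  The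
  spaces \<open>H20\<close>, \<open>Domain (L_max \<alpha>)\<close>, \<open>Domain (L_min \<alpha>)\<close> and \<open>Domain (H_op \<xi> m)\<close> below are stable
  under modification on \<open>\<real>\<^sub>+\<close>-null sets, so that inclusions and equalities between
  them are the ones between the corresponding spaces of classes.  The complete measure
  \<open>lebesgue_on {0<..}\<close> is used so that measurability is stable under such modifications.
\<close>

definition L2 :: "(real \<Rightarrow> complex) set" where
  "L2 = {f \<in> borel_measurable (lebesgue_on {0<..}).
           integrable (lebesgue_on {0<..}) (\<lambda>x. (cmod (f x))\<^sup>2)}"

definition L2_norm :: "(real \<Rightarrow> complex) \<Rightarrow> real" where
  "L2_norm f = sqrt (LINT x|lebesgue_on {0<..}. (cmod (f x))\<^sup>2)"

interpretation cfun: vector_space "\<lambda>(c::complex) (f::real \<Rightarrow> complex) x. c * f x"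
  by unfold_locales (auto simp: fun_eq_iff algebra_simps)

text \<open>For \<open>V\<close> a subspace of \<open>W\<close>: the quotient \<open>W/V\<close> is not finite dimensional over the complex numbers.\<close>

definition infinite_codim :: "(real \<Rightarrow> complex) set \<Rightarrow> (real \<Rightarrow> complex) set \<Rightarrow> bool" where
  "infinite_codim V W \<longleftrightarrow> \<not> (\<exists>F. finite F \<and> F \<subseteq> W \<and> W \<subseteq> cfun.span (V \<union> F))"

text \<open>Derivatives are taken within \<open>S\<close>, hence one-sided at \<open>0\<close> when \<open>S = {0..}\<close>.\<close>

primrec Ck_on :: "nat \<Rightarrow> real set \<Rightarrow> (real \<Rightarrow> complex) \<Rightarrow> bool" where
  "Ck_on 0 S f \<longleftrightarrow> continuous_on S f"
| "Ck_on (Suc k) S f \<longleftrightarrow>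
     (\<exists>f'. (\<forall>x\<in>S. (f has_vector_derivative f' x) (at x within S)) \<and> Ck_on k S f')"

text \<open>\<open>C\<^sub>c\<^sup>\<infinity>(\<real>\<^sub>+)\<close>, each function being extended by \<open>0\<close> to the real line.\<close>

definition test_fun :: "(real \<Rightarrow> complex) set" where
  "test_fun = {\<phi>. (\<forall>k. Ck_on k UNIV \<phi>) \<and>
                 compact (closure {x. \<phi> x \<noteq> 0}) \<and> closure {x. \<phi> x \<noteq> 0} \<subseteq> {0<..}}"

text \<open>\<open>C\<^sub>c\<^sup>k[0,\<infinity>[\<close>: the support may contain \<open>0\<close>.\<close>

definition Ck_c_half :: "nat \<Rightarrow> (real \<Rightarrow> complex) set" where
  "Ck_c_half k = {\<xi>. Ck_on k {0..} \<xi> \<and> (\<exists>R. \<forall>x>R. \<xi> x = 0)}"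

definition Cinf_c_half :: "(real \<Rightarrow> complex) set" where
  "Cinf_c_half = (\<Inter>k. Ck_c_half k)"

definition one_near_0 :: "(real \<Rightarrow> complex) \<Rightarrow> bool" where
  "one_near_0 \<xi> \<longleftrightarrow> (\<exists>e>0. \<forall>x. 0 \<le> x \<and> x < e \<longrightarrow> \<xi> x = 1)"

definition deriv2 :: "(real \<Rightarrow> complex) \<Rightarrow> real \<Rightarrow> complex" where
  "deriv2 \<phi> x = vector_derivative (\<lambda>y. vector_derivative \<phi> (at y)) (at x)"

text \<open>\<open>f'' = g\<close> and \<open>L\<^sub>\<alpha> f = g\<close> as distributions on \<open>\<real>\<^sub>+\<close>, for \<open>f\<close>, \<open>g\<close> in \<open>L2\<close>, with the bilinear
  pairing (no complex conjugation), for which \<open>L\<^sub>\<alpha>\<close> is its own transpose.\<close>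

definition dist_deriv2 :: "(real \<Rightarrow> complex) \<Rightarrow> (real \<Rightarrow> complex) \<Rightarrow> bool" where
  "dist_deriv2 f g \<longleftrightarrow> (\<forall>\<phi>\<in>test_fun.
     (LINT x|lebesgue_on {0<..}. f x * deriv2 \<phi> x) = (LINT x|lebesgue_on {0<..}. g x * \<phi> x))"

definition dist_L :: "complex \<Rightarrow> (real \<Rightarrow> complex) \<Rightarrow> (real \<Rightarrow> complex) \<Rightarrow> bool" where
  "dist_L \<alpha> f g \<longleftrightarrow> (\<forall>\<phi>\<in>test_fun.
     (LINT x|lebesgue_on {0<..}. f x * (- deriv2 \<phi> x + (\<alpha> - 1/4) / (of_real x)\<^sup>2 * \<phi> x)) =
     (LINT x|lebesgue_on {0<..}. g x * \<phi> x))"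

text \<open>An operator is identified with its graph, a set of pairs of representatives, and its domain is
  the \<open>Domain\<close> of that relation.  The norm of \<open>(f, T f)\<close> in \<open>L\<^sup>2 \<oplus> L\<^sup>2\<close> is the graph norm of \<open>f\<close>.\<close>

type_synonym graph = "((real \<Rightarrow> complex) \<times> (real \<Rightarrow> complex)) set"

definition graph_norm :: "(real \<Rightarrow> complex) \<times> (real \<Rightarrow> complex) \<Rightarrow> real" where
  "graph_norm p = sqrt ((L2_norm (fst p))\<^sup>2 + (L2_norm (snd p))\<^sup>2)"

definition op_restrict :: "graph \<Rightarrow> (real \<Rightarrow> complex) set \<Rightarrow> graph" where
  "op_restrict T V = {p \<in> T. fst p \<in> V}"

definition op_closure :: "graph \<Rightarrow> graph" where
  "op_closure T = {p \<in> L2 \<times> L2. \<forall>e>0. \<exists>q\<in>T. graph_norm (p - q) < e}"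

definition graph_dense :: "(real \<Rightarrow> complex) set \<Rightarrow> graph \<Rightarrow> bool" where
  "graph_dense V T \<longleftrightarrow> V \<subseteq> Domain T \<and>
     (\<forall>p\<in>T. \<forall>e>0. \<exists>q\<in>T. fst q \<in> V \<and> graph_norm (p - q) < e)"

definition L_max :: "complex \<Rightarrow> graph" where
  "L_max \<alpha> = {(f, g). f \<in> L2 \<and> g \<in> L2 \<and> dist_L \<alpha> f g}"

definition L_min :: "complex \<Rightarrow> graph" where
  "L_min \<alpha> = op_closure (op_restrict (L_max \<alpha>) test_fun)"

definition cutoff_power :: "complex \<Rightarrow> (real \<Rightarrow> complex) \<Rightarrow> real \<Rightarrow> complex" where
  "cutoff_power m \<xi> x = of_real x powr (1/2 + m) * \<xi> x"

text \<open>The operator \<open>H\<^sub>m\<close>, for \<open>Re m > -1\<close>; it does not depend on the cutoff \<open>\<xi> \<in> Cinf_c_half\<close> with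
  \<open>one_near_0 \<xi>\<close>.\<close>

definition H_op :: "(real \<Rightarrow> complex) \<Rightarrow> complex \<Rightarrow> graph" where
  "H_op \<xi> m = op_restrict (L_max (m\<^sup>2))
     {f + (\<lambda>x. c * cutoff_power m \<xi> x) | f c. f \<in> Domain (L_min (m\<^sup>2))}"

definition H2 :: "(real \<Rightarrow> complex) set" where
  "H2 = {f \<in> L2. \<exists>g\<in>L2. dist_deriv2 f g}"

text \<open>The boundary values \<open>f(0)\<close> and \<open>f'(0)\<close> are those of the representative \<open>u\<close> of \<open>f\<close> that
  is \<open>C\<^sup>1\<close> up to the boundary.\<close>

definition H20 :: "(real \<Rightarrow> complex) set" where
  "H20 = {f \<in> H2. \<exists>u u'. (AE x in lebesgue_on {0<..}. f x = u x) \<and>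
            (\<forall>x\<ge>0. (u has_vector_derivative u' x) (at x within {0..})) \<and>
            continuous_on {0..} u' \<and> u 0 = 0 \<and> u' 0 = 0}"

end

theory Submission
  imports Defs
begin

text \<open>
  A function of \<open>H20\<close> is the second primitive of its second derivative, so by Hardy's inequality
  \<open>f / x\<^sup>2\<close> is square integrable, with norm bounded by that of \<open>f''\<close>; conversely, if \<open>f\<close>, \<open>f''\<close> and
  \<open>f / x\<^sup>2\<close> are square integrable then \<open>f\<close> is in \<open>H20\<close>, since the affine functions \<open>a + b x\<close> divided by
  \<open>x\<^sup>2\<close> are not square integrable near \<open>0\<close>.  If \<open>f\<close> lies in two maximal domains, subtracting the two
  expressions shows that \<open>f / x\<^sup>2\<close> is square integrable: this gives (3).

  Cutting off at \<open>0\<close> and \<open>\<infinity>\<close> and then approximating \<open>f''\<close> shows that \<open>H20\<close> is contained in the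
  domain of the closed operator \<open>L_min\<close>, whose domain therefore contains every limit of elements of \<open>H20\<close> in
  the graph norm.  For \<open>\<epsilon> > 0\<close> the functions \<open>x\<^bsup>1/2+m+\<epsilon>\<^esup> g\<close> are in \<open>H20\<close> and converge to
  \<open>x\<^bsup>1/2+m\<^esup> g\<close> as \<open>\<epsilon> \<longrightarrow> 0\<close>, because \<open>\<epsilon>\<^sup>2 x\<^bsup>2\<epsilon>-1\<^esup>\<close> is dominated by \<open>1 / (x (1 + ln\<^sup>2 x))\<close>.  With \<open>g\<close> a
  cutoff this puts the generator of \<open>H\<^sub>m\<close> into the domain of \<open>L_min\<close>.  With \<open>g = (1 + ln\<^sup>2 x)\<^bsup>-r\<^esup>\<close> near \<open>0\<close>,
  \<open>0 \<le> r \<le> 1/4\<close>, it gives arbitrarily many elements of the domain no non-trivial combination of which is in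
  \<open>H20\<close>, because \<open>x\<^bsup>-1/2\<^esup> g\<close> is not square integrable.
\<close>

section \<open>Smooth functions and cutoffs\<close>

text \<open>The exponent is critical: for Re m = 1 the second derivative of x^(1/2+m) has modulus of
  order x^(-1/2), whose square misses integrability at 0 by a logarithm only. This rules out a plain
  cutoff at 0: at scale 1/n the term with the second derivative of the cutoff keeps, by scaling, an
  L2 norm of order 1. Raising the exponent by \<epsilon> spreads the cutoff over all logarithmic
  scales, and the error \<epsilon> x^(\<epsilon>-1/2) does tend to 0 in L2 near 0. In the variable
  ln x the measure dx/x is Lebesgue measure, and the proof lives between two weights: (1 + ln^2
  x)^(-1), integrable for dx/x, and (1 + ln^2 x)^(-1/2), not integrable. Squares of x d/dx applied
  to (1 + ln^2 x)^(-r) are controlled by the first weight, while r <= 1/4 keeps the square of the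
  function itself above the second. Density in (1) then costs little: once \<open>H_op\<close> and
  \<open>L_min\<close> have the same domain, test functions do it, since they belong to
  \<open>H20\<close> and are dense in \<open>L_min\<close> by definition.\<close>

definition smooth :: "(real \<Rightarrow> complex) \<Rightarrow> bool" where
  "smooth f \<longleftrightarrow> (\<forall>k. Ck_on k UNIV f)"

lemma Ck_on_Suc_imp: "Ck_on (Suc k) S f \<Longrightarrow> Ck_on k S f"
proof (induction k arbitrary: f)
  case 0
  then show ?case
    by (auto intro: continuous_on_vector_derivative)
next
  case (Suc k)
  then show ?case by (metis Ck_on.simps(2))
qed

lemma Ck_on_SucI:
  "(\<And>x. x \<in> S \<Longrightarrow> (f has_vector_derivative f' x) (at x within S)) \<Longrightarrow> Ck_on k S f' \<Longrightarrow> Ck_on (Suc k) S f"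
  by auto

lemma Ck_on_add: "Ck_on k S f \<Longrightarrow> Ck_on k S g \<Longrightarrow> Ck_on k S (\<lambda>x. f x + g x)"
proof (induction k arbitrary: f g)
  case 0
  then show ?case by (auto intro: continuous_intros)
next
  case (Suc k)
  from Suc.prems obtain f' g' where
    "\<forall>x\<in>S. (f has_vector_derivative f' x) (at x within S)" "Ck_on k S f'"
    "\<forall>x\<in>S. (g has_vector_derivative g' x) (at x within S)" "Ck_on k S g'" by auto
  with Suc.IH[of f' g'] show ?case
    by (auto intro!: exI[of _ "\<lambda>x. f' x + g' x"] derivative_intros)
qed

lemma Ck_on_mult: "Ck_on k S f \<Longrightarrow> Ck_on k S g \<Longrightarrow> Ck_on k S (\<lambda>x. f x * g x)"
proof (induction k arbitrary: f g)
  case 0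
  then show ?case by (auto intro: continuous_intros)
next
  case (Suc k)
  from Suc.prems obtain f' g' where d:
    "\<forall>x\<in>S. (f has_vector_derivative f' x) (at x within S)" "Ck_on k S f'"
    "\<forall>x\<in>S. (g has_vector_derivative g' x) (at x within S)" "Ck_on k S g'" by auto
  have "Ck_on k S (\<lambda>x. f x * g' x + f' x * g x)"
    using Suc d by (intro Ck_on_add Suc.IH) (auto intro: Ck_on_Suc_imp simp del: Ck_on.simps)
  with d show ?case
    by (auto intro!: exI[of _ "\<lambda>x. f x * g' x + f' x * g x"] has_vector_derivative_mult)
qed

lemma Ck_on_const: "Ck_on k S (\<lambda>_. c)"
  by (induction k arbitrary: c) (auto intro!: exI[of _ "\<lambda>_. 0"] derivative_intros)

lemma smooth_add: "smooth f \<Longrightarrow> smooth g \<Longrightarrow> smooth (\<lambda>x. f x + g x)"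
  and smooth_mult: "smooth f \<Longrightarrow> smooth g \<Longrightarrow> smooth (\<lambda>x. f x * g x)"
  and smooth_const: "smooth (\<lambda>_. c)"
  by (auto simp: smooth_def Ck_on_add Ck_on_mult Ck_on_const)

lemma smooth_diff: "smooth f \<Longrightarrow> smooth g \<Longrightarrow> smooth (\<lambda>x. f x - g x)"
  using smooth_add[of f "\<lambda>x. (-1) * g x"] smooth_mult[OF smooth_const, of g "-1"] by simp

lemma smoothI:
  assumes "\<And>x. (f has_vector_derivative f' x) (at x)" "smooth f'"
  shows "smooth f"
proof -
  have "Ck_on k UNIV f" for k
  proof (cases k)
    case 0
    then show ?thesis using assms(1)
      by (auto intro: continuous_on_vector_derivative[where f'=f'])
  next
    case (Suc n)
    then show ?thesis using assms by (auto simp: smooth_def)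
  qed
  then show ?thesis by (simp add: smooth_def)
qed

text \<open>Unfolding \<open>smooth\<close> order by order yields a derivative that might depend on
  the order. Uniqueness of derivatives identifies them all, so that a single \<open>f'\<close> is
  seen to be smooth.\<close>

lemma smooth_obtain_derivative:
  assumes "smooth f"
  obtains f' where "smooth f'" "\<And>x. (f has_vector_derivative f' x) (at x)"
proof -
  from assms have "Ck_on (Suc 0) UNIV f" unfolding smooth_def by blast
  then obtain f' where f': "\<And>x. (f has_vector_derivative f' x) (at x)" by auto
  have "Ck_on k UNIV f'" for k
  proof -
    from assms have "Ck_on (Suc k) UNIV f" unfolding smooth_def by blast
    then obtain g where g: "\<And>x. (f has_vector_derivative g x) (at x)" "Ck_on k UNIV g" by auto
    have "g = f'" using g(1) f' vector_derivative_unique_at by blast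
    with g show ?thesis by simp
  qed
  then show ?thesis using that f' by (auto simp: smooth_def)
qed

lemma smooth_continuous_on: "smooth f \<Longrightarrow> continuous_on S f"
  by (metis Ck_on.simps(1) smooth_def continuous_on_subset subset_UNIV)

lemma smooth_of_real: "smooth of_real"
  by (rule smoothI[where f'="\<lambda>_. 1"])
    (use smooth_const has_vector_derivative_of_real[OF DERIV_ident] in auto)

lemma smooth_power: "smooth f \<Longrightarrow> smooth (\<lambda>x. f x ^ n)"
  by (induction n) (auto intro!: smooth_const smooth_mult)

lemma smooth_affine_compose:
  assumes "smooth f" shows "smooth (\<lambda>x. f (c * x + d))"
proof -
  have "Ck_on k UNIV f \<Longrightarrow> Ck_on k UNIV (\<lambda>x. f (c * x + d))" for k and f :: "real \<Rightarrow> complex"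
  proof (induction k arbitrary: f)
    case 0
    then show ?case by (auto intro!: continuous_on_compose2[of UNIV f] continuous_intros)
  next
    case (Suc k)
    then obtain f' where f': "\<And>x. (f has_vector_derivative f' x) (at x)" "Ck_on k UNIV f'" by auto
    have "((\<lambda>x. f (c * x + d)) has_vector_derivative (of_real c * f' (c * x + d))) (at x)" for x
    proof -
      have "((\<lambda>x. c * x + d) has_vector_derivative c) (at x)"
        by (auto intro!: derivative_eq_intros)
      from vector_diff_chain_at[OF this f'(1)[of "c * x + d"]] show ?thesis
        by (simp add: o_def scaleR_conv_of_real)
    qed
    moreover have "Ck_on k UNIV (\<lambda>x. of_real c * f' (c * x + d))"
      by (intro Ck_on_mult Ck_on_const Suc.IH f')
    ultimately show ?case by (rule Ck_on_SucI)
  qed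
  with assms show ?thesis by (auto simp: smooth_def)
qed

lemma continuous_antiderivative:
  fixes f :: "real \<Rightarrow> 'a::euclidean_space"
  assumes "continuous_on UNIV f"
  obtains F where "\<And>x. (F has_vector_derivative f x) (at x)" "F a = 0"
proof -
  from einterval_antiderivative[of "-\<infinity>" "\<infinity>" f] assms obtain F where
    F: "\<And>x. (F has_vector_derivative f x) (at x)"
    by (auto simp: continuous_on_eq_continuous_at)
  show ?thesis
    by (rule that[of "\<lambda>x. F x - F a"]) (auto intro!: derivative_eq_intros F)
qed

text \<open>The functions x^(-k) exp(-1/x), extended by 0. The negative powers make the family
  closed under differentiation up to linear combinations, so that smoothness is an induction on the
  order for all k at once.\<close>

definition flat_exp :: "nat \<Rightarrow> real \<Rightarrow> real" where
  "flat_exp k x = (if x \<le> 0 then 0 else inverse x ^ k * exp (- inverse x))"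

lemma flat_exp_tendsto_0: "(flat_exp k \<longlongrightarrow> 0) (at_right 0)"
proof -
  have "((\<lambda>x. inverse x ^ k / exp (inverse x)) \<longlongrightarrow> (0::real)) (at_right 0)"
    by (rule filterlim_compose[OF tendsto_power_div_exp_0 filterlim_inverse_at_top_right])
  then show ?thesis
    by (rule Lim_transform_eventually)
      (auto simp: flat_exp_def eventually_at_filter exp_minus divide_inverse)
qed

text \<open>Only x = 0 is delicate: there the difference quotient from the right is
  \<open>flat_exp (k + 1)\<close>, which tends to 0 because the exponential beats every
  power.\<close>

lemma flat_exp_has_derivative:
  "(flat_exp k has_real_derivative (flat_exp (k + 2) x - k * flat_exp (k + 1) x)) (at x)"
proof (cases x "0::real" rule: linorder_cases)
  case less
  have "((\<lambda>_. 0) has_real_derivative 0) (at x)" by simp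
  then have "(flat_exp k has_real_derivative 0) (at x)"
    by (rule has_field_derivative_transform_within_open[where S="{..<0}"])
       (use less in \<open>auto simp: flat_exp_def\<close>)
  with less show ?thesis by (simp add: flat_exp_def)
next
  case equal
  have "((\<lambda>y. (flat_exp k y - flat_exp k 0) / (y - 0)) \<longlongrightarrow> 0) (at 0)"
  proof (rule filterlim_split_at)
    show "((\<lambda>y. (flat_exp k y - flat_exp k 0) / (y - 0)) \<longlongrightarrow> 0) (at_left 0)"
      by (rule Lim_transform_eventually[OF tendsto_const])
        (auto simp: flat_exp_def eventually_at_filter)
    show "((\<lambda>y. (flat_exp k y - flat_exp k 0) / (y - 0)) \<longlongrightarrow> 0) (at_right 0)"
      by (rule Lim_transform_eventually[OF flat_exp_tendsto_0[of "k + 1"]])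
        (auto simp: flat_exp_def eventually_at_filter divide_inverse)
  qed
  with equal show ?thesis by (simp add: has_field_derivative_iff flat_exp_def)
next
  case greater
  have pow: "((\<lambda>x. inverse x ^ k) has_real_derivative - (k * inverse x ^ (k + 1))) (at x)"
  proof (cases k)
    case (Suc n)
    show ?thesis unfolding Suc
      by (rule DERIV_cong[OF DERIV_power_Suc[OF DERIV_inverse]])
        (use greater in \<open>auto simp: algebra_simps\<close>)
  qed auto
  have "((\<lambda>x. inverse x ^ k * exp (- inverse x)) has_real_derivative
     (inverse x ^ (k + 2) * exp (- inverse x) - k * (inverse x ^ (k + 1) * exp (- inverse x)))) (at x)"
    using greater
  proof -
    have "((\<lambda>x. exp (- inverse x)) has_real_derivative inverse x ^ 2 * exp (- inverse x)) (at x)"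
      using greater by (auto intro!: derivative_eq_intros simp: power2_eq_square)
    from DERIV_mult[OF pow this] show ?thesis
      by (rule DERIV_cong) (simp add: algebra_simps power2_eq_square)
  qed
  then have "(flat_exp k has_real_derivative
     (inverse x ^ (k + 2) * exp (- inverse x) - k * (inverse x ^ (k + 1) * exp (- inverse x)))) (at x)"
    by (rule has_field_derivative_transform_within_open[where S="{0<..}"])
       (use greater in \<open>auto simp: flat_exp_def\<close>)
  with greater show ?thesis by (simp add: flat_exp_def)
qed

lemma smooth_flat_exp: "smooth (\<lambda>x. of_real (flat_exp k x))"
proof -
  have "Ck_on j UNIV (\<lambda>x. of_real (flat_exp k x))" for j
  proof (induction j arbitrary: k)
    case 0
    have "isCont (flat_exp k) x" for x
      using flat_exp_has_derivative DERIV_isCont by blast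
    then show ?case by (auto intro!: continuous_intros simp: continuous_on_eq_continuous_at)
  next
    case (Suc j)
    have "((\<lambda>x. of_real (flat_exp k x)) has_vector_derivative
        (of_real (flat_exp (k + 2) x) + (- of_nat k) * of_real (flat_exp (k + 1) x))) (at x)" for x
      using has_vector_derivative_of_real[OF flat_exp_has_derivative[of k x]] by simp
    moreover have "Ck_on j UNIV (\<lambda>x. of_real (flat_exp (k + 2) x) + (- of_nat k) * of_real (flat_exp (k + 1) x))"
      by (intro Ck_on_add Ck_on_mult Ck_on_const Suc.IH)
    ultimately show ?case by (rule Ck_on_SucI)
  qed
  then show ?thesis by (simp add: smooth_def)
qed

text \<open>The step is the normalised primitive of the bump exp(-1/(x-1)) exp(-1/(2-x)), which is
  supported in [1,2].\<close>

lemma smooth_step_exists: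
  obtains \<kappa> :: "real \<Rightarrow> real" where "smooth (\<lambda>x. of_real (\<kappa> x))"
    "\<And>x. x \<le> 1 \<Longrightarrow> \<kappa> x = 0" "\<And>x. 2 \<le> x \<Longrightarrow> \<kappa> x = 1" "\<And>x. 0 \<le> \<kappa> x" "\<And>x. \<kappa> x \<le> 1"
proof -
  define b where "b x = flat_exp 0 (x - 1) * flat_exp 0 (2 - x)" for x
  have bsm: "smooth (\<lambda>x. of_real (b x))"
    using smooth_mult[OF smooth_affine_compose[OF smooth_flat_exp[of 0], of 1 "-1"]
        smooth_affine_compose[OF smooth_flat_exp[of 0], of "-1" 2]]
    by (simp add: b_def)
  have b0: "b x \<ge> 0" for x by (simp add: b_def flat_exp_def)
  have bpos: "b x > 0" if "1 < x" "x < 2" for x using that by (simp add: b_def flat_exp_def)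
  have bz: "b x = 0" if "x \<le> 1 \<or> 2 \<le> x" for x using that by (auto simp add: b_def flat_exp_def)
  have "continuous_on UNIV (\<lambda>x. Re (of_real (b x)))"
    using smooth_continuous_on[OF bsm] by (intro continuous_on_Re)
  then have "continuous_on UNIV b" by simp
  from continuous_antiderivative[OF this, of 1]
  obtain F where F: "\<And>x. (F has_vector_derivative b x) (at x)" and F1: "F 1 = 0"
    by blast
  have Fd: "(F has_real_derivative b x) (at x)" for x
    using F by (simp add: has_real_derivative_iff_has_vector_derivative)
  have mono: "F x \<le> F y" if "x \<le> y" for x y
    by (rule DERIV_nonneg_imp_nondecreasing[OF that]) (use Fd b0 in blast)
  have F2: "F 2 > F 1"
  proof (rule DERIV_pos_imp_increasing_open[of 1 2 F])
    show "continuous_on {1..2} F"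
      using Fd DERIV_isCont continuous_at_imp_continuous_on by blast
  qed (use Fd bpos in auto)
  have le1: "F x = 0" if "x \<le> 1" for x
  proof (rule antisym)
    show "F x \<le> 0" using mono[OF that] F1 by simp
    have "F 1 \<le> F x"
      by (rule DERIV_nonpos_imp_nonincreasing[OF that]) (use Fd bz in \<open>metis le_numeral_extra(3)\<close>)
    then show "0 \<le> F x" using F1 by simp
  qed
  have ge2: "F x = F 2" if "2 \<le> x" for x
  proof (rule antisym)
    show "F 2 \<le> F x" using mono[OF that] by simp
    show "F x \<le> F 2"
      by (rule DERIV_nonpos_imp_nonincreasing[OF that]) (use Fd bz in \<open>metis le_numeral_extra(3)\<close>)
  qed
  have "smooth (\<lambda>x. of_real (F x))"
    by (rule smoothI[OF _ bsm]) (rule has_vector_derivative_of_real[OF Fd])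
  then have "smooth (\<lambda>x. of_real (1 / F 2) * of_real (F x))"
    by (intro smooth_mult smooth_const)
  then have sm: "smooth (\<lambda>x. of_real (F x / F 2))" by simp
  show ?thesis
  proof (rule that[of "\<lambda>x. F x / F 2", rotated])
    show "0 \<le> F x / F 2" for x
      using F2 F1 le1[of x] mono[of 1 x] by (cases "x \<le> 1") auto
    show "F x / F 2 \<le> 1" for x
      using F2 F1 ge2[of x] mono[of x 2] by (cases "x \<le> 2") auto
    show "F x / F 2 = 1" if "2 \<le> x" for x
      using F2 F1 ge2[OF that] by simp
  qed (use sm F2 F1 le1 in auto)
qed

section \<open>Test functions: intervals of support, stability, cutoffs\<close>

lemma test_fun_iff:
  "\<phi> \<in> test_fun \<longleftrightarrow> smooth \<phi> \<and> (\<exists>a b. 0 < a \<and> a < b \<and> (\<forall>x. x \<notin> {a..b} \<longrightarrow> \<phi> x = 0))"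
proof safe
  assume "\<phi> \<in> test_fun"
  then have s: "smooth \<phi>" and c: "compact (closure {x. \<phi> x \<noteq> 0})" and p: "closure {x. \<phi> x \<noteq> 0} \<subseteq> {0<..}"
    by (auto simp: test_fun_def smooth_def)
  show "smooth \<phi>" by fact
  show "\<exists>a b. 0 < a \<and> a < b \<and> (\<forall>x. x \<notin> {a..b} \<longrightarrow> \<phi> x = 0)"
  proof (cases "closure {x. \<phi> x \<noteq> 0} = {}")
    case True
    then have "\<phi> x = 0" for x by auto
    then show ?thesis by (intro exI[of _ 1] exI[of _ 2]) auto
  next
    case False
    from compact_attains_inf[OF c False] compact_attains_sup[OF c False] obtain a b where
      ab: "a \<in> closure {x. \<phi> x \<noteq> 0}" "\<And>x. x \<in> closure {x. \<phi> x \<noteq> 0} \<Longrightarrow> a \<le> x \<and> x \<le> b"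
      by blast
    \<comment> \<open>Enlarging the upper end by 1 gives a strict inequality between the endpoints
      without any inspection of the support.\<close>
    have "\<phi> x = 0" if "x \<notin> {a..b+1}" for x
      using ab(2)[of x] that closure_subset[of "{x. \<phi> x \<noteq> 0}"] by force
    moreover have "a < b + 1" "0 < a" using ab(2)[OF ab(1)] ab(1) p by auto
    ultimately show ?thesis by (intro exI[of _ a] exI[of _ "b + 1"]) auto
  qed
next
  fix a b :: real assume "smooth \<phi>" and ab: "0 < a" "a < b" "\<forall>x. x \<notin> {a..b} \<longrightarrow> \<phi> x = 0"
  have "{x. \<phi> x \<noteq> 0} \<subseteq> {a..b}" using ab(3) by blast
  then have sub: "closure {x. \<phi> x \<noteq> 0} \<subseteq> {a..b}"
    by (simp add: closure_minimal)
  then have "bounded (closure {x. \<phi> x \<noteq> 0})" using bounded_subset[OF bounded_closed_interval] by blast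
  with sub ab show "\<phi> \<in> test_fun"
    using \<open>smooth \<phi>\<close> by (auto simp: test_fun_def smooth_def compact_eq_bounded_closed)
qed

lemma test_funI:
  "smooth \<phi> \<Longrightarrow> 0 < a \<Longrightarrow> a < b \<Longrightarrow> (\<And>x. x \<notin> {a..b} \<Longrightarrow> \<phi> x = 0) \<Longrightarrow> \<phi> \<in> test_fun"
  unfolding test_fun_iff by blast

lemma test_funE:
  assumes "\<phi> \<in> test_fun"
  obtains a b where "0 < a" "a < b" "\<And>x. x \<notin> {a..b} \<Longrightarrow> \<phi> x = 0" "smooth \<phi>"
  using assms unfolding test_fun_iff by blast

lemma deriv2_eqI:
  assumes "\<And>x. (\<phi> has_vector_derivative \<phi>' x) (at x)" "\<And>x. (\<phi>' has_vector_derivative \<phi>'' x) (at x)"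
  shows "deriv2 \<phi> = \<phi>''"
proof -
  have "(\<lambda>y. vector_derivative \<phi> (at y)) = \<phi>'"
    using assms(1) by (auto simp: fun_eq_iff vector_derivative_at)
  then show ?thesis
    using assms(2) by (auto simp: deriv2_def fun_eq_iff vector_derivative_at)
qed

lemma test_fun_derivatives:
  assumes "\<phi> \<in> test_fun"
  obtains \<phi>' where "\<phi>' \<in> test_fun" "deriv2 \<phi> \<in> test_fun"
    "\<And>x. (\<phi> has_vector_derivative \<phi>' x) (at x)"
    "\<And>x. (\<phi>' has_vector_derivative deriv2 \<phi> x) (at x)"
proof -
  have step: "\<exists>g'\<in>test_fun. \<forall>x. (g has_vector_derivative g' x) (at x)" if g: "g \<in> test_fun" for g
  proof -
    from g obtain a b where ab: "0 < a" "a < b" "\<And>x. x \<notin> {a..b} \<Longrightarrow> g x = 0" and s: "smooth g"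
      by (auto simp: test_fun_iff)
    obtain g' where g': "smooth g'" "\<And>x. (g has_vector_derivative g' x) (at x)"
      using smooth_obtain_derivative[OF s] by blast
    have "g' x = 0" if "x \<notin> {a..b}" for x
    proof -
      have "((\<lambda>_. 0) has_vector_derivative 0) (at x)" by simp
      then have "(g has_vector_derivative 0) (at x)"
        by (rule has_vector_derivative_transform_within_open[where S="- {a..b}"])
          (use that ab(3) in auto)
      then show ?thesis using g'(2) vector_derivative_unique_at by blast
    qed
    then have "g' \<in> test_fun" using g' ab by (auto simp: test_fun_iff)
    then show ?thesis using g'(2) by blast
  qed
  from step[OF assms] obtain \<phi>' where 1: "\<phi>' \<in> test_fun" "\<And>x. (\<phi> has_vector_derivative \<phi>' x) (at x)" by blast
  from step[OF 1(1)] obtain \<phi>'' where 2: "\<phi>'' \<in> test_fun" "\<And>x. (\<phi>' has_vector_derivative \<phi>'' x) (at x)" by blast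
  have "deriv2 \<phi> = \<phi>''" using 1(2) 2(2) by (rule deriv2_eqI)
  with 1 2 that show ?thesis by blast
qed

lemma test_fun_smooth: "\<phi> \<in> test_fun \<Longrightarrow> smooth \<phi>"
  by (simp add: test_fun_iff)

lemma test_fun_add:
  assumes "f \<in> test_fun" "g \<in> test_fun"
  shows "(\<lambda>x. f x + g x) \<in> test_fun"
proof -
  from assms(1) obtain a b where f: "0 < a" "a < b" "\<And>x. x \<notin> {a..b} \<Longrightarrow> f x = 0" "smooth f"
    by (rule test_funE) blast
  from assms(2) obtain c d where g: "0 < c" "c < d" "\<And>x. x \<notin> {c..d} \<Longrightarrow> g x = 0" "smooth g"
    by (rule test_funE) blast
  show ?thesis
  proof (rule test_funI[OF smooth_add[OF f(4) g(4)], of "min a c" "max b d"])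
    show "f x + g x = 0" if "x \<notin> {min a c..max b d}" for x
      using that f(3)[of x] g(3)[of x] by (auto simp: min_le_iff_disj le_max_iff_disj)
  qed (use f g in auto)
qed

lemma test_fun_mult: "smooth f \<Longrightarrow> g \<in> test_fun \<Longrightarrow> (\<lambda>x. f x * g x) \<in> test_fun"
  by (fastforce simp: test_fun_iff intro: smooth_mult)

lemma test_fun_cmult: "g \<in> test_fun \<Longrightarrow> (\<lambda>x. c * g x) \<in> test_fun"
  by (rule test_fun_mult[OF smooth_const])

lemma test_fun_diff: "f \<in> test_fun \<Longrightarrow> g \<in> test_fun \<Longrightarrow> (\<lambda>x. f x - g x) \<in> test_fun"
  using test_fun_add[of f "\<lambda>x. (-1) * g x"] test_fun_cmult[of g "-1"] by simp

lemma smooth_cutoff_exists: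
  fixes a b :: real
  assumes "0 < a" "a < b"
  obtains \<eta> :: "real \<Rightarrow> real" where "(\<lambda>x. of_real (\<eta> x)) \<in> test_fun"
    "\<And>x. x \<in> {a..b} \<Longrightarrow> \<eta> x = 1" "\<And>x. x \<notin> {a/2..2*b} \<Longrightarrow> \<eta> x = 0" "\<And>x. 0 \<le> \<eta> x" "\<And>x. \<eta> x \<le> 1"
proof -
  obtain \<kappa> :: "real \<Rightarrow> real" where k: "smooth (\<lambda>x. of_real (\<kappa> x))"
    "\<And>x. x \<le> 1 \<Longrightarrow> \<kappa> x = 0" "\<And>x. 2 \<le> x \<Longrightarrow> \<kappa> x = 1" "\<And>x. 0 \<le> \<kappa> x" "\<And>x. \<kappa> x \<le> 1"
    by (rule smooth_step_exists) auto
  \<comment> \<open>The first factor switches on between a/2 and a, the second switches off between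
    b and 2b.\<close>
  define \<eta> where "\<eta> x = \<kappa> (2 / a * x) * (1 - \<kappa> (x / b))" for x
  have z: "\<eta> x = 0" if "x \<notin> {a/2..2*b}" for x
    using that assms k(2)[of "2 / a * x"] k(3)[of "x / b"] by (auto simp: \<eta>_def field_simps)
  have "smooth (\<lambda>x. of_real (\<eta> x))"
    using smooth_mult[OF smooth_affine_compose[OF k(1), of "2/a" 0]
        smooth_diff[OF smooth_const[of 1] smooth_affine_compose[OF k(1), of "1/b" 0]]]
    by (simp add: \<eta>_def)
  then have "(\<lambda>x. of_real (\<eta> x)) \<in> test_fun"
    using z assms by (intro test_funI[of _ "a/2" "2*b"]) auto
  moreover have "\<eta> x = 1" if "x \<in> {a..b}" for x
    using that assms k(3)[of "2 / a * x"] k(2)[of "x / b"] by (auto simp: \<eta>_def field_simps)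
  ultimately show ?thesis
    using z k(4,5) by (intro that[of \<eta>]) (auto simp: \<eta>_def intro!: mult_le_one)
qed

lemma continuous_on_Icc_bounded:
  fixes f :: "real \<Rightarrow> complex"
  assumes "continuous_on {a..b} f"
  obtains B where "0 \<le> B" "\<And>x. x \<in> {a..b} \<Longrightarrow> cmod (f x) \<le> B"
proof -
  have "bounded (f ` {a..b})"
    using assms compact_continuous_image compact_imp_bounded compact_Icc by blast
  then obtain B where "\<And>x. x \<in> {a..b} \<Longrightarrow> cmod (f x) \<le> B" unfolding bounded_iff by blast
  then show ?thesis using that[of "max B 0"] by (meson max.cobounded2 max.coboundedI1)
qed

lemma test_fun_bounded:
  assumes "\<phi> \<in> test_fun"
  obtains B where "\<And>x. cmod (\<phi> x) \<le> B"
proof -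
  obtain a b where ab: "\<And>x. x \<notin> {a..b} \<Longrightarrow> \<phi> x = 0" using assms by (rule test_funE) blast
  obtain B where "0 \<le> B" "\<And>x. x \<in> {a..b} \<Longrightarrow> cmod (\<phi> x) \<le> B"
    using continuous_on_Icc_bounded[OF smooth_continuous_on[OF test_fun_smooth[OF assms]]] by blast
  then show ?thesis using ab that[of B] by (metis norm_zero)
qed

section \<open>The space \<open>L\<^sup>2(\<real>\<^sub>+)\<close>\<close>

abbreviation lebP :: "real measure" where
  "lebP \<equiv> lebesgue_on {0<..}"

text \<open>Error budgets and limits are kept in squared norms, without square roots; the triangle
  inequality becomes |u + v|^2 <= 2 |u|^2 + 2 |v|^2, whence many of the factors 2 and 4
  below.\<close>

definition L2_sq :: "(real \<Rightarrow> complex) \<Rightarrow> real" where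
  "L2_sq f = (LINT x|lebP. (cmod (f x))\<^sup>2)"

lemma measurable_ident_lebP [measurable]: "(\<lambda>x. x) \<in> borel_measurable lebP"
  using id_borel_measurable_lebesgue_on[of "{0<..}"] by (simp add: id_def)

lemma borel_measurable_lebP: "f \<in> borel_measurable borel \<Longrightarrow> f \<in> borel_measurable lebP"
  using measurable_compose[OF measurable_ident_lebP] by blast

lemma continuous_measurable_lebP:
  "continuous_on {0<..} f \<Longrightarrow> f \<in> borel_measurable lebP"
  by (rule continuous_imp_measurable_on_sets_lebesgue) auto

text \<open>The Borel sets of finite measure that exhaust \<open>lborel\<close> do the same for its
  completion. Fubini's theorem depends on this.\<close>

lemma sigma_finite_lebP: "sigma_finite_measure lebP"
proof (rule sigma_finite_measure_restrict_space)
  obtain A :: "real set set" where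
    "countable A" "A \<subseteq> sets lborel" "\<Union>A = space lborel" "\<forall>a\<in>A. emeasure lborel a \<noteq> \<infinity>"
    using sigma_finite_measure.sigma_finite_countable[OF sigma_finite_lborel] by blast
  then show "sigma_finite_measure (lebesgue :: real measure)"
    by (intro sigma_finite_measure.intro exI[of _ A]) (auto simp: subset_iff)
qed auto

lemma pair_sigma_finite_lebP: "pair_sigma_finite lebP lebP"
  by (simp add: pair_sigma_finite_def sigma_finite_lebP)

lemma L2_sq_nonneg [simp]: "0 \<le> L2_sq f"
  by (simp add: L2_sq_def)

lemma L2_norm_sq: "(L2_norm f)\<^sup>2 = L2_sq f"
  by (simp add: L2_norm_def L2_sq_def[symmetric])

lemma L2_measurable [measurable_dest]: "f \<in> L2 \<Longrightarrow> f \<in> borel_measurable lebP"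
  and L2_integrable: "f \<in> L2 \<Longrightarrow> integrable lebP (\<lambda>x. (cmod (f x))\<^sup>2)"
  by (simp_all add: L2_def)

lemma L2_bound:
  assumes [measurable]: "f \<in> borel_measurable lebP" and g: "integrable lebP g"
    and le: "\<And>x. 0 < x \<Longrightarrow> (cmod (f x))\<^sup>2 \<le> g x"
  shows "f \<in> L2" "L2_sq f \<le> (LINT x|lebP. g x)"
proof -
  have *: "integrable lebP (\<lambda>x. (cmod (f x))\<^sup>2)"
    by (rule Bochner_Integration.integrable_bound[OF g])
      (measurable, use le in \<open>auto intro!: AE_I2 intro: order_trans[OF _ abs_ge_self]\<close>)
  then show "f \<in> L2" by (simp add: L2_def)
  show "L2_sq f \<le> (LINT x|lebP. g x)"
    unfolding L2_sq_def by (rule integral_mono[OF * g]) (use le in auto)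
qed

lemma L2_cmult: "f \<in> L2 \<Longrightarrow> (\<lambda>x. c * f x) \<in> L2"
  by (auto simp: L2_def norm_mult power_mult_distrib)

lemma L2_sq_cmult: "L2_sq (\<lambda>x. c * f x) = (cmod c)\<^sup>2 * L2_sq f"
  by (auto simp: L2_sq_def norm_mult power_mult_distrib)

lemma cmod_add_sq_le: "(cmod (a + b))\<^sup>2 \<le> 2 * (cmod a)\<^sup>2 + 2 * (cmod b)\<^sup>2"
proof -
  have "(cmod (a + b))\<^sup>2 \<le> (cmod a + cmod b)\<^sup>2" by (intro power_mono norm_triangle_ineq) auto
  also have "\<dots> \<le> 2 * (cmod a)\<^sup>2 + 2 * (cmod b)\<^sup>2"
    using sum_squares_bound[of "cmod a" "cmod b"] by (simp add: power2_sum)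
  finally show ?thesis .
qed

lemma assumes "f \<in> L2" "g \<in> L2"
  shows L2_add: "(\<lambda>x. f x + g x) \<in> L2"
    and L2_sq_add_le: "L2_sq (\<lambda>x. f x + g x) \<le> 2 * L2_sq f + 2 * L2_sq g"
proof -
  have [measurable]: "f \<in> borel_measurable lebP" "g \<in> borel_measurable lebP"
    using assms by (auto intro: L2_measurable)
  have i: "integrable lebP (\<lambda>x. 2 * (cmod (f x))\<^sup>2 + 2 * (cmod (g x))\<^sup>2)"
    using assms by (intro Bochner_Integration.integrable_add integrable_mult_right L2_integrable) auto
  note b = L2_bound[OF _ i cmod_add_sq_le]
  show "(\<lambda>x. f x + g x) \<in> L2" by (rule b) measurable
  have "(LINT x|lebP. 2 * (cmod (f x))\<^sup>2 + 2 * (cmod (g x))\<^sup>2) = 2 * L2_sq f + 2 * L2_sq g"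
    using assms by (subst Bochner_Integration.integral_add) (auto simp: L2_sq_def intro: L2_integrable)
  with b(2) show "L2_sq (\<lambda>x. f x + g x) \<le> 2 * L2_sq f + 2 * L2_sq g" by simp
qed

lemma assumes "f \<in> L2" "g \<in> L2"
  shows L2_diff: "(\<lambda>x. f x - g x) \<in> L2"
    and L2_sq_diff_le: "L2_sq (\<lambda>x. f x - g x) \<le> 2 * L2_sq f + 2 * L2_sq g"
  using L2_add[OF assms(1) L2_cmult[OF assms(2), of "-1"]]
    L2_sq_add_le[OF assms(1) L2_cmult[OF assms(2), of "-1"]] L2_sq_cmult[of "-1" g]
  by auto

lemma L2_mult_bounded:
  assumes f: "f \<in> L2" and [measurable]: "g \<in> borel_measurable lebP"
    and b: "\<And>x. 0 < x \<Longrightarrow> cmod (g x) \<le> C"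
  shows "(\<lambda>x. g x * f x) \<in> L2" "L2_sq (\<lambda>x. g x * f x) \<le> C\<^sup>2 * L2_sq f"
proof -
  have [measurable]: "f \<in> borel_measurable lebP" using f by (rule L2_measurable)
  have i: "integrable lebP (\<lambda>x. C\<^sup>2 * (cmod (f x))\<^sup>2)"
    using f by (auto intro: L2_integrable)
  have le: "(cmod (g x * f x))\<^sup>2 \<le> C\<^sup>2 * (cmod (f x))\<^sup>2" if "0 < x" for x
    using b[OF that] by (auto simp: norm_mult power_mult_distrib intro!: mult_right_mono power_mono)
  show "(\<lambda>x. g x * f x) \<in> L2" by (rule L2_bound(1)[OF _ i le]) measurable
  have "L2_sq (\<lambda>x. g x * f x) \<le> (LINT x|lebP. C\<^sup>2 * (cmod (f x))\<^sup>2)"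
    by (rule L2_bound(2)[OF _ i le]) measurable
  then show "L2_sq (\<lambda>x. g x * f x) \<le> C\<^sup>2 * L2_sq f" by (simp add: L2_sq_def)
qed

lemma L2_sq_cong_AE:
  assumes "f \<in> L2" "g \<in> L2" "AE x in lebP. f x = g x"
  shows "L2_sq f = L2_sq g"
  unfolding L2_sq_def using assms by (intro integral_cong_AE) (auto dest!: L2_measurable)

lemma assumes "f \<in> L2" "g \<in> L2"
  shows integrable_mult_L2: "integrable lebP (\<lambda>x. f x * g x)"
    and Cauchy_Schwarz_L2: "(cmod (LINT x|lebP. f x * g x))\<^sup>2 \<le> L2_sq f * L2_sq g"
proof -
  have [measurable]: "f \<in> borel_measurable lebP" "g \<in> borel_measurable lebP"
    using assms by (auto intro: L2_measurable)
  have "integrable lebP (\<lambda>x. (cmod (f x))\<^sup>2 + (cmod (g x))\<^sup>2)"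
    using assms by (auto intro: L2_integrable)
  then show i: "integrable lebP (\<lambda>x. f x * g x)"
  proof (rule Bochner_Integration.integrable_bound)
    show "AE x in lebP. norm (f x * g x) \<le> norm ((cmod (f x))\<^sup>2 + (cmod (g x))\<^sup>2)"
    proof (rule AE_I2)
      fix x
      have "2 * (cmod (f x) * cmod (g x)) \<le> (cmod (f x))\<^sup>2 + (cmod (g x))\<^sup>2"
        using sum_squares_bound[of "cmod (f x)" "cmod (g x)"] by (simp only: mult.assoc)
      moreover have "0 \<le> cmod (f x) * cmod (g x)" by simp
      ultimately show "norm (f x * g x) \<le> norm ((cmod (f x))\<^sup>2 + (cmod (g x))\<^sup>2)"
        unfolding norm_mult real_norm_def by linarith
    qed
  qed measurable
  have e: "(\<integral>\<^sup>+x. ennreal (cmod (h x)) ^ 2 \<partial>lebP) = ennreal (L2_sq h)" if "h \<in> L2" for h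
    using nn_integral_eq_integral[OF L2_integrable[OF that]]
    by (simp add: ennreal_power L2_sq_def)
  have "ennreal ((LINT x|lebP. cmod (f x * g x))\<^sup>2) = (\<integral>\<^sup>+x. ennreal (cmod (f x)) * ennreal (cmod (g x)) \<partial>lebP)\<^sup>2"
    using nn_integral_eq_integral[OF integrable_norm[OF i]]
    by (simp add: norm_mult ennreal_mult flip: ennreal_power)
  also have "\<dots> \<le> (\<integral>\<^sup>+x. ennreal (cmod (f x)) ^ 2 \<partial>lebP) * (\<integral>\<^sup>+x. ennreal (cmod (g x)) ^ 2 \<partial>lebP)"
    by (rule Cauchy_Schwarz_nn_integral) measurable
  also have "\<dots> = ennreal (L2_sq f * L2_sq g)"
    using assms by (simp add: e ennreal_mult)
  finally have c: "(LINT x|lebP. cmod (f x * g x))\<^sup>2 \<le> L2_sq f * L2_sq g"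
    by (simp add: ennreal_le_iff)
  have "cmod (LINT x|lebP. f x * g x) \<le> (LINT x|lebP. cmod (f x * g x))"
    by (rule integral_norm_bound)
  then have "(cmod (LINT x|lebP. f x * g x))\<^sup>2 \<le> (LINT x|lebP. cmod (f x * g x))\<^sup>2"
    by (intro power_mono) auto
  with c show "(cmod (LINT x|lebP. f x * g x))\<^sup>2 \<le> L2_sq f * L2_sq g" by linarith
qed

section \<open>Reduction to Borel integrals and integration by parts\<close>

lemma integrable_lebP_of_lborel:
  fixes f :: "real \<Rightarrow> 'a :: {banach, second_countable_topology}"
  assumes "integrable lborel f"
  shows "integrable lebP f"
proof -
  have "integrable lebesgue f" using assms by (simp add: integrable_completion)
  then have "integrable lebesgue (\<lambda>x. indicator {0<..} x *\<^sub>R f x)"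
    by (intro integrable_mult_indicator) auto
  then show ?thesis by (subst integrable_restrict_space) auto
qed

lemma integral_lebP:
  fixes f :: "real \<Rightarrow> 'a :: {banach, second_countable_topology}"
  shows "(LINT x|lebP. f x) = (LINT x|lebesgue. indicator {0<..} x *\<^sub>R f x)"
  by (subst integral_restrict_space) auto

text \<open>The integrand is supported in a compact subset of ]0,\<infinity>[, so that its integral
  for the complete measure is a Borel integral over \<open>{a..b}\<close>. Every integration by
  parts below exhibits an antiderivative \<open>F\<close> and uses this lemma.\<close>

lemma
  fixes f :: "real \<Rightarrow> complex"
  assumes "0 < a" "a \<le> b" and c: "continuous_on {a..b} f"
    and z: "\<And>x. 0 < x \<Longrightarrow> x \<notin> {a..b} \<Longrightarrow> f x = 0"
  shows continuous_integrable_lebP: "integrable lebP f"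
    and integral_FTC_lebP: "(\<And>x. a \<le> x \<Longrightarrow> x \<le> b \<Longrightarrow> (F has_vector_derivative f x) (at x)) \<Longrightarrow>
      (LINT x|lebP. f x) = F b - F a"
proof -
  let ?g = "\<lambda>x. indicator {a..b} x *\<^sub>R f x"
  have i: "integrable lborel ?g"
    using borel_integrable_atLeastAtMost'[OF c] by (simp add: set_integrable_def)
  from integrable_lebP_of_lborel[OF i] show "integrable lebP f"
    by (rule Bochner_Integration.integrable_cong[THEN iffD1, rotated -1])
      (use z in \<open>auto simp: indicator_def\<close>)
  assume F: "\<And>x. a \<le> x \<Longrightarrow> x \<le> b \<Longrightarrow> (F has_vector_derivative f x) (at x)"
  have "(LINT x|lebP. f x) = (LINT x|lebP. ?g x)"
    by (rule Bochner_Integration.integral_cong) (use z in \<open>auto simp: indicator_def\<close>)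
  also have "\<dots> = (LINT x|lebesgue. ?g x)"
    unfolding integral_lebP
    by (rule Bochner_Integration.integral_cong) (use assms(1) in \<open>auto simp: indicator_def\<close>)
  also have "\<dots> = (LINT x|lborel. ?g x)"
    using i by (intro integral_completion) auto
  also have "\<dots> = F b - F a"
    by (rule integral_FTC_atLeastAtMost[OF assms(2) _ c])
      (use F in \<open>auto intro: has_vector_derivative_at_within\<close>)
  finally show "(LINT x|lebP. f x) = F b - F a" .
qed

lemma L2_of_compact_support:
  fixes f :: "real \<Rightarrow> complex"
  assumes "0 < a" "a \<le> b" "continuous_on {a..b} f" "\<And>x. 0 < x \<Longrightarrow> x \<notin> {a..b} \<Longrightarrow> f x = 0"
  shows "f \<in> L2"
proof -
  have "integrable lebP (\<lambda>x. f x * cnj (f x))"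
    by (rule continuous_integrable_lebP[OF assms(1,2)])
      (use assms in \<open>auto intro!: continuous_intros\<close>)
  then have "integrable lebP (\<lambda>x. Re (f x * cnj (f x)))" by (rule integrable_Re)
  moreover have "(\<lambda>x. Re (f x * cnj (f x))) = (\<lambda>x. (cmod (f x))\<^sup>2)"
    by (simp add: fun_eq_iff complex_mult_cnj cmod_power2)
  ultimately show ?thesis
    using continuous_integrable_lebP[OF assms] by (simp add: L2_def)
qed

lemma test_fun_L2:
  assumes "\<phi> \<in> test_fun" shows "\<phi> \<in> L2"
proof -
  from assms obtain a b where "0 < a" "a < b" "\<And>x. x \<notin> {a..b} \<Longrightarrow> \<phi> x = 0" "smooth \<phi>"
    by (rule test_funE) blast
  then show ?thesis
    by (intro L2_of_compact_support[of a b] smooth_continuous_on) (blast intro: less_imp_le)+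
qed

lemma test_fun_measurable: "\<phi> \<in> test_fun \<Longrightarrow> \<phi> \<in> borel_measurable lebP"
  by (intro L2_measurable test_fun_L2)

section \<open>Density of test functions\<close>

lemma polynomial_smooth:
  fixes p :: "real \<Rightarrow> complex"
  assumes "polynomial_function p" shows "smooth p"
proof -
  have sm: "smooth (\<lambda>x. of_real (q x))" if "real_polynomial_function q" for q :: "real \<Rightarrow> real"
    using that
  proof (induction q rule: real_polynomial_function.induct)
    case (linear f)
    then have "f = (\<lambda>x. f 1 * x)"
      using linear_simps(5)[of f] bounded_linear.linear linear_scale[of f _ 1] 
      by (auto simp: fun_eq_iff mult.commute)
    then have "(\<lambda>x. complex_of_real (f x)) = (\<lambda>x. of_real (f 1) * of_real x)" by (metis of_real_mult)
    then show ?case using smooth_mult[OF smooth_const smooth_of_real] by simp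
  qed (auto intro!: smooth_const smooth_add smooth_mult)
  have "real_polynomial_function (\<lambda>x. Re (p x))" "real_polynomial_function (\<lambda>x. Im (p x))"
    using assms bounded_linear_Re bounded_linear_Im unfolding polynomial_function_def o_def by auto
  from smooth_add[OF sm[OF this(1)] smooth_mult[OF smooth_const sm[OF this(2)], of \<i>]]
  show ?thesis by (simp add: complex_eq[symmetric])
qed

lemma integrable_Icc_const: "integrable lebP (\<lambda>x. indicator {a..b} x * (c::real))"
  using borel_integrable_atLeastAtMost'[of a b "\<lambda>_. c"]
  by (intro integrable_lebP_of_lborel) (simp add: set_integrable_def)

lemma integral_Icc_const_le:
  assumes "a \<le> b" "0 \<le> c"
  shows "(LINT x|lebP. indicator {a..b} x * c) \<le> (b - a) * (c::real)"
proof -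
  have "measure lebP ({a..b} \<inter> {0<..}) = measure lebesgue ({a..b} \<inter> {0<..})"
    by (subst measure_restrict_space) auto
  also have "\<dots> \<le> measure lebesgue {a..b}"
    by (intro measure_mono_fmeasurable) auto
  finally show ?thesis using assms by (simp add: mult_right_mono)
qed

lemma L2_sq_tendsto_0I:
  assumes f: "\<And>n::nat. f n \<in> borel_measurable lebP" and g: "integrable lebP g"
    and le: "\<And>n x. 0 < x \<Longrightarrow> (cmod (f n x))\<^sup>2 \<le> g x"
    and lim: "AE x in lebP. (\<lambda>n. f n x) \<longlonglongrightarrow> 0"
  shows "(\<lambda>n. L2_sq (f n)) \<longlonglongrightarrow> 0"
proof -
  have "(\<lambda>n. L2_sq (f n)) \<longlonglongrightarrow> (LINT x|lebP. 0)"
    unfolding L2_sq_def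
  proof (rule integral_dominated_convergence[OF _ _ g])
    show "AE x in lebP. (\<lambda>n. (cmod (f n x))\<^sup>2) \<longlonglongrightarrow> 0"
      using lim by eventually_elim (auto intro!: tendsto_eq_intros)
    show "AE x in lebP. norm ((cmod (f n x))\<^sup>2) \<le> g x" for n
      using le by (intro AE_I2) auto
  qed (use f in measurable)
  then show ?thesis by simp
qed

lemma L2_truncation:
  assumes h: "h \<in> L2"
  shows "(\<lambda>n. L2_sq (\<lambda>x. h x - (if cmod (h x) \<le> real n then h x else 0))) \<longlonglongrightarrow> 0"
proof (rule L2_sq_tendsto_0I[OF _ L2_integrable[OF h]])
  have [measurable]: "h \<in> borel_measurable lebP" using h by (rule L2_measurable)
  show "(\<lambda>x. h x - (if cmod (h x) \<le> real n then h x else 0)) \<in> borel_measurable lebP" for n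
    by measurable
  show "AE x in lebP. (\<lambda>n. h x - (if cmod (h x) \<le> real n then h x else 0)) \<longlonglongrightarrow> 0"
  proof (rule AE_I2)
    fix x
    have "eventually (\<lambda>n. cmod (h x) \<le> real n) sequentially"
      using filterlim_real_sequentially by (simp add: filterlim_at_top)
    then have "eventually (\<lambda>n. 0 = h x - (if cmod (h x) \<le> real n then h x else 0)) sequentially"
      by eventually_elim simp
    then show "(\<lambda>n. h x - (if cmod (h x) \<le> real n then h x else 0)) \<longlonglongrightarrow> 0"
      by (rule Lim_transform_eventually[OF tendsto_const])
  qed
qed auto

text \<open>The continuous approximants provided by measurability are cut off at the bound \<open>C\<close> of \<open>h\<close>;
  they then converge dominatedly on the bounded interval.\<close>

lemma L2_continuous_approx:
  assumes [measurable]: "h \<in> borel_measurable lebP" and ab: "0 < a" "a \<le> b"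
    and C: "0 < C" "\<And>x. cmod (h x) \<le> C"  and e: "0 < e"
  obtains g where "continuous_on UNIV g" "L2_sq (\<lambda>x. indicator {a..b} x * (h x - g x)) < e"
proof -
  have "h measurable_on {0<..}"
    using assms by (subst measurable_on_iff_borel_measurable) auto
  then obtain N g where N: "negligible N" and g: "\<And>n. continuous_on UNIV (g n)"
    and lim: "\<And>x. x \<notin> N \<Longrightarrow> (\<lambda>n. g n x) \<longlonglongrightarrow> (if x \<in> {0<..} then h x else 0)"
    unfolding measurable_on_def by blast
  define k where "k n x = g n x * of_real (C / max C (cmod (g n x)))" for n x
  have kc: "continuous_on UNIV (k n)" for n
    unfolding k_def using C by (intro continuous_intros g) auto
  have kb: "cmod (k n x) \<le> C" for n x
    using C(1) by (auto simp: k_def norm_mult norm_divide max_def field_simps)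
  have "(\<lambda>n. L2_sq (\<lambda>x. indicator {a..b} x * (h x - k n x))) \<longlonglongrightarrow> 0"
  proof (rule L2_sq_tendsto_0I)
    show "(\<lambda>x. indicator {a..b} x * (h x - k n x)) \<in> borel_measurable lebP" for n
    proof -
      have [measurable]: "k n \<in> borel_measurable lebP"
        using kc continuous_on_subset by (intro continuous_measurable_lebP) blast
      show ?thesis by measurable
    qed
    show "integrable lebP (\<lambda>x. indicator {a..b} x * (2 * C)\<^sup>2)"
      by (rule integrable_Icc_const)
    show "(cmod (indicator {a..b} x * (h x - k n x)))\<^sup>2 \<le> indicator {a..b} x * (2 * C)\<^sup>2" for n x
    proof -
      have "cmod (h x - k n x) \<le> 2 * C"
        using norm_triangle_ineq4[of "h x" "k n x"] C(2)[of x] kb[of n x] by simp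
      then have "(cmod (h x - k n x))\<^sup>2 \<le> (2 * C)\<^sup>2" by (intro power_mono) auto
      then show ?thesis by (auto simp: indicator_def)
    qed
    have "N \<in> null_sets lebesgue" using N by (simp add: negligible_iff_null_sets)
    then have "AE x in lebesgue. x \<notin> N" by (rule AE_not_in)
    then have "AE x in lebP. x \<notin> N" by (subst AE_restrict_space_iff) auto
    then show "AE x in lebP. (\<lambda>n. indicator {a..b} x * (h x - k n x)) \<longlonglongrightarrow> 0"
      using AE_space
    proof eventually_elim
      case (elim x)
      have "(\<lambda>n. g n x) \<longlonglongrightarrow> h x" using lim[of x] elim by auto
      then have "(\<lambda>n. k n x) \<longlonglongrightarrow> h x * of_real (C / max C (cmod (h x)))"
        unfolding k_def using C(1) by (intro tendsto_intros) auto
      moreover have "max C (cmod (h x)) = C" using C(2)[of x] by auto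
      ultimately have "(\<lambda>n. k n x) \<longlonglongrightarrow> h x" using C(1) by simp
      then have "(\<lambda>n. indicator {a..b} x * (h x - k n x)) \<longlonglongrightarrow> indicator {a..b} x * (h x - h x)"
        by (intro tendsto_intros)
      then show ?case by simp
    qed
  qed
  from order_tendstoD(2)[OF this e] obtain n where "L2_sq (\<lambda>x. indicator {a..b} x * (h x - k n x)) < e"
    by (auto simp: eventually_sequentially)
  with kc that show ?thesis by blast
qed

lemma L2_bounded_Icc:
  assumes ab: "a \<le> b" and [measurable]: "f \<in> borel_measurable lebP"
    and C: "\<And>x. x \<in> {a..b} \<Longrightarrow> cmod (f x) \<le> C"
    and z: "\<And>x. 0 < x \<Longrightarrow> x \<notin> {a..b} \<Longrightarrow> f x = 0"
  shows "f \<in> L2" "L2_sq f \<le> (b - a) * C\<^sup>2"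
proof -
  have le: "(cmod (f x))\<^sup>2 \<le> indicator {a..b} x * C\<^sup>2" if "0 < x" for x
    using C[of x] z[OF that] by (auto simp: indicator_def intro: power_mono)
  show "f \<in> L2" by (rule L2_bound(1)[OF _ integrable_Icc_const le]) auto
  have "L2_sq f \<le> (LINT x|lebP. indicator {a..b} x * C\<^sup>2)"
    by (rule L2_bound(2)[OF _ integrable_Icc_const le]) auto
  with integral_Icc_const_le[OF ab, of "C\<^sup>2"] show "L2_sq f \<le> (b - a) * C\<^sup>2" by simp
qed

text \<open>Mollification is avoided: \<open>h\<close> is truncated in value, replaced by a
  continuous function, then by a polynomial uniformly on a larger interval, and the polynomial is
  multiplied by a cutoff.\<close>

lemma L2_test_fun_approx:
  assumes h: "h \<in> L2" and ab: "0 < a" "a < b"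
    and z: "\<And>x. x \<notin> {a..b} \<Longrightarrow> h x = 0" and e: "0 < e"
  obtains \<phi> where "\<phi> \<in> test_fun" "\<And>x. x \<notin> {a/2..2*b} \<Longrightarrow> \<phi> x = 0" "L2_sq (\<lambda>x. h x - \<phi> x) < e"
proof -
  have [measurable]: "h \<in> borel_measurable lebP" using h by (rule L2_measurable)
  obtain \<eta> :: "real \<Rightarrow> real" where eta: "(\<lambda>x. of_real (\<eta> x)) \<in> test_fun"
    "\<And>x. x \<in> {a..b} \<Longrightarrow> \<eta> x = 1" "\<And>x. x \<notin> {a/2..2*b} \<Longrightarrow> \<eta> x = 0" "\<And>x. 0 \<le> \<eta> x" "\<And>x. \<eta> x \<le> 1"
    by (rule smooth_cutoff_exists[OF ab]) blast
  have eta_meas [measurable]: "(\<lambda>x. complex_of_real (\<eta> x)) \<in> borel_measurable lebP"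
    using eta(1) by (rule test_fun_measurable)
  define a' b' where "a' = a/2" and "b' = 2*b"
  have ab': "0 < a'" "a' \<le> b'" using ab by (auto simp: a'_def b'_def)
  from order_tendstoD(2)[OF L2_truncation[OF h], of "e/8"] e obtain n where
    n: "L2_sq (\<lambda>x. h x - (if cmod (h x) \<le> real n then h x else 0)) < e/8"
    by (auto simp: eventually_sequentially)
  define k where "k x = (if cmod (h x) \<le> real n then h x else 0)" for x
  have [measurable]: "k \<in> borel_measurable lebP" unfolding k_def by measurable
  have kz: "k x = 0" if "x \<notin> {a..b}" for x using z[OF that] by (simp add: k_def)
  have kL: "k \<in> L2"
    by (rule L2_bound(1)[OF _ L2_integrable[OF h]]) (measurable, auto simp: k_def)
  obtain g where g: "continuous_on UNIV g" "L2_sq (\<lambda>x. indicator {a'..b'} x * (k x - g x)) < e/16"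
    by (rule L2_continuous_approx[of k a' b' "real n + 1" "e/16"]) (use ab' e in \<open>auto simp: k_def\<close>)
  \<comment> \<open>A uniform error \<delta> on \<open>{a'..b'}\<close> costs at most (b' - a')
    \<delta>^2 in squared norm, here less than e/16.\<close>
  define \<delta> where "\<delta> = sqrt (e / (32 * (b' - a' + 1)))"
  have d: "0 < \<delta>" using e ab' by (simp add: \<delta>_def)
  have d2: "(b' - a') * \<delta>\<^sup>2 < e/16"
  proof -
    have "(b' - a') * \<delta>\<^sup>2 = (b' - a') / (b' - a' + 1) * (e / 32)"
      using e ab' by (simp add: \<delta>_def)
    also have "\<dots> \<le> 1 * (e / 32)" using e ab' by (intro mult_right_mono) (auto simp: field_simps)
    finally show ?thesis using e by simp
  qed
  from Stone_Weierstrass_polynomial_function[OF compact_Icc continuous_on_subset[OF g(1)] d, of a' b']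
  obtain p where p: "polynomial_function p" "\<And>x. x \<in> {a'..b'} \<Longrightarrow> cmod (g x - p x) < \<delta>"
    by auto
  have ps: "smooth p" using p(1) by (rule polynomial_smooth)
  have [measurable]: "g \<in> borel_measurable lebP" "p \<in> borel_measurable lebP"
    using g(1) smooth_continuous_on[OF ps] continuous_on_subset by (blast intro: continuous_measurable_lebP)+
  have Lg: "(\<lambda>x. indicator {a'..b'} x * (k x - g x)) \<in> L2"
  proof -
    have "(\<lambda>x. indicator {a'..b'} x * g x) \<in> L2"
      by (rule L2_of_compact_support[OF ab']) 
        (auto simp: indicator_def intro!: continuous_on_eq[OF continuous_on_subset[OF g(1)]])
    moreover have "(\<lambda>x. indicator {a'..b'} x * k x) \<in> L2"
      by (rule L2_mult_bounded(1)[OF kL, of _ 1]) (measurable, auto simp: indicator_def)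
    ultimately show ?thesis using L2_diff by (fastforce simp: algebra_simps)
  qed
  have Lp: "(\<lambda>x. indicator {a'..b'} x * (g x - p x)) \<in> L2"
    by (rule L2_of_compact_support[OF ab']) 
        (auto simp: indicator_def intro!: continuous_on_eq[OF continuous_on_diff[OF continuous_on_subset[OF g(1)]
          smooth_continuous_on[OF ps]]])
  define \<phi> where "\<phi> x = p x * of_real (\<eta> x)" for x
  have phi: "\<phi> \<in> test_fun" unfolding \<phi>_def by (rule test_fun_mult[OF ps eta(1)])
  \<comment> \<open>Valid everywhere because \<eta> is 1 on \<open>{a..b}\<close>, where
    \<open>k\<close> lives, and 0 outside \<open>{a'..b'}\<close>: the cutoff leaves
    \<open>k\<close> intact and only shrinks the error.\<close>
  have kphi: "k x - \<phi> x = of_real (\<eta> x) *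
     (indicator {a'..b'} x * (k x - g x) + indicator {a'..b'} x * (g x - p x))" for x
    using eta(2)[of x] eta(3)[of x] kz[of x]
    by (cases "x \<in> {a'..b'}"; cases "x \<in> {a..b}") (auto simp: \<phi>_def a'_def b'_def algebra_simps)
  have "L2_sq (\<lambda>x. k x - \<phi> x) \<le> 1\<^sup>2 * L2_sq (\<lambda>x. indicator {a'..b'} x * (k x - g x) + indicator {a'..b'} x * (g x - p x))"
    unfolding kphi by (rule L2_mult_bounded(2)[OF L2_add[OF Lg Lp] eta_meas]) (use eta in auto)
  also have "\<dots> \<le> 2 * L2_sq (\<lambda>x. indicator {a'..b'} x * (k x - g x)) + 2 * L2_sq (\<lambda>x. indicator {a'..b'} x * (g x - p x))"
    using L2_sq_add_le[OF Lg Lp] by simp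
  also have "\<dots> < e / 4"
  proof -
    have "L2_sq (\<lambda>x. indicator {a'..b'} x * (g x - p x)) \<le> (b' - a') * \<delta>\<^sup>2"
      by (rule L2_bounded_Icc(2)) (use ab' in simp, measurable, use p(2) in \<open>auto intro: less_imp_le\<close>)
    then show ?thesis using d2 g(2) by simp
  qed
  finally have kp: "L2_sq (\<lambda>x. k x - \<phi> x) < e/4" .
  have "L2_sq (\<lambda>x. (h x - k x) + (k x - \<phi> x)) \<le> 2 * L2_sq (\<lambda>x. h x - k x) + 2 * L2_sq (\<lambda>x. k x - \<phi> x)"
    by (intro L2_sq_add_le L2_diff h kL test_fun_L2 phi)
  also have "\<dots> < 2 * (e/8) + 2 * (e/4)" using n kp by (simp add: k_def[symmetric])
  finally have "L2_sq (\<lambda>x. h x - \<phi> x) < e" using e by simp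
  moreover have "\<phi> x = 0" if "x \<notin> {a/2..2*b}" for x using eta(3)[OF that] by (simp add: \<phi>_def)
  ultimately show ?thesis using that phi by blast
qed

text \<open>Functions such as f / x^2 or a second primitive are at first known to be square
  integrable only on compact subsets of ]0,\<infinity>[. By Cauchy-Schwarz on its support, this is
  enough for pairing with a test function.\<close>

definition L2loc :: "(real \<Rightarrow> complex) \<Rightarrow> bool" where
  "L2loc k \<longleftrightarrow> k \<in> borel_measurable lebP \<and>
     (\<forall>a b. 0 < a \<longrightarrow> a < b \<longrightarrow> (\<lambda>x. indicator {a..b} x * k x) \<in> L2)"

lemma L2loc_measurable: "L2loc k \<Longrightarrow> k \<in> borel_measurable lebP"
  by (simp add: L2loc_def)

lemma L2loc_L2: "k \<in> L2 \<Longrightarrow> L2loc k"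
  unfolding L2loc_def
proof (intro conjI allI impI L2_mult_bounded(1)[where C=1])
  show "cmod (indicator {a..b} x) \<le> 1" for a b x :: real by (simp add: indicator_def)
qed (auto dest: L2_measurable)

lemma L2loc_continuous: "continuous_on {0<..} k \<Longrightarrow> L2loc k"
  unfolding L2loc_def
proof (intro conjI allI impI continuous_measurable_lebP)
  fix a b :: real assume k: "continuous_on {0<..} k" and ab: "0 < a" "a < b"
  then have "continuous_on {a..b} k" by (auto intro: continuous_on_subset)
  then have "continuous_on {a..b} (\<lambda>x. indicator {a..b} x * k x)"
    by (rule continuous_on_eq) auto
  with ab show "(\<lambda>x. indicator {a..b} x * k x) \<in> L2"
    by (intro L2_of_compact_support[of a b]) auto
qed

lemma L2loc_mult_continuous:
  assumes k: "L2loc k" and g: "continuous_on {0<..} g"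
  shows "L2loc (\<lambda>x. g x * k x)"
  unfolding L2loc_def
proof (intro conjI allI impI)
  have [measurable]: "k \<in> borel_measurable lebP" "g \<in> borel_measurable lebP"
    using k g by (auto intro: L2loc_measurable continuous_measurable_lebP)
  show "(\<lambda>x. g x * k x) \<in> borel_measurable lebP" by measurable
  fix a b :: real assume ab: "0 < a" "a < b"
  have "continuous_on {a..b} g" using g ab by (auto intro: continuous_on_subset)
  then obtain C where "0 \<le> C" and C: "\<And>x. x \<in> {a..b} \<Longrightarrow> cmod (g x) \<le> C"
    by (rule continuous_on_Icc_bounded) blast
  have "(\<lambda>x. (indicator {a..b} x * g x) * (indicator {a..b} x * k x)) \<in> L2"
    by (rule L2_mult_bounded(1)[where C=C])
      (use k ab C \<open>0 \<le> C\<close> in \<open>auto simp: L2loc_def indicator_def\<close>)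
  then show "(\<lambda>x. indicator {a..b} x * (g x * k x)) \<in> L2"
    by (rule back_subst[where P="\<lambda>f. f \<in> L2"]) (auto simp: indicator_def)
qed

lemma L2loc_diff:
  assumes "L2loc k" "L2loc l" shows "L2loc (\<lambda>x. k x - l x)"
  using assms L2_diff unfolding L2loc_def right_diff_distrib by fastforce

lemma L2loc_mult_test_fun_integrable:
  assumes k: "L2loc k" and phi: "\<phi> \<in> test_fun"
  shows "integrable lebP (\<lambda>x. k x * \<phi> x)"
proof -
  obtain a b where ab: "0 < a" "a < b" "\<And>x. x \<notin> {a..b} \<Longrightarrow> \<phi> x = 0"
    using phi by (rule test_funE) blast
  have "integrable lebP (\<lambda>x. (indicator {a..b} x * k x) * \<phi> x)"
    by (rule integrable_mult_L2) (use k ab phi in \<open>auto simp: L2loc_def intro: test_fun_L2\<close>)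
  then show ?thesis
    by (rule back_subst[where P="integrable lebP"]) (use ab in \<open>auto simp: fun_eq_iff indicator_def\<close>)
qed

lemma test_fun_integrable:
  assumes "\<phi> \<in> test_fun"
  shows "integrable lebP \<phi>" "integrable lebP (\<lambda>x. of_real x * \<phi> x)"
  using L2loc_mult_test_fun_integrable[OF L2loc_continuous[OF continuous_on_const] assms, of 1]
    L2loc_mult_test_fun_integrable[OF L2loc_continuous assms, of of_real]
  by (simp_all add: continuous_intros)

text \<open>On each compact interval, test functions approximate the conjugate of the restriction of
  \<open>k\<close>, and the vanishing pairings converge to the squared norm of that
  restriction.\<close>

lemma fundamental_lemma_variations:
  assumes k: "L2loc k" and 0: "\<And>\<phi>. \<phi> \<in> test_fun \<Longrightarrow> (LINT x|lebP. k x * \<phi> x) = 0"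
  shows "AE x in lebP. k x = 0"
proof -
  have *: "AE x in lebP. x \<in> {a..b} \<longrightarrow> k x = 0" if ab: "0 < a" "a < b" for a b
  proof -
    define h where "h x = cnj (indicator {a..b} x * k x)" for x
    \<comment> \<open>The window is wider than that of \<open>h\<close> because the approximating
      test functions live on \<open>{a/2..2*b}\<close>; their pairings with \<open>l\<close> and
      with \<open>k\<close> coincide.\<close>
    define l where "l x = indicator {a/2..2*b} x * k x" for x
    have kL: "(\<lambda>x. indicator {a..b} x * k x) \<in> L2" and lL: "l \<in> L2"
      using k ab unfolding L2loc_def l_def by simp_all
    have hL: "h \<in> L2"
    proof (rule L2_bound(1)[OF _ L2_integrable[OF kL]])
      have [measurable]: "k \<in> borel_measurable lebP" using k by (rule L2loc_measurable)
      show "h \<in> borel_measurable lebP"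
        unfolding h_def by (intro measurable_compose[OF _ borel_measurable_continuous_onI[of cnj]])
          (auto intro: continuous_intros)
    qed (simp add: h_def norm_mult)
    have hz: "h x = 0" if "x \<notin> {a..b}" for x using that by (simp add: h_def)
    have lh: "(LINT x|lebP. l x * h x) = of_real (L2_sq h)"
      unfolding L2_sq_def integral_complex_of_real[symmetric]
      by (rule Bochner_Integration.integral_cong)
        (use ab in \<open>auto simp: l_def h_def indicator_def complex_norm_square simp del: of_real_power\<close>)
    have bd: "(L2_sq h)\<^sup>2 \<le> L2_sq l * e" if e: "0 < e" for e
    proof -
      obtain \<phi> where phi: "\<phi> \<in> test_fun" "\<And>x. x \<notin> {a/2..2*b} \<Longrightarrow> \<phi> x = 0" "L2_sq (\<lambda>x. h x - \<phi> x) < e"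
        using L2_test_fun_approx[OF hL ab hz e] by blast
      have "(\<lambda>x. l x * \<phi> x) = (\<lambda>x. k x * \<phi> x)"
        using phi(2) by (auto simp: l_def indicator_def fun_eq_iff)
      then have "(LINT x|lebP. l x * \<phi> x) = 0" using 0[OF phi(1)] by simp
      then have "(LINT x|lebP. l x * (h x - \<phi> x)) = of_real (L2_sq h)"
        using integrable_mult_L2[OF lL hL] integrable_mult_L2[OF lL test_fun_L2[OF phi(1)]] lh
        by (simp add: right_diff_distrib)
      with Cauchy_Schwarz_L2[OF lL L2_diff[OF hL test_fun_L2[OF phi(1)]]]
      have "(L2_sq h)\<^sup>2 \<le> L2_sq l * L2_sq (\<lambda>x. h x - \<phi> x)" by simp
      also have "\<dots> \<le> L2_sq l * e" using phi(3) by (intro mult_left_mono) auto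
      finally show ?thesis .
    qed
    have "L2_sq h = 0"
    proof (rule ccontr)
      assume "L2_sq h \<noteq> 0"
      then have p: "0 < (L2_sq h)\<^sup>2" by simp
      \<comment> \<open>The error is chosen so that the bound becomes at most half of the left-hand
        side; the summand 1 keeps the denominator positive.\<close>
      have "(L2_sq h)\<^sup>2 \<le> L2_sq l * ((L2_sq h)\<^sup>2 / (2 * (L2_sq l + 1)))"
        using p by (intro bd divide_pos_pos) (auto intro: add_nonneg_pos)
      also have "\<dots> = (L2_sq h)\<^sup>2 * (L2_sq l / (2 * (L2_sq l + 1)))" by simp
      also have "\<dots> \<le> (L2_sq h)\<^sup>2 * (1/2)"
      proof (rule mult_left_mono)
        show "L2_sq l / (2 * (L2_sq l + 1)) \<le> 1/2"
        proof -
          have "0 \<le> A \<Longrightarrow> A / (2 * (A + 1)) \<le> 1/2" for A :: real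
            by (simp add: field_simps)
          from this[OF L2_sq_nonneg] show ?thesis .
        qed
      qed simp
      finally show False using p by simp
    qed
    then have "AE x in lebP. (cmod (h x))\<^sup>2 = 0"
      unfolding L2_sq_def using integral_nonneg_eq_0_iff_AE[OF L2_integrable[OF hL]] by simp
    then show ?thesis by eventually_elim (auto simp: h_def)
  qed
  \<comment> \<open>Countably many intervals exhaust ]0,\<infinity>[; the shift by 2 makes each of
    them non-degenerate, n = 0 included.\<close>
  have "AE x in lebP. \<forall>n::nat. x \<in> {1 / (real n + 2)..real n + 2} \<longrightarrow> k x = 0"
    unfolding AE_all_countable
  proof (intro allI *)
    show "1 / (real n + 2) < real n + 2" for n :: nat
      by (rule order_le_less_trans[of _ 1]) auto
  qed auto
  then show ?thesis using AE_space
  proof eventually_elim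
    case (elim x)
    then have x: "0 < x" by simp
    obtain n :: nat where n: "max x (1/x) < real n" using reals_Archimedean2 by blast
    have "1 / (real n + 2) \<le> x"
    proof -
      have "1 / x \<le> real n + 2" using n by simp
      then show ?thesis using x by (simp add: pos_divide_le_eq mult.commute)
    qed
    then show ?case using elim n by auto
  qed
qed

section \<open>Second primitives and weak second derivatives\<close>

definition vint :: "(real \<Rightarrow> complex) \<Rightarrow> real \<Rightarrow> complex" where
  "vint h x = (LINT t|lebP. indicator {..<x} t * h t)"

text \<open>Cauchy's formula for the second primitive with zero initial data: a single integral
  against the kernel (x - t)_+, to which Cauchy-Schwarz and Fubini apply directly. Both
  \<open>vint\<close> and \<open>wint\<close> are 0 for x <= 0, so that two-sided derivatives make
  sense at 0.\<close>

definition wint :: "(real \<Rightarrow> complex) \<Rightarrow> real \<Rightarrow> complex" where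
  "wint h x = (LINT t|lebP. of_real (max 0 (x - t)) * h t)"

lemma indicator_L2: "(indicator {..<x} :: real \<Rightarrow> complex) \<in> L2"
  by (rule L2_bounded_Icc[of 0 "max 0 x" _ 1]) (auto simp: indicator_def split: if_splits)

lemma hinge_L2: "(\<lambda>t. complex_of_real (max 0 (x - t))) \<in> L2"
  by (rule L2_bounded_Icc[of 0 "max 0 x" _ "max 0 x"]) auto

lemma vint_integrable: "h \<in> L2 \<Longrightarrow> integrable lebP (\<lambda>t. indicator {..<x} t * h t)"
  and wint_integrable: "h \<in> L2 \<Longrightarrow> integrable lebP (\<lambda>t. of_real (max 0 (x - t)) * h t)"
  by (intro integrable_mult_L2 indicator_L2 hinge_L2; assumption)+

lemma wint_diff: "h \<in> L2 \<Longrightarrow> k \<in> L2 \<Longrightarrow> wint (\<lambda>t. h t - k t) x = wint h x - wint k x"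
  using wint_integrable[of h x] wint_integrable[of k x] by (simp add: wint_def right_diff_distrib)

lemma vint_nonpos: "x \<le> 0 \<Longrightarrow> vint h x = 0"
  unfolding vint_def by (rule integral_eq_zero_AE) (auto intro!: AE_I2 simp: indicator_def)

lemma wint_nonpos: "x \<le> 0 \<Longrightarrow> wint h x = 0"
  unfolding wint_def by (rule integral_eq_zero_AE) (auto intro!: AE_I2 simp: max_def)

lemma vint_diff_bound:
  assumes h: "h \<in> L2" shows "(cmod (vint h y - vint h x))\<^sup>2 \<le> \<bar>y - x\<bar> * L2_sq h"
proof -
  have *: "(cmod (vint h y - vint h x))\<^sup>2 \<le> (y - x) * L2_sq h" if "x \<le> y" for x y
  proof -
    let ?k = "\<lambda>t. indicator {..<y} t - indicator {..<x} t :: complex"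
    have k: "?k \<in> L2" "L2_sq ?k \<le> (y - x) * 1\<^sup>2"
      by (rule L2_bounded_Icc[of x y _ 1]; use that in \<open>auto simp: indicator_def\<close>)+
    have "vint h y - vint h x = (LINT t|lebP. ?k t * h t)"
      using vint_integrable[OF h, of x] vint_integrable[OF h, of y]
      by (simp add: vint_def left_diff_distrib)
    then have "(cmod (vint h y - vint h x))\<^sup>2 \<le> L2_sq ?k * L2_sq h"
      using Cauchy_Schwarz_L2[OF k(1) h] by simp
    also have "\<dots> \<le> (y - x) * L2_sq h" using k(2) by (intro mult_right_mono) auto
    finally show ?thesis .
  qed
  from *[of x y] *[of y x] show ?thesis by (cases "x \<le> y") (auto simp: norm_minus_commute)
qed

text \<open>The Taylor remainder is the pairing of \<open>h\<close> with a kernel supported between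
  x and y and bounded by |y - x|. Cauchy-Schwarz gives order 3/2, so \<open>wint h\<close> is
  differentiable everywhere although \<open>h\<close> is only square integrable.\<close>

lemma wint_taylor_bound:
  assumes h: "h \<in> L2"
  shows "(cmod (wint h y - wint h x - of_real (y - x) * vint h x))\<^sup>2 \<le> \<bar>y - x\<bar> ^ 3 * L2_sq h"
proof -
  let ?k = "\<lambda>t. of_real (max 0 (y - t)) - of_real (max 0 (x - t)) - of_real (y - x) * indicator {..<x} t :: complex"
  have k: "?k \<in> L2" "L2_sq ?k \<le> (max x y - min x y) * \<bar>y - x\<bar>\<^sup>2"
  proof -
    have kr: "?k t = of_real (max 0 (y - t) - max 0 (x - t) - (y - x) * indicator {..<x} t)" for t
      by (simp add: indicator_def)
    have b: "cmod (?k t) \<le> \<bar>y - x\<bar>" for t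
      unfolding kr norm_of_real by (auto simp: indicator_def max_def abs_if)
    have z: "?k t = 0" if "t \<notin> {min x y..max x y}" for t
      unfolding kr using that by (auto simp: indicator_def max_def min_def split: if_splits)
    show "?k \<in> L2" "L2_sq ?k \<le> (max x y - min x y) * \<bar>y - x\<bar>\<^sup>2"
      by (rule L2_bounded_Icc[OF _ _ b z]; simp)+
  qed
  have "wint h y - wint h x - of_real (y - x) * vint h x = (LINT t|lebP. ?k t * h t)"
    using wint_integrable[OF h, of x] wint_integrable[OF h, of y] vint_integrable[OF h, of x]
    by (simp add: wint_def vint_def left_diff_distrib mult.assoc del: of_real_diff)
  then have "(cmod (wint h y - wint h x - of_real (y - x) * vint h x))\<^sup>2 \<le> L2_sq ?k * L2_sq h"
    using Cauchy_Schwarz_L2[OF k(1) h] by simp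
  also have "\<dots> \<le> ((max x y - min x y) * \<bar>y - x\<bar>\<^sup>2) * L2_sq h"
    using k(2) by (intro mult_right_mono) auto
  also have "(max x y - min x y) * \<bar>y - x\<bar>\<^sup>2 = \<bar>y - x\<bar> ^ 3"
    by (simp add: max_def min_def power3_eq_cube power2_eq_square)
  finally show ?thesis .
qed

lemma vint_continuous:
  assumes h: "h \<in> L2" shows "continuous_on S (vint h)"
proof (rule continuous_at_imp_continuous_on, rule ballI)
  fix x
  have "((\<lambda>y. sqrt (\<bar>y - x\<bar> * L2_sq h)) \<longlongrightarrow> sqrt (\<bar>x - x\<bar> * L2_sq h)) (at x)"
    by (intro tendsto_intros)
  then have "((\<lambda>y. sqrt (\<bar>y - x\<bar> * L2_sq h)) \<longlongrightarrow> 0) (at x)" by simp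
  then have "((\<lambda>y. vint h y - vint h x) \<longlongrightarrow> 0) (at x)"
    by (rule Lim_null_comparison[rotated])
      (use vint_diff_bound[OF h] in \<open>auto intro!: always_eventually real_le_rsqrt\<close>)
  then show "isCont (vint h) x" by (simp add: isCont_def LIM_zero_iff)
qed

lemma wint_has_derivative:
  assumes h: "h \<in> L2" shows "(wint h has_vector_derivative vint h x) (at x)"
  unfolding has_vector_derivative_def has_derivative_at2
proof (intro conjI bounded_linear_intros)
  have "((\<lambda>y. sqrt (\<bar>y - x\<bar> * L2_sq h)) \<longlongrightarrow> sqrt (\<bar>x - x\<bar> * L2_sq h)) (at x)"
    by (intro tendsto_intros)
  then have *: "((\<lambda>y. sqrt (\<bar>y - x\<bar> * L2_sq h)) \<longlongrightarrow> 0) (at x)" by simp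
  show "((\<lambda>y. (1 / norm (y - x)) *\<^sub>R (wint h y - (wint h x + (y - x) *\<^sub>R vint h x))) \<longlongrightarrow> 0) (at x)"
  proof (rule Lim_null_comparison[OF _ *], unfold eventually_at_filter, intro always_eventually allI impI)
    fix y assume "y \<noteq> x"
    let ?N = "cmod (wint h y - (wint h x + (y - x) *\<^sub>R vint h x))"
    have "?N\<^sup>2 \<le> \<bar>y - x\<bar> ^ 3 * L2_sq h"
      using wint_taylor_bound[OF h, of y x] by (simp add: scaleR_conv_of_real diff_diff_eq)
    then have "(?N / \<bar>y - x\<bar>)\<^sup>2 \<le> \<bar>y - x\<bar> * L2_sq h"
      using \<open>y \<noteq> x\<close> by (simp add: power_divide divide_simps power2_eq_square power3_eq_cube mult_ac)
    then have "?N / \<bar>y - x\<bar> \<le> sqrt (\<bar>y - x\<bar> * L2_sq h)" by (rule real_le_rsqrt)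
    then show "norm ((1 / norm (y - x)) *\<^sub>R (wint h y - (wint h x + (y - x) *\<^sub>R vint h x))) \<le> sqrt (\<bar>y - x\<bar> * L2_sq h)"
      by (simp add: divide_inverse mult.commute)
  qed
qed

lemma wint_continuous: "h \<in> L2 \<Longrightarrow> continuous_on S (wint h)"
  by (meson continuous_on_vector_derivative has_vector_derivative_at_within wint_has_derivative)

lemma antiderivative_vanishes:
  fixes F :: "real \<Rightarrow> complex"
  assumes d: "\<And>x. (F has_vector_derivative f x) (at x)" and z: "\<And>x. x < a \<Longrightarrow> f x = 0" "F 0 = 0" "0 < a"
    and x: "x < a"
  shows "F x = 0"
proof -
  have "(F has_vector_derivative 0) (at y within {..<a})" if "y \<in> {..<a}" for y
    using d[of y] z(1)[of y] that by (auto intro: has_vector_derivative_at_within)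
  then obtain c where c: "\<And>x. x \<in> {..<a} \<Longrightarrow> F x = c"
    using has_vector_derivative_zero_constant[of "{..<a}" F] by auto
  from c[of x] c[of 0] z x show ?thesis by auto
qed

text \<open>To the left of the support the second primitive is 0; to the right it is x times the
  moment of order 0 minus the moment of order 1. The two moment conditions are exactly what compact
  support needs.\<close>

lemma wint_test_fun:
  assumes phi: "\<phi> \<in> test_fun" and m0: "(LINT x|lebP. \<phi> x) = 0" and m1: "(LINT x|lebP. of_real x * \<phi> x) = 0"
  shows "wint \<phi> \<in> test_fun" "deriv2 (wint \<phi>) = \<phi>"
proof -
  obtain a b where ab: "0 < a" "a < b" "\<And>x. x \<notin> {a..b} \<Longrightarrow> \<phi> x = 0" and s: "smooth \<phi>"
    using phi by (rule test_funE) blast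
  obtain F where F: "\<And>x. (F has_vector_derivative \<phi> x) (at x)" "F 0 = 0"
    using continuous_antiderivative[OF smooth_continuous_on[OF s]] by blast
  have sF: "smooth F" using smoothI[OF F(1) s] .
  obtain G where G: "\<And>x. (G has_vector_derivative F x) (at x)" "G 0 = 0"
    using continuous_antiderivative[OF smooth_continuous_on[OF sF]] by blast
  have sG: "smooth G" using smoothI[OF G(1) sF] .
  have F0: "F x = 0" if "x < a" for x
    by (rule antiderivative_vanishes[OF F(1) _ F(2) ab(1) that]) (use ab(3) in auto)
  have G0: "G x = 0" if "x < a" for x
    by (rule antiderivative_vanishes[OF G(1) F0 G(2) ab(1) that])
  have wG: "wint \<phi> x = G x" for x
  proof (cases "0 < x")
    case False
    with G0[of x] ab show ?thesis by (simp add: wint_nonpos)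
  next
    case True
    \<comment> \<open>The base point lies to the left of the support of \<phi>, where
      \<open>F\<close> and \<open>G\<close> vanish, and inside ]0,\<infinity>[, as
      \<open>integral_FTC_lebP\<close> demands.\<close>
    define p where "p = min (a/2) x"
    have p: "0 < p" "p \<le> x" "p < a" using True ab by (auto simp: p_def)
    have "wint \<phi> x = (of_real (x - x) * F x + G x) - (of_real (x - p) * F p + G p)"
      unfolding wint_def
    proof (rule integral_FTC_lebP[OF p(1,2)])
      show "continuous_on {p..x} (\<lambda>t. of_real (max 0 (x - t)) * \<phi> t)"
        by (intro continuous_intros smooth_continuous_on s)
      show "of_real (max 0 (x - t)) * \<phi> t = 0" if "0 < t" "t \<notin> {p..x}" for t
      proof (cases "t < p")
        case True
        then show ?thesis using p ab(3)[of t] by simp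
      next
        case False
        then show ?thesis using that by simp
      qed
      show "((\<lambda>t. of_real (x - t) * F t + G t) has_vector_derivative of_real (max 0 (x - t)) * \<phi> t) (at t)"
        if "p \<le> t" "t \<le> x" for t
      proof -
        have "((\<lambda>t. complex_of_real (x - t)) has_vector_derivative of_real (-1)) (at t)"
          by (rule has_vector_derivative_of_real) (auto intro!: derivative_eq_intros)
        from has_vector_derivative_add[OF has_vector_derivative_mult[OF this F(1)[of t]] G(1)[of t]]
        show ?thesis using that by (simp add: max_def)
      qed
    qed
    then show ?thesis using F0[OF p(3)] G0[OF p(3)] by simp
  qed
  then have wG: "wint \<phi> = G" by auto
  note i = test_fun_integrable[OF phi]
  have "G x = 0" if x: "x \<notin> {a/2..b}" for x
  proof (cases "x < a")
    case True then show ?thesis using G0 by simp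
  next
    case False
    then have "b < x" using x ab by auto
    have "wint \<phi> x = (LINT t|lebP. of_real x * \<phi> t - of_real t * \<phi> t)"
      unfolding wint_def
    proof (rule Bochner_Integration.integral_cong)
      fix t show "of_real (max 0 (x - t)) * \<phi> t = of_real x * \<phi> t - of_real t * \<phi> t"
        using ab(3)[of t] \<open>b < x\<close> by (cases "t \<le> b") (auto simp: left_diff_distrib)
    qed simp
    also have "\<dots> = 0" using i m0 m1 by simp
    finally show ?thesis by (simp add: wG)
  qed
  then show "wint \<phi> \<in> test_fun" using ab sG unfolding wG by (intro test_funI[of G "a/2" b]) auto
  show "deriv2 (wint \<phi>) = \<phi>" unfolding wG by (rule deriv2_eqI[OF G(1) F(1)])
qed

lemma locally_constant_derivative_zero:
  fixes f :: "real \<Rightarrow> 'a::real_normed_vector"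
  assumes "(f has_vector_derivative f') (at x)" "open S" "x \<in> S" "\<And>y. y \<in> S \<Longrightarrow> f y = c"
  shows "f' = 0"
proof -
  have "(f has_vector_derivative 0) (at x)"
    by (rule has_vector_derivative_transform_within_open[OF has_vector_derivative_const[of c] assms(2,3)])
      (use assms(4) in auto)
  with assms(1) show ?thesis using vector_derivative_unique_at by blast
qed

lemma smooth_step_derivatives:
  obtains \<kappa> \<kappa>' \<kappa>'' :: "real \<Rightarrow> complex" where "smooth \<kappa>" "\<kappa>' \<in> test_fun" "\<kappa>'' \<in> test_fun"
    "\<And>x. (\<kappa> has_vector_derivative \<kappa>' x) (at x)" "\<And>x. (\<kappa>' has_vector_derivative \<kappa>'' x) (at x)"
    "\<And>x. x \<le> 1 \<Longrightarrow> \<kappa> x = 0" "\<And>x. 2 \<le> x \<Longrightarrow> \<kappa> x = 1"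
    "\<And>x. cmod (\<kappa> x) \<le> 1" "\<And>x. cmod (1 - \<kappa> x) \<le> 1"
    "\<And>x. x \<notin> {1..2} \<Longrightarrow> \<kappa>' x = 0" "\<And>x. x \<notin> {1..2} \<Longrightarrow> \<kappa>'' x = 0"
proof -
  obtain \<kappa> :: "real \<Rightarrow> real" where k: "smooth (\<lambda>x. of_real (\<kappa> x))"
    "\<And>x. x \<le> 1 \<Longrightarrow> \<kappa> x = 0" "\<And>x. 2 \<le> x \<Longrightarrow> \<kappa> x = 1" "\<And>x. 0 \<le> \<kappa> x" "\<And>x. \<kappa> x \<le> 1"
    by (rule smooth_step_exists) blast
  obtain \<rho> where r: "smooth \<rho>" "\<And>x. ((\<lambda>x. of_real (\<kappa> x)) has_vector_derivative \<rho> x) (at x)"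
    using smooth_obtain_derivative[OF k(1)] by blast
  have rz: "\<rho> x = 0" if "x \<notin> {1..2}" for x
  proof (cases "x < 1")
    case True
    then show ?thesis
      by (intro locally_constant_derivative_zero[OF r(2), of "{..<1}" x 0]) (use k(2) in auto)
  next
    case False
    with that show ?thesis
      by (intro locally_constant_derivative_zero[OF r(2), of "{2<..}" x 1]) (use k(3) in auto)
  qed
  have rt: "\<rho> \<in> test_fun" by (rule test_funI[OF r(1) _ _ rz]) auto
  obtain \<rho>' where r': "\<rho>' \<in> test_fun" "\<And>x. (\<rho> has_vector_derivative \<rho>' x) (at x)"
    using rt by (rule test_fun_derivatives) blast
  have r'z: "\<rho>' x = 0" if "x \<notin> {1..2}" for x
    using rz that by (intro locally_constant_derivative_zero[OF r'(2), of "- {1..2}" x 0]) auto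
  show ?thesis
  proof (rule that[OF k(1) rt r'(1) r(2) r'(2)])
    show "cmod (1 - of_real (\<kappa> x)) \<le> 1" for x
    proof -
      have "1 - complex_of_real (\<kappa> x) = of_real (1 - \<kappa> x)" by simp
      then have "cmod (1 - of_real (\<kappa> x)) = \<bar>1 - \<kappa> x\<bar>" by (simp only: norm_of_real)
      then show ?thesis using k(4,5)[of x] by simp
    qed
    show "cmod (of_real (\<kappa> x)) \<le> 1" for x using k(4,5)[of x] by simp
  qed (simp_all add: k(2,3) rz r'z)
qed

lemma test_fun_moments:
  obtains \<rho>\<^sub>0 \<rho>\<^sub>1 where "\<rho>\<^sub>0 \<in> test_fun" "\<rho>\<^sub>1 \<in> test_fun"
    "(LINT x|lebP. \<rho>\<^sub>0 x) = 1" "(LINT x|lebP. of_real x * \<rho>\<^sub>0 x) = 0"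
    "(LINT x|lebP. \<rho>\<^sub>1 x) = 0" "(LINT x|lebP. of_real x * \<rho>\<^sub>1 x) = 1"
proof -
  obtain \<kappa> \<rho> \<rho>' :: "real \<Rightarrow> complex" where rt: "\<rho> \<in> test_fun" and r': "\<rho>' \<in> test_fun" "\<And>x. (\<rho> has_vector_derivative \<rho>' x) (at x)"
    and r: "\<And>x. (\<kappa> has_vector_derivative \<rho> x) (at x)"
    and k: "\<And>x. x \<le> 1 \<Longrightarrow> \<kappa> x = 0" "\<And>x. 2 \<le> x \<Longrightarrow> \<kappa> x = 1"
    and rz: "\<And>x. x \<notin> {1..2} \<Longrightarrow> \<rho> x = 0" and r'z: "\<And>x. x \<notin> {1..2} \<Longrightarrow> \<rho>' x = 0"
    by (rule smooth_step_derivatives) blast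
  have X: "((\<lambda>x. complex_of_real x) has_vector_derivative 1) (at x)" for x
    using has_vector_derivative_of_real[OF DERIV_ident] by simp
  have c: "continuous_on S \<rho>" "continuous_on S \<rho>'" for S
    using rt r'(1) by (auto intro: smooth_continuous_on test_fun_smooth)
  have r12: "\<rho> 3 = 0" "\<rho> (1/2) = 0" using rz by auto
  have "(LINT x|lebP. \<rho> x) = \<kappa> 3 - \<kappa> (1/2)"
    by (rule integral_FTC_lebP) (use rz r c in auto)
  then have i1: "(LINT x|lebP. \<rho> x) = 1" using k by simp
  have "(LINT x|lebP. \<rho>' x) = \<rho> 3 - \<rho> (1/2)"
    by (rule integral_FTC_lebP) (use r'z r' c in auto)
  then have i2: "(LINT x|lebP. \<rho>' x) = 0" using r12 by simp
  have "(LINT x|lebP. of_real x * \<rho>' x) = (of_real 3 * \<rho> 3 - \<kappa> 3) - (of_real (1/2) * \<rho> (1/2) - \<kappa> (1/2))"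
  proof (rule integral_FTC_lebP)
    show "((\<lambda>x. of_real x * \<rho> x - \<kappa> x) has_vector_derivative of_real x * \<rho>' x) (at x)" for x
      using has_vector_derivative_diff[OF has_vector_derivative_mult[OF X r'(2)] r] by simp
  qed (use r'z c in \<open>auto intro!: continuous_intros\<close>)
  then have i3: "(LINT x|lebP. of_real x * \<rho>' x) = -1" using k r12 by simp
  note i = test_fun_integrable
  \<comment> \<open>The derivative \<rho> of the step has integral 1, and -\<rho>' has moments 0 and
    1; subtracting c times the latter from \<rho> removes its first moment c.\<close>
  define c where "c = (LINT x|lebP. of_real x * \<rho> x)"
  show ?thesis
  proof (rule that[of "\<lambda>x. \<rho> x - c * (- 1 * \<rho>' x)" "\<lambda>x. - 1 * \<rho>' x"])
    show "(\<lambda>x. \<rho> x - c * (- 1 * \<rho>' x)) \<in> test_fun" "(\<lambda>x. - 1 * \<rho>' x) \<in> test_fun"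
      by (intro test_fun_diff test_fun_cmult rt r')+
    have "(\<lambda>x. of_real x * (\<rho> x - c * (- 1 * \<rho>' x))) = (\<lambda>x. of_real x * \<rho> x + c * (of_real x * \<rho>' x))"
      by (simp add: algebra_simps)
    then show "(LINT x|lebP. of_real x * (\<rho> x - c * (- 1 * \<rho>' x))) = 0"
      using i3 i[OF rt] i[OF r'(1)] by (simp add: c_def)
  qed (use i1 i2 i3 i[OF rt] i[OF r'(1)] in simp_all)
qed

text \<open>The du Bois-Reymond lemma: every test function is, up to a combination of two fixed ones, the second
  derivative of a test function.\<close>

lemma weak_deriv2_zero_affine:
  assumes k: "L2loc k" and 0: "\<And>\<phi>. \<phi> \<in> test_fun \<Longrightarrow> (LINT x|lebP. k x * deriv2 \<phi> x) = 0"
  obtains A B where "AE x in lebP. k x = A + B * of_real x"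
proof -
  obtain \<rho>\<^sub>0 \<rho>\<^sub>1 where r: "\<rho>\<^sub>0 \<in> test_fun" "\<rho>\<^sub>1 \<in> test_fun"
    "(LINT x|lebP. \<rho>\<^sub>0 x) = 1" "(LINT x|lebP. of_real x * \<rho>\<^sub>0 x) = 0"
    "(LINT x|lebP. \<rho>\<^sub>1 x) = 0" "(LINT x|lebP. of_real x * \<rho>\<^sub>1 x) = 1"
    by (rule test_fun_moments) blast
  \<comment> \<open>These pairings turn out to be the coefficients, because the moments of the two
    fixed test functions make them dual to 1 and x.\<close>
  define A B where "A = (LINT x|lebP. k x * \<rho>\<^sub>0 x)" and "B = (LINT x|lebP. k x * \<rho>\<^sub>1 x)"
  have i: "integrable lebP f" "integrable lebP (\<lambda>x. of_real x * f x)" "integrable lebP (\<lambda>x. k x * f x)"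
    if "f \<in> test_fun" for f
    using test_fun_integrable[OF that] L2loc_mult_test_fun_integrable[OF k that] by simp_all
  have lin: "continuous_on {0<..} (\<lambda>x. A + B * complex_of_real x)" by (intro continuous_intros)
  have "AE x in lebP. k x - (A + B * of_real x) = 0"
  proof (rule fundamental_lemma_variations)
    show "L2loc (\<lambda>x. k x - (A + B * of_real x))"
      by (rule L2loc_diff[OF k L2loc_continuous[OF lin]])
    fix \<phi> assume phi: "\<phi> \<in> test_fun"
    define m\<^sub>0 m\<^sub>1 where "m\<^sub>0 = (LINT x|lebP. \<phi> x)" and "m\<^sub>1 = (LINT x|lebP. of_real x * \<phi> x)"
    define \<psi> where "\<psi> x = \<phi> x - m\<^sub>0 * \<rho>\<^sub>0 x - m\<^sub>1 * \<rho>\<^sub>1 x" for x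
    have psi: "\<psi> \<in> test_fun" unfolding \<psi>_def by (intro test_fun_diff test_fun_cmult phi r)
    have "(LINT x|lebP. \<psi> x) = 0"
      using i[OF phi] i[OF r(1)] i[OF r(2)] r by (simp add: \<psi>_def m\<^sub>0_def)
    moreover have "(LINT x|lebP. of_real x * \<psi> x) = 0"
    proof -
      have "(\<lambda>x. of_real x * \<psi> x) = (\<lambda>x. of_real x * \<phi> x - m\<^sub>0 * (of_real x * \<rho>\<^sub>0 x) - m\<^sub>1 * (of_real x * \<rho>\<^sub>1 x))"
        by (simp add: \<psi>_def algebra_simps)
      then show ?thesis using i[OF phi] i[OF r(1)] i[OF r(2)] r by (simp add: m\<^sub>1_def)
    qed
    ultimately have w: "wint \<psi> \<in> test_fun" "deriv2 (wint \<psi>) = \<psi>"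
      using wint_test_fun[OF psi] by auto
    have "(LINT x|lebP. k x * \<psi> x) = 0" using 0[OF w(1)] w(2) by simp
    moreover have "(\<lambda>x. k x * \<psi> x) = (\<lambda>x. k x * \<phi> x - m\<^sub>0 * (k x * \<rho>\<^sub>0 x) - m\<^sub>1 * (k x * \<rho>\<^sub>1 x))"
      by (simp add: \<psi>_def algebra_simps)
    ultimately have "(LINT x|lebP. k x * \<phi> x) = m\<^sub>0 * A + m\<^sub>1 * B"
      using i[OF phi] i[OF r(1)] i[OF r(2)] by (simp add: A_def B_def algebra_simps)
    moreover have "(\<lambda>x. (k x - (A + B * of_real x)) * \<phi> x) = (\<lambda>x. k x * \<phi> x - A * \<phi> x - B * (of_real x * \<phi> x))"
      by (simp add: algebra_simps)
    ultimately show "(LINT x|lebP. (k x - (A + B * of_real x)) * \<phi> x) = 0"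
      using i[OF phi] by (simp add: m\<^sub>0_def m\<^sub>1_def algebra_simps)
  qed
  then show ?thesis by (intro that[of A B]) simp
qed

text \<open>The hinge (x - t)_+ is a fundamental solution of the second derivative.\<close>

lemma integral_hinge_deriv2:
  assumes phi: "\<phi> \<in> test_fun" and t: "0 < t"
  shows "(LINT x|lebP. of_real (max 0 (x - t)) * deriv2 \<phi> x) = \<phi> t"
proof -
  obtain \<phi>' where d: "\<phi>' \<in> test_fun" "deriv2 \<phi> \<in> test_fun"
    "\<And>x. (\<phi> has_vector_derivative \<phi>' x) (at x)" "\<And>x. (\<phi>' has_vector_derivative deriv2 \<phi> x) (at x)"
    using phi by (rule test_fun_derivatives) blast
  obtain a b where ab: "\<And>x. x \<notin> {a..b} \<Longrightarrow> \<phi> x = 0" using phi by (rule test_funE) blast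
  obtain a' b' where ab': "\<And>x. x \<notin> {a'..b'} \<Longrightarrow> \<phi>' x = 0" using d(1) by (rule test_funE) blast
  obtain a'' b'' where ab'': "\<And>x. x \<notin> {a''..b''} \<Longrightarrow> deriv2 \<phi> x = 0" using d(2) by (rule test_funE) blast
  \<comment> \<open>Beyond \<open>t\<close> and the three supports, so that the boundary terms at
    \<open>q\<close> vanish.\<close>
  define q where "q = max t (max b (max b' b'')) + 1"
  have "t \<le> q" and qs: "b < q" "b' < q" "b'' < q" by (auto simp: q_def)
  then have q: "t \<le> q" "\<phi> q = 0" "\<phi>' q = 0" and q4: "\<And>x. q < x \<Longrightarrow> deriv2 \<phi> x = 0"
    using ab[of q] ab'[of q] ab'' by auto
  have "(LINT x|lebP. of_real (max 0 (x - t)) * deriv2 \<phi> x) =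
      (of_real (q - t) * \<phi>' q - \<phi> q) - (of_real (t - t) * \<phi>' t - \<phi> t)"
  proof (rule integral_FTC_lebP[OF t q(1)])
    show "continuous_on {t..q} (\<lambda>x. of_real (max 0 (x - t)) * deriv2 \<phi> x)"
      by (intro continuous_intros smooth_continuous_on test_fun_smooth d)
    show "of_real (max 0 (x - t)) * deriv2 \<phi> x = 0" if "0 < x" "x \<notin> {t..q}" for x
      using that q4[of x] by (cases "x < t") auto
    show "((\<lambda>x. of_real (x - t) * \<phi>' x - \<phi> x) has_vector_derivative of_real (max 0 (x - t)) * deriv2 \<phi> x) (at x)"
      if "t \<le> x" for x
    proof -
      have "((\<lambda>x. complex_of_real (x - t)) has_vector_derivative of_real 1) (at x)"
        by (rule has_vector_derivative_of_real) (auto intro!: derivative_eq_intros)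
      from has_vector_derivative_diff[OF has_vector_derivative_mult[OF this d(4)] d(3)]
      show ?thesis using that by (simp add: max_def)
    qed
  qed
  then show ?thesis using q by simp
qed

lemma cmod_indicator_mult: "cmod (indicator S x * z) = indicator S x * cmod z"
  by (simp add: indicator_def norm_mult)

lemma L2_norm_function:
  assumes "h \<in> L2" shows "(\<lambda>x. complex_of_real (cmod (h x))) \<in> L2" "L2_sq (\<lambda>x. of_real (cmod (h x))) = L2_sq h"
  using assms by (auto simp: L2_def L2_sq_def)

text \<open>Fubini reduces the claim to the kernel of \<open>wint\<close>, for which it is
  \<open>integral_hinge_deriv2\<close>.\<close>

lemma wint_weak_deriv2:
  assumes h: "h \<in> L2" and phi: "\<phi> \<in> test_fun"
  shows "(LINT x|lebP. wint h x * deriv2 \<phi> x) = (LINT x|lebP. h x * \<phi> x)"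
proof -
  interpret pair_sigma_finite lebP lebP by (rule pair_sigma_finite_lebP)
  have d: "deriv2 \<phi> \<in> test_fun" using phi by (rule test_fun_derivatives)
  have [measurable]: "h \<in> borel_measurable lebP" "deriv2 \<phi> \<in> borel_measurable lebP"
    using h d by (auto intro: L2_measurable test_fun_measurable)
  have [measurable]: "(\<lambda>p. fst p - snd p) \<in> borel_measurable (lebP \<Otimes>\<^sub>M lebP)"
    by (intro borel_measurable_diff measurable_compose[OF measurable_fst measurable_ident_lebP]
        measurable_compose[OF measurable_snd measurable_ident_lebP])
  define f where "f x t = of_real (max 0 (x - t)) * h t * deriv2 \<phi> x" for x t
  note hn = L2_norm_function(1)[OF h]
  \<comment> \<open>The inner integral of the modulus is the second primitive of |h|, a continuous
    function, times the modulus of a test function; this yields absolute integrability.\<close>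
  have inner: "(\<lambda>x. LINT t|lebP. norm (f x t)) = (\<lambda>x. cmod (wint (\<lambda>t. of_real (cmod (h t))) x * deriv2 \<phi> x))"
  proof
    fix x
    have "wint (\<lambda>t. of_real (cmod (h t))) x = of_real (LINT t|lebP. max 0 (x - t) * cmod (h t))"
      unfolding wint_def by (simp flip: of_real_mult)
    moreover have "0 \<le> (LINT t|lebP. max 0 (x - t) * cmod (h t))"
      by (rule Bochner_Integration.integral_nonneg) auto
    ultimately show "(LINT t|lebP. norm (f x t)) = cmod (wint (\<lambda>t. of_real (cmod (h t))) x * deriv2 \<phi> x)"
      by (simp add: f_def norm_mult)
  qed
  have int: "integrable (lebP \<Otimes>\<^sub>M lebP) (case_prod f)"
  proof (rule Fubini_integrable)
    show "case_prod f \<in> borel_measurable (lebP \<Otimes>\<^sub>M lebP)"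
      unfolding f_def case_prod_beta by measurable
    show "integrable lebP (\<lambda>x. LINT t|lebP. norm (case_prod f (x, t)))"
      using L2loc_mult_test_fun_integrable[OF L2loc_continuous[OF wint_continuous[OF hn]] d]
      by (simp add: inner)
    show "AE x in lebP. integrable lebP (\<lambda>t. case_prod f (x, t))"
      using wint_integrable[OF h] by (intro AE_I2) (simp add: f_def)
  qed
  have "(LINT x|lebP. wint h x * deriv2 \<phi> x) = (LINT x|lebP. LINT t|lebP. f x t)"
    by (simp add: f_def wint_def)
  also have "\<dots> = (LINT t|lebP. LINT x|lebP. f x t)"
    using Fubini_integral[OF int] by simp
  also have "\<dots> = (LINT t|lebP. h t * \<phi> t)"
  proof (rule Bochner_Integration.integral_cong)
    fix t assume "t \<in> space lebP"
    then have "(LINT x|lebP. of_real (max 0 (x - t)) * deriv2 \<phi> x) = \<phi> t"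
      using integral_hinge_deriv2[OF phi] by simp
    moreover have "(\<lambda>x. f x t) = (\<lambda>x. h t * (of_real (max 0 (x - t)) * deriv2 \<phi> x))"
      by (simp add: f_def mult_ac)
    ultimately show "(LINT x|lebP. f x t) = h t * \<phi> t" by simp
  qed simp
  finally show ?thesis .
qed

section \<open>Hardy's inequality\<close>

lemma nn_integral_lebP_has_integral:
  fixes f :: "real \<Rightarrow> real"
  assumes [measurable]: "f \<in> borel_measurable borel" "S \<in> sets borel"
    and pos: "\<And>x. x \<in> S \<Longrightarrow> 0 \<le> f x" and z: "\<And>x. x \<in> S \<Longrightarrow> x \<le> 0 \<Longrightarrow> f x = 0"
    and I: "(f has_integral I) S"
  shows "(\<integral>\<^sup>+x. ennreal (f x) * indicator S x \<partial>lebP) = ennreal I"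
proof -
  have "(\<integral>\<^sup>+x. ennreal (f x) * indicator S x \<partial>lebP) =
      (\<integral>\<^sup>+x. ennreal (f x) * indicator S x * indicator {0<..} x \<partial>lebesgue)"
    by (rule nn_integral_restrict_space) auto
  also have "\<dots> = (\<integral>\<^sup>+x. ennreal (f x) * indicator S x \<partial>lebesgue)"
    by (rule nn_integral_cong) (use z in \<open>auto simp: indicator_def not_less\<close>)
  also have "\<dots> = (\<integral>\<^sup>+x. ennreal (f x) * indicator S x \<partial>lborel)"
    by (rule nn_integral_completion)
  also have "\<dots> = ennreal I" by (rule nn_integral_has_integral_lebesgue'[OF pos I])
  finally show ?thesis .
qed

text \<open>Schur's test: the Cauchy--Schwarz inequality is applied with the weight \<open>t powr (1/4)\<close>.\<close>

lemma Hardy_nn_integral: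
  fixes g :: "real \<Rightarrow> real"
  assumes [measurable]: "g \<in> borel_measurable lebP" and g0: "\<And>x. 0 \<le> g x"
  shows "(\<integral>\<^sup>+x. (\<integral>\<^sup>+t. indicator {..<x} t * ennreal (g t) \<partial>lebP)\<^sup>2 * ennreal (1 / x\<^sup>2) \<partial>lebP)
    \<le> 4 * (\<integral>\<^sup>+t. ennreal ((g t)\<^sup>2) \<partial>lebP)"
proof -
  interpret pair_sigma_finite lebP lebP by (rule pair_sigma_finite_lebP)
  have [measurable]: "(\<lambda>x::real. x powr a) \<in> borel_measurable borel" for a by measurable
  have powm [measurable]: "(\<lambda>x::real. x powr a) \<in> borel_measurable lebP" for a
    by (rule borel_measurable_lebP) measurable
  have ind [measurable]: "(\<lambda>p. indicator {..<fst p} (snd p) :: ennreal) \<in> borel_measurable (lebP \<Otimes>\<^sub>M lebP)"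
  proof -
    have [measurable]: "fst \<in> borel_measurable (lebP \<Otimes>\<^sub>M lebP)" "snd \<in> borel_measurable (lebP \<Otimes>\<^sub>M lebP)"
      using measurable_compose[OF measurable_fst[of lebP lebP] measurable_ident_lebP]
        measurable_compose[OF measurable_snd[of lebP lebP] measurable_ident_lebP] by (simp_all add: comp_def)
    have "(\<lambda>p. if snd p < fst p then 1 else 0 :: ennreal) \<in> borel_measurable (lebP \<Otimes>\<^sub>M lebP)"
      by measurable
    then show ?thesis by (simp add: indicator_def of_bool_def)
  qed
  have ind1 [measurable]: "(\<lambda>t. indicator {..<x} t :: ennreal) \<in> borel_measurable lebP" for x :: real
    by (rule borel_measurable_lebP) measurable
  define a where "a x = (\<integral>\<^sup>+t. indicator {..<x} t * ennreal (g t) \<partial>lebP)" for x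
  define k where "k x = (\<integral>\<^sup>+t. indicator {..<x} t * ennreal (t powr (1/2) * (g t)\<^sup>2) \<partial>lebP)" for x
  \<comment> \<open>Splitting the integrand into t^(1/4) g and t^(-1/4) leaves the integral of
    t^(-1/2) over ]0,x[, which is 2 x^(1/2).\<close>
  have step: "(a x)\<^sup>2 * ennreal (1 / x\<^sup>2) \<le> ennreal (2 * x powr (-3/2)) * k x" if x: "0 < x" for x
  proof -
    have "a x = (\<integral>\<^sup>+t. (indicator {..<x} t * ennreal (t powr (1/4) * g t)) *
        (indicator {..<x} t * ennreal (t powr (-1/4))) \<partial>lebP)"
      unfolding a_def
    proof (rule nn_integral_cong)
      fix t assume "t \<in> space lebP"
      then have t: "0 < t" by simp
      have "t powr (1/4) * g t * t powr (-1/4) = (t powr (1/4) * t powr (-1/4)) * g t" by simp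
      also have "\<dots> = g t" using t by (subst powr_add[symmetric]) simp
      finally have "ennreal (g t) = ennreal (t powr (1/4) * g t) * ennreal (t powr (-1/4))"
        using g0[of t] by (simp add: ennreal_mult[symmetric])
      then show "indicator {..<x} t * ennreal (g t) = indicator {..<x} t * ennreal (t powr (1/4) * g t) *
          (indicator {..<x} t * ennreal (t powr (-1/4)))"
        by (auto simp: indicator_def)
    qed
    then have "(a x)\<^sup>2 \<le> (\<integral>\<^sup>+t. (indicator {..<x} t * ennreal (t powr (1/4) * g t))\<^sup>2 \<partial>lebP) *
        (\<integral>\<^sup>+t. (indicator {..<x} t * ennreal (t powr (-1/4)))\<^sup>2 \<partial>lebP)"
      using Cauchy_Schwarz_nn_integral[of "\<lambda>t. indicator {..<x} t * ennreal (t powr (1/4) * g t)" lebP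
          "\<lambda>t. indicator {..<x} t * ennreal (t powr (-1/4))"] by simp
    also have "(\<integral>\<^sup>+t. (indicator {..<x} t * ennreal (t powr (1/4) * g t))\<^sup>2 \<partial>lebP) = k x"
      unfolding k_def
    proof (rule nn_integral_cong)
      fix t
      have "(t powr (1/4) * g t)\<^sup>2 = t powr (1/2) * (g t)\<^sup>2"
        by (simp add: power_mult_distrib power2_eq_square flip: powr_add)
      then have "(ennreal (t powr (1/4) * g t))\<^sup>2 = ennreal (t powr (1/2) * (g t)\<^sup>2)"
        using g0[of t] by (subst ennreal_power) auto
      then show "(indicator {..<x} t * ennreal (t powr (1/4) * g t))\<^sup>2 = indicator {..<x} t * ennreal (t powr (1/2) * (g t)\<^sup>2)"
        by (simp add: indicator_def)
    qed
    also have "k x * (\<integral>\<^sup>+t. (indicator {..<x} t * ennreal (t powr (-1/4)))\<^sup>2 \<partial>lebP)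
        \<le> k x * ennreal (2 * x powr (1/2))"
    proof (rule mult_left_mono)
      have "(\<integral>\<^sup>+t. (indicator {..<x} t * ennreal (t powr (-1/4)))\<^sup>2 \<partial>lebP)
          \<le> (\<integral>\<^sup>+t. ennreal (t powr (-1/2)) * indicator {0..x} t \<partial>lebP)"
        by (rule nn_integral_mono)
          (auto simp: indicator_def power2_eq_square ennreal_mult[symmetric] simp flip: powr_add)
      also have "\<dots> = ennreal (x powr (-1/2 + 1) / (-1/2 + 1))"
        by (rule nn_integral_lebP_has_integral[OF _ _ _ _ has_integral_powr_from_0]) (use x in auto)
      finally show "(\<integral>\<^sup>+t. (indicator {..<x} t * ennreal (t powr (-1/4)))\<^sup>2 \<partial>lebP) \<le> ennreal (2 * x powr (1/2))"
        by (simp add: mult.commute)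
    qed simp
    finally have "(a x)\<^sup>2 \<le> k x * ennreal (2 * x powr (1/2))" .
    then have "(a x)\<^sup>2 * ennreal (1 / x\<^sup>2) \<le> k x * ennreal (2 * x powr (1/2)) * ennreal (1 / x\<^sup>2)"
      by (rule mult_right_mono) simp
    also have "\<dots> = ennreal (2 * x powr (1/2) * (1 / x\<^sup>2)) * k x"
      by (subst ennreal_mult) (auto simp: mult_ac)
    also have "2 * x powr (1/2) * (1 / x\<^sup>2) = 2 * x powr (-3/2)"
    proof -
      have "1 / x\<^sup>2 = x powr (-2)" using x by (simp add: powr_minus divide_inverse)
      then have "x powr (1/2) * (1 / x\<^sup>2) = x powr (1/2 + (-2))" by (simp only: powr_add)
      then show ?thesis by simp
    qed
    finally show ?thesis .
  qed
  have "(\<integral>\<^sup>+x. (a x)\<^sup>2 * ennreal (1 / x\<^sup>2) \<partial>lebP) \<le> (\<integral>\<^sup>+x. ennreal (2 * x powr (-3/2)) * k x \<partial>lebP)"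
    by (rule nn_integral_mono) (use step in auto)
  also have "\<dots> = (\<integral>\<^sup>+x. \<integral>\<^sup>+t. ennreal (2 * x powr (-3/2)) * (indicator {..<x} t * ennreal (t powr (1/2) * (g t)\<^sup>2)) \<partial>lebP \<partial>lebP)"
    unfolding k_def by (intro nn_integral_cong nn_integral_cmult[symmetric]) measurable
  \<comment> \<open>After the exchange, the integral of x^(-3/2) over [t,\<infinity>[ is 2 t^(-1/2),
    which cancels the weight t^(1/2). The constant 4 is the product of the two factors 2.\<close>
  also have "\<dots> = (\<integral>\<^sup>+t. \<integral>\<^sup>+x. ennreal (2 * x powr (-3/2)) * (indicator {..<x} t * ennreal (t powr (1/2) * (g t)\<^sup>2)) \<partial>lebP \<partial>lebP)"
    by (rule Fubini'[symmetric]) (unfold case_prod_beta, measurable)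
  also have "\<dots> \<le> (\<integral>\<^sup>+t. 4 * ennreal ((g t)\<^sup>2) \<partial>lebP)"
  proof (rule nn_integral_mono)
    fix t assume "t \<in> space lebP"
    then have t: "0 < t" by simp
    have "(\<integral>\<^sup>+x. ennreal (2 * x powr (-3/2)) * (indicator {..<x} t * ennreal (t powr (1/2) * (g t)\<^sup>2)) \<partial>lebP)
      \<le> (\<integral>\<^sup>+x. ennreal (2 * (t powr (1/2) * (g t)\<^sup>2)) * (ennreal (x powr (-3/2)) * indicator {t..} x) \<partial>lebP)"
      by (rule nn_integral_mono) (auto simp: indicator_def ennreal_mult[symmetric] mult_ac)
    also have "\<dots> = ennreal (2 * (t powr (1/2) * (g t)\<^sup>2)) * (\<integral>\<^sup>+x. ennreal (x powr (-3/2)) * indicator {t..} x \<partial>lebP)"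
      by (rule nn_integral_cmult) (rule borel_measurable_lebP, measurable)
    also have "(\<integral>\<^sup>+x. ennreal (x powr (-3/2)) * indicator {t..} x \<partial>lebP) = ennreal (- (t powr (-3/2 + 1)) / (-3/2 + 1))"
      by (rule nn_integral_lebP_has_integral[OF _ _ _ _ has_integral_powr_to_inf]) (use t in auto)
    also have "ennreal (2 * (t powr (1/2) * (g t)\<^sup>2)) * ennreal (- (t powr (-3/2 + 1)) / (-3/2 + 1)) =
       ennreal (4 * (t powr (1/2) * t powr (-1/2)) * (g t)\<^sup>2)"
      by (subst ennreal_mult[symmetric]) (auto simp: mult_ac)
    also have "t powr (1/2) * t powr (-1/2) = 1" using t by (simp flip: powr_add)
    finally show "(\<integral>\<^sup>+x. ennreal (2 * x powr (-3/2)) * (indicator {..<x} t * ennreal (t powr (1/2) * (g t)\<^sup>2)) \<partial>lebP) \<le> 4 * ennreal ((g t)\<^sup>2)"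
      by (simp add: ennreal_mult)
  qed
  also have "\<dots> = 4 * (\<integral>\<^sup>+t. ennreal ((g t)\<^sup>2) \<partial>lebP)"
    by (rule nn_integral_cmult) measurable
  finally show ?thesis unfolding a_def .
qed

text \<open>Both quotients are dominated by A(x)/x, where \<open>A\<close> is the primitive of |h|:
  the kernel of \<open>wint\<close> is at most x on ]0,x[, so the second primitive costs just one
  more factor x. The integral estimate is applied to \<open>A\<close> alone.\<close>

lemma Hardy_inequality:
  assumes h: "h \<in> L2"
  shows "(\<lambda>x. vint h x / of_real x) \<in> L2" "L2_sq (\<lambda>x. vint h x / of_real x) \<le> 4 * L2_sq h"
    and "(\<lambda>x. wint h x / of_real (x\<^sup>2)) \<in> L2" "L2_sq (\<lambda>x. wint h x / of_real (x\<^sup>2)) \<le> 4 * L2_sq h"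
proof -
  have [measurable]: "h \<in> borel_measurable lebP" using h by (rule L2_measurable)
  note hn = L2_norm_function(1)[OF h]
  define A where "A x = (LINT t|lebP. indicator {..<x} t * cmod (h t))" for x
  have Ai: "integrable lebP (\<lambda>t. indicator {..<x} t * cmod (h t))" for x
    using integrable_norm[OF vint_integrable[OF h, of x]] by (simp add: cmod_indicator_mult)
  have A0: "0 \<le> A x" for x unfolding A_def by (rule Bochner_Integration.integral_nonneg) auto
  have Av: "vint (\<lambda>t. of_real (cmod (h t))) x = of_real (A x)" for x
    unfolding A_def vint_def integral_complex_of_real[symmetric]
    by (rule Bochner_Integration.integral_cong) (auto simp: indicator_def)
  have "continuous_on {0<..} (\<lambda>x. Re (vint (\<lambda>t. of_real (cmod (h t))) x))"
    by (intro continuous_on_Re vint_continuous hn)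
  then have "continuous_on {0<..} A" by (simp add: Av)
  then have Am [measurable]: "A \<in> borel_measurable lebP" by (rule continuous_measurable_lebP)
  have Ae: "ennreal (A x) = (\<integral>\<^sup>+t. indicator {..<x} t * ennreal (cmod (h t)) \<partial>lebP)" for x
    unfolding A_def using nn_integral_eq_integral[OF Ai[of x]]
    by (simp add: ennreal_mult ennreal_indicator)
  have "(\<integral>\<^sup>+x. ennreal ((A x / x)\<^sup>2) \<partial>lebP) =
      (\<integral>\<^sup>+x. (\<integral>\<^sup>+t. indicator {..<x} t * ennreal (cmod (h t)) \<partial>lebP)\<^sup>2 * ennreal (1 / x\<^sup>2) \<partial>lebP)"
    unfolding Ae[symmetric]
    by (rule nn_integral_cong) (use A0 in \<open>auto simp: ennreal_power ennreal_mult[symmetric] power_divide\<close>)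
  also have "\<dots> \<le> 4 * (\<integral>\<^sup>+t. ennreal ((cmod (h t))\<^sup>2) \<partial>lebP)"
    by (rule Hardy_nn_integral) auto
  also have "(\<integral>\<^sup>+t. ennreal ((cmod (h t))\<^sup>2) \<partial>lebP) = ennreal (L2_sq h)"
    unfolding L2_sq_def by (rule nn_integral_eq_integral[OF L2_integrable[OF h]]) auto
  also have "4 * ennreal (L2_sq h) = ennreal (4 * L2_sq h)" by (simp add: ennreal_mult)
  finally have le: "(\<integral>\<^sup>+x. ennreal ((A x / x)\<^sup>2) \<partial>lebP) \<le> ennreal (4 * L2_sq h)" .
  have i: "integrable lebP (\<lambda>x. (A x / x)\<^sup>2)"
    by (rule integrableI_nonneg) (use le_less_trans[OF le ennreal_less_top] in auto)
  have I: "(LINT x|lebP. (A x / x)\<^sup>2) \<le> 4 * L2_sq h"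
    using le nn_integral_eq_integral[OF i] by (simp add: ennreal_le_iff)
  have vle: "cmod (vint h x) \<le> A x" for x
    unfolding vint_def A_def
    by (rule order_trans[OF integral_norm_bound]) (simp add: cmod_indicator_mult)
  have wle: "cmod (wint h x) \<le> x * A x" if "0 < x" for x
  proof -
    have "cmod (wint h x) \<le> (LINT t|lebP. cmod (of_real (max 0 (x - t)) * h t))"
      unfolding wint_def by (rule integral_norm_bound)
    also have "\<dots> \<le> (LINT t|lebP. x * (indicator {..<x} t * cmod (h t)))"
    proof (rule integral_mono)
      show "integrable lebP (\<lambda>t. cmod (of_real (max 0 (x - t)) * h t))"
        by (rule integrable_norm[OF wint_integrable[OF h]])
      show "integrable lebP (\<lambda>t. x * (indicator {..<x} t * cmod (h t)))"
        using Ai by simp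
      show "cmod (of_real (max 0 (x - t)) * h t) \<le> x * (indicator {..<x} t * cmod (h t))"
        if "t \<in> space lebP" for t
        using that \<open>0 < x\<close> by (auto simp: norm_mult indicator_def max_def mult_right_mono)
    qed
    finally show ?thesis by (simp add: A_def)
  qed
  have vb: "(cmod (vint h x / of_real x))\<^sup>2 \<le> (A x / x)\<^sup>2" if "0 < x" for x
    using vle[of x] that by (intro power_mono) (auto simp: norm_divide divide_right_mono)
  have wb: "(cmod (wint h x / of_real (x\<^sup>2)))\<^sup>2 \<le> (A x / x)\<^sup>2" if "0 < x" for x
  proof (intro power_mono)
    have "cmod (wint h x) / x\<^sup>2 \<le> (x * A x) / x\<^sup>2" using wle[OF that] by (intro divide_right_mono) auto
    also have "\<dots> = A x / x" using that by (simp add: power2_eq_square)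
    finally show "cmod (wint h x / of_real (x\<^sup>2)) \<le> A x / x" by (simp add: norm_divide norm_power)
  qed simp
  have [measurable]: "vint h \<in> borel_measurable lebP" "wint h \<in> borel_measurable lebP"
    using h by (auto intro!: continuous_measurable_lebP vint_continuous wint_continuous)
  have [measurable]: "complex_of_real \<in> borel_measurable lebP"
    by (rule borel_measurable_lebP) measurable
  have m: "(\<lambda>x. vint h x / of_real x) \<in> borel_measurable lebP" "(\<lambda>x. wint h x / of_real (x\<^sup>2)) \<in> borel_measurable lebP"
    by measurable
  show "(\<lambda>x. vint h x / of_real x) \<in> L2" "L2_sq (\<lambda>x. vint h x / of_real x) \<le> 4 * L2_sq h"
    using L2_bound[OF m(1) i vb] I by auto
  show "(\<lambda>x. wint h x / of_real (x\<^sup>2)) \<in> L2" "L2_sq (\<lambda>x. wint h x / of_real (x\<^sup>2)) \<le> 4 * L2_sq h"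
    using L2_bound[OF m(2) i wb] I by auto
qed

section \<open>The space \<open>H20\<close>\<close>

lemma L2_AE:
  assumes g: "g \<in> L2" and [measurable]: "f \<in> borel_measurable lebP" and ae: "AE x in lebP. f x = g x"
  shows "f \<in> L2" "L2_sq f = L2_sq g"
proof -
  have [measurable]: "g \<in> borel_measurable lebP" using g by (rule L2_measurable)
  have ae': "AE x in lebP. (cmod (g x))\<^sup>2 = (cmod (f x))\<^sup>2"
    using ae by eventually_elim simp
  have "integrable lebP (\<lambda>x. (cmod (f x))\<^sup>2)"
    by (rule integrable_cong_AE_imp[OF L2_integrable[OF g] _ ae']) measurable
  then show "f \<in> L2" by (simp add: L2_def)
  then show "L2_sq f = L2_sq g" using g ae by (intro L2_sq_cong_AE)
qed

text \<open>The set where \<open>g\<close> does not vanish is open, and a non-empty open set is not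
  negligible.\<close>

lemma continuous_AE_zero:
  fixes g :: "real \<Rightarrow> complex"
  assumes c: "continuous_on {0<..} g" and ae: "AE x in lebP. g x = 0" and x: "0 < x"
  shows "g x = 0"
proof (rule ccontr)
  assume "g x \<noteq> 0"
  have eq: "{0<..} \<inter> g -` (- {0}) = {x \<in> {0<..}. g x \<noteq> 0}" by auto
  have "open ({0<..} \<inter> g -` (- {0}))"
    by (rule continuous_open_preimage[OF c]) auto
  then have o: "open {x \<in> {0<..}. g x \<noteq> 0}" by (simp only: eq)
  have eq2: "{x \<in> space lebesgue. \<not> (0 < x \<longrightarrow> g x = 0)} = {x \<in> {0<..}. g x \<noteq> 0}" by auto
  have st: "{x \<in> {0<..}. g x \<noteq> 0} \<in> sets lebesgue"
    using borel_open[OF o] by (intro sets_completionI_sets) simp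
  have "AE x in lebesgue. 0 < x \<longrightarrow> g x = 0"
    using ae by (subst (asm) AE_restrict_space_iff) auto
  then have "{x \<in> space lebesgue. \<not> (0 < x \<longrightarrow> g x = 0)} \<in> null_sets lebesgue"
    using st by (subst (asm) AE_iff_null) (simp_all only: eq2)
  then have "negligible {x \<in> {0<..}. g x \<noteq> 0}" by (simp only: eq2 negligible_iff_null_sets)
  moreover have "{x \<in> {0<..}. g x \<noteq> 0} \<noteq> {}" using x \<open>g x \<noteq> 0\<close> by auto
  ultimately show False using open_not_negligible[OF o] by blast
qed

text \<open>A primitive of the minorant is c times arsinh (ln x), which tends to -\<infinity> at 0.
  The logarithm in the minorant leaves room for the factors (1 + ln^2 x)^(-2r) met later; every
  proof that a function is not in L2 goes through this lemma.\<close>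

lemma log_not_integrable:
  assumes f: "f \<in> L2" and c: "0 < c" and d: "0 < d"
    and le: "AE x in lebP. x < d \<longrightarrow> c / (x * sqrt ((ln x)\<^sup>2 + 1)) \<le> (cmod (f x))\<^sup>2"
  shows False
proof -
  define G where "G x = complex_of_real (arsinh (ln x))" for x
  define D where "D x = 1 / (x * sqrt ((ln x)\<^sup>2 + 1))" for x :: real
  define S where "S = arsinh (ln (d/2))"
  have bound: "c * (S + T) \<le> L2_sq f" if T: "- S < T" for T
  proof -
    \<comment> \<open>The lower endpoint at which arsinh (ln x) takes the value -T.\<close>
    define a where "a = exp (sinh (- T))"
    have "ln a = sinh (- T)" by (simp add: a_def)
    then have Ga: "arsinh (ln a) = - T" by (simp add: arsinh_sinh_real del: sinh_minus)
    have "0 < a" by (simp add: a_def)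
    have "arsinh (ln a) < arsinh (ln (d/2))" using T Ga unfolding S_def by linarith
    then have "ln a < ln (d/2)" by (simp only: arsinh_less_iff_real)
    then have ad: "0 < a" "a \<le> d/2" using d \<open>0 < a\<close> ln_less_cancel_iff[of a "d/2"] by auto
    define F where "F x = complex_of_real (indicator {a..d/2} x * D x)" for x
    have sq: "0 < sqrt ((ln x)\<^sup>2 + 1)" for x :: real by (simp add: add_nonneg_pos)
    have c1: "continuous_on {a..d/2} (\<lambda>x. complex_of_real (D x))"
      unfolding D_def using ad sq by (intro continuous_intros) (auto simp: less_imp_neq[symmetric])
    have c2: "continuous_on {a..d/2} F"
      by (rule continuous_on_eq[OF c1]) (auto simp: F_def)
    have Fz: "F x = 0" if "0 < x" "x \<notin> {a..d/2}" for x using that by (simp add: F_def)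
    have Fi: "integrable lebP F" by (rule continuous_integrable_lebP[OF ad c2 Fz])
    have "(LINT x|lebP. F x) = G (d/2) - G a"
    proof (rule integral_FTC_lebP[OF ad c2 Fz])
      fix x assume x: "a \<le> x" "x \<le> d/2"
      then have "0 < x" using ad by simp
      have "((\<lambda>x. arsinh (ln x)) has_real_derivative D x) (at x)"
        unfolding D_def
        by (rule DERIV_cong[OF DERIV_chain2[OF arsinh_real_has_field_derivative DERIV_ln[OF \<open>0 < x\<close>]]])
          (simp add: divide_inverse)
      from has_vector_derivative_of_real[OF this] show "(G has_vector_derivative F x) (at x)"
        unfolding G_def F_def using x by simp
    qed
    then have "complex_of_real (LINT x|lebP. indicator {a..d/2} x * D x) = of_real (S + T)"
      by (simp add: F_def G_def S_def Ga del: of_real_mult)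
    then have I: "(LINT x|lebP. indicator {a..d/2} x * D x) = S + T" by (simp only: of_real_eq_iff)
    have i: "integrable lebP (\<lambda>x. indicator {a..d/2} x * D x)"
      using integrable_Re[OF Fi] by (simp add: F_def del: of_real_mult)
    have "c * (S + T) = (LINT x|lebP. c * (indicator {a..d/2} x * D x))" by (simp add: I)
    also have "\<dots> \<le> L2_sq f" unfolding L2_sq_def
    proof (rule integral_mono_AE[OF integrable_mult_right[OF i] L2_integrable[OF f]])
      show "AE x in lebP. c * (indicator {a..d/2} x * D x) \<le> (cmod (f x))\<^sup>2"
        using le by eventually_elim (use d in \<open>auto simp: indicator_def D_def\<close>)
    qed
    finally show ?thesis .
  qed
  \<comment> \<open>With T larger than \<open>L2_sq f / c - S\<close> by at least 1, the bound would
    give L2_sq f + c <= L2_sq f.\<close>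
  have "c * (S + (max (- S) (L2_sq f / c - S) + 1)) \<le> L2_sq f" by (rule bound) simp
  moreover have "c * (S + (max (- S) (L2_sq f / c - S) + 1)) \<ge> c * (L2_sq f / c + 1)"
    using c by (intro mult_left_mono) auto
  ultimately show False using c by (simp add: distrib_left)
qed

lemma wint_AE_affine:
  assumes f: "f \<in> L2" and h: "h \<in> L2" and d: "dist_deriv2 f h"
  obtains A B where "AE x in lebP. f x = A + B * of_real x + wint h x"
proof -
  have w: "L2loc (wint h)" by (rule L2loc_continuous[OF wint_continuous[OF h]])
  have "(LINT x|lebP. (f x - wint h x) * deriv2 \<phi> x) = 0" if phi: "\<phi> \<in> test_fun" for \<phi>
  proof -
    have "deriv2 \<phi> \<in> test_fun" using phi by (rule test_fun_derivatives)
    then have "integrable lebP (\<lambda>x. f x * deriv2 \<phi> x)" "integrable lebP (\<lambda>x. wint h x * deriv2 \<phi> x)"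
      by (intro L2loc_mult_test_fun_integrable L2loc_L2[OF f] w; assumption)+
    then show ?thesis using d phi wint_weak_deriv2[OF h phi] by (simp add: left_diff_distrib dist_deriv2_def)
  qed
  then obtain A B where "AE x in lebP. f x - wint h x = A + B * of_real x"
    using weak_deriv2_zero_affine[OF L2loc_diff[OF L2loc_L2[OF f] w]] by blast
  then have "AE x in lebP. f x = A + B * of_real x + wint h x"
    by eventually_elim (simp add: algebra_simps)
  then show ?thesis by (rule that)
qed

lemma of_real_measurable_lebP [measurable]: "complex_of_real \<in> borel_measurable lebP"
  by (rule borel_measurable_lebP) measurable

text \<open>A lower bound c x for |A + B x| near 0 is enough, since c^2 / x^2 exceeds the minorant
  of \<open>log_not_integrable\<close> for x < 1. Such a bound holds if A is not 0, the constant
  term dominating, and, once A = 0, if B is not 0.\<close>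

lemma affine_over_square_not_L2:
  assumes f: "f \<in> L2" and ae: "AE x in lebP. f x = (A + B * of_real x) / of_real (x\<^sup>2)"
  shows "A = 0" "B = 0"
proof -
  have *: False if c: "0 < c" "0 < d" "\<And>x. 0 < x \<Longrightarrow> x < d \<Longrightarrow> c * x \<le> cmod (A + B * of_real x)" for c d
  proof (rule log_not_integrable[OF f, of "c\<^sup>2" "min d 1"])
    show "AE x in lebP. x < min d 1 \<longrightarrow> c\<^sup>2 / (x * sqrt ((ln x)\<^sup>2 + 1)) \<le> (cmod (f x))\<^sup>2"
      using ae AE_space
    proof eventually_elim
      case (elim x)
      show ?case
      proof
        assume x1: "x < min d 1"
        have x: "0 < x" "x < d" "x < 1" using elim x1 by auto
        have "1 \<le> sqrt ((ln x)\<^sup>2 + 1)" by simp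
        then have "x \<le> sqrt ((ln x)\<^sup>2 + 1)" using x by linarith
        then have "x * x \<le> x * sqrt ((ln x)\<^sup>2 + 1)"
          using x by (intro mult_left_mono) auto
        then have "c\<^sup>2 / (x * sqrt ((ln x)\<^sup>2 + 1)) \<le> c\<^sup>2 / (x * x)"
          using x by (intro divide_left_mono mult_pos_pos) (auto intro: add_nonneg_pos)
        also have "\<dots> = (c * x / x\<^sup>2)\<^sup>2" using x by (simp add: power2_eq_square)
        also have "\<dots> \<le> (cmod (A + B * of_real x) / x\<^sup>2)\<^sup>2"
          using c(3)[of x] x c by (intro power_mono divide_right_mono) auto
        also have "\<dots> = (cmod (f x))\<^sup>2" using elim by (simp add: norm_divide norm_power)
        finally show "c\<^sup>2 / (x * sqrt ((ln x)\<^sup>2 + 1)) \<le> (cmod (f x))\<^sup>2" .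
      qed
    qed
  qed (use c in auto)
  show A: "A = 0"
  proof (rule ccontr)
    assume A: "A \<noteq> 0"
    \<comment> \<open>Below \<open>d\<close> the linear term is at most half of the constant one,
      and x <= 1 turns the remaining half into a multiple of x.\<close>
    define d where "d = min 1 (cmod A / (2 * (cmod B + 1)))"
    have pB: "0 < cmod B + 1" by (simp add: add_nonneg_pos)
    show False
    proof (rule *[of "cmod A / 2" d])
      show "0 < d" using A pB by (simp add: d_def)
      fix x assume x: "0 < x" "x < d"
      have "cmod B * x \<le> (cmod B + 1) * x" using x by (intro mult_right_mono) auto
      also have "\<dots> \<le> (cmod B + 1) * (cmod A / (2 * (cmod B + 1)))"
        using x by (intro mult_left_mono) (auto simp: d_def)
      also have "\<dots> = cmod A / 2"
      proof -
        have "0 < b \<Longrightarrow> b * (r / (2 * b)) = r / 2" for b r :: real by simp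
        from this[OF pB] show ?thesis .
      qed
      finally have "cmod B * x \<le> cmod A / 2" .
      moreover have "cmod A - cmod (B * of_real x) \<le> cmod (A + B * of_real x)"
        by (metis norm_diff_ineq)
      moreover have "cmod A / 2 * x \<le> cmod A / 2 * 1" using x by (intro mult_left_mono) (auto simp: d_def)
      ultimately show "cmod A / 2 * x \<le> cmod (A + B * of_real x)"
        using x by (simp add: norm_mult)
    qed (use A in simp)
  qed
  show "B = 0"
  proof (rule ccontr)
    assume "B \<noteq> 0"
    then show False using *[of "cmod B" 1] A by (auto simp: norm_mult)
  qed
qed

lemma H20I:
  assumes f: "f \<in> L2" and h: "h \<in> L2" and d: "dist_deriv2 f h" and q: "(\<lambda>x. f x / of_real (x\<^sup>2)) \<in> L2"
  shows "f \<in> H20" "AE x in lebP. f x = wint h x"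
proof -
  obtain A B where AB: "AE x in lebP. f x = A + B * of_real x + wint h x"
    using wint_AE_affine[OF f h d] by blast
  have "(\<lambda>x. f x / of_real (x\<^sup>2) - wint h x / of_real (x\<^sup>2)) \<in> L2"
    by (rule L2_diff[OF q Hardy_inequality(3)[OF h]])
  moreover have "AE x in lebP. f x / of_real (x\<^sup>2) - wint h x / of_real (x\<^sup>2) = (A + B * of_real x) / of_real (x\<^sup>2)"
    using AB by eventually_elim (simp add: diff_divide_distrib[symmetric])
  ultimately have "A = 0" "B = 0" using affine_over_square_not_L2 by blast+
  with AB show ae: "AE x in lebP. f x = wint h x" by simp
  have "wint h 0 = 0" "vint h 0 = 0" by (simp_all add: wint_nonpos vint_nonpos)
  moreover have "\<forall>x\<ge>0. (wint h has_vector_derivative vint h x) (at x within {0..})"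
    by (auto intro: has_vector_derivative_at_within wint_has_derivative[OF h])
  moreover have "f \<in> H2" using f h d by (auto simp: H2_def)
  ultimately show "f \<in> H20"
    unfolding H20_def using ae vint_continuous[OF h] by blast
qed

lemma L2_divide_square_measurable:
  "f \<in> L2 \<Longrightarrow> (\<lambda>x. f x / of_real (x\<^sup>2)) \<in> borel_measurable lebP"
  unfolding of_real_power
  by (intro borel_measurable_divide borel_measurable_power L2_measurable of_real_measurable_lebP)

text \<open>The representative \<open>u\<close> agrees almost everywhere with an affine function
  plus \<open>wint h\<close>, hence everywhere on ]0,\<infinity>[ by continuity and at 0 by closure.
  Value and one-sided derivative can thus be compared at 0, where the boundary conditions kill the
  affine part; Hardy's inequality does the rest.\<close>

lemma H20E:
  assumes f: "f \<in> H20"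
  obtains h where "f \<in> L2" "h \<in> L2" "dist_deriv2 f h" "(\<lambda>x. f x / of_real (x\<^sup>2)) \<in> L2" "AE x in lebP. f x = wint h x"
proof -
  from f obtain h u u' where fL: "f \<in> L2" and h: "h \<in> L2" and d: "dist_deriv2 f h"
    and fu: "AE x in lebP. f x = u x" and u: "\<And>x. 0 \<le> x \<Longrightarrow> (u has_vector_derivative u' x) (at x within {0..})"
    and u0: "u 0 = 0" "u' 0 = 0"
    by (auto simp: H20_def H2_def)
  obtain A B where AB: "AE x in lebP. f x = A + B * of_real x + wint h x"
    using wint_AE_affine[OF fL h d] by blast
  define D where "D x = u x - (A + B * of_real x + wint h x)" for x
  have X: "((\<lambda>x. complex_of_real x) has_vector_derivative 1) (at x within S)" for x S
    using has_vector_derivative_of_real[OF DERIV_ident] by (auto intro: has_vector_derivative_at_within)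
  have Dd: "(D has_vector_derivative (u' x - (B + vint h x))) (at x within {0..})" if "0 \<le> x" for x
    unfolding D_def
    using has_vector_derivative_diff[OF u[OF that] has_vector_derivative_add[OF has_vector_derivative_add[OF
          has_vector_derivative_const[of A] has_vector_derivative_mult[OF has_vector_derivative_const[of B] X]]
          has_vector_derivative_at_within[OF wint_has_derivative[OF h]]]]
    by simp
  have cD: "continuous_on {0..} D"
    by (rule continuous_on_vector_derivative[OF Dd]) auto
  have Dpos: "D x = 0" if "0 < x" for x
  proof (rule continuous_AE_zero[OF continuous_on_subset[OF cD] _ that])
    show "AE x in lebP. D x = 0" using fu AB by eventually_elim (simp add: D_def)
  qed auto
  have D0: "D x = 0" if "0 \<le> x" for x
  proof -
    have "closure {0<..} = {0::real..}" by simp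
    then show ?thesis
      using continuous_constant_on_closure[of "{0<..}" D 0] cD Dpos that by auto
  qed
  then have "D 0 = 0" by simp
  then have "A = 0" using u0 by (simp add: D_def wint_nonpos)
  have "(D has_vector_derivative 0) (at 0 within {0..})"
    by (rule has_vector_derivative_transform[where f="\<lambda>_. 0"]) (use D0 in auto)
  with Dd[of 0] have "u' 0 - (B + vint h 0) = 0"
    by (intro vector_derivative_unique_within[of 0 "{0..}" D])
      (auto simp: trivial_limit_within islimpt_greaterThanLessThan1 intro: islimpt_subset[OF islimpt_greaterThanLessThan1[of 0 1]])
  then have "B = 0" using u0 by (simp add: vint_nonpos)
  with \<open>A = 0\<close> AB have ae: "AE x in lebP. f x = wint h x" by simp
  then have "AE x in lebP. f x / of_real (x\<^sup>2) = wint h x / of_real (x\<^sup>2)" by eventually_elim simp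
  then have "(\<lambda>x. f x / of_real (x\<^sup>2)) \<in> L2"
    by (rule L2_AE(1)[OF Hardy_inequality(3)[OF h] L2_divide_square_measurable[OF fL]])
  with that fL h d ae show ?thesis by blast
qed

lemma test_fun_over_square:
  assumes "\<phi> \<in> test_fun" shows "(\<lambda>x. \<phi> x / of_real (x\<^sup>2)) \<in> L2"
proof -
  from assms obtain a b where ab: "0 < a" "a < b" "\<And>x. x \<notin> {a..b} \<Longrightarrow> \<phi> x = 0" "smooth \<phi>"
    by (rule test_funE) blast
  then have c: "continuous_on {a..b} \<phi>" by (intro smooth_continuous_on)
  show ?thesis
    by (rule L2_of_compact_support[of a b]) (use ab in \<open>auto intro!: continuous_intros c\<close>)
qed

text \<open>The difference of the two integrands has the primitive u \<phi>' - u' \<phi>, which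
  vanishes with \<phi> at both ends.\<close>

lemma classical_weak_deriv2:
  fixes u :: "real \<Rightarrow> complex"
  assumes u: "\<And>x. 0 < x \<Longrightarrow> (u has_vector_derivative u' x) (at x)" "\<And>x. 0 < x \<Longrightarrow> (u' has_vector_derivative u'' x) (at x)"
    and c: "continuous_on {0<..} u''" and phi: "\<phi> \<in> test_fun"
  shows "(LINT x|lebP. u x * deriv2 \<phi> x) = (LINT x|lebP. u'' x * \<phi> x)"
proof -
  obtain \<phi>' where d: "\<phi>' \<in> test_fun" "deriv2 \<phi> \<in> test_fun"
    "\<And>x. (\<phi> has_vector_derivative \<phi>' x) (at x)" "\<And>x. (\<phi>' has_vector_derivative deriv2 \<phi> x) (at x)"
    using phi by (rule test_fun_derivatives) blast
  obtain a b where ab: "0 < a" "a < b" "\<And>x. x \<notin> {a..b} \<Longrightarrow> \<phi> x = 0" using phi by (rule test_funE) blast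
  have z': "\<phi>' x = 0" if "x \<notin> {a..b}" for x
    using ab(3) that by (intro locally_constant_derivative_zero[OF d(3), of "- {a..b}" x 0]) auto
  have z: "\<phi>' x = 0" "deriv2 \<phi> x = 0" if "x \<notin> {a..b}" for x
  proof -
    show "\<phi>' x = 0" by (rule z'[OF that])
    show "deriv2 \<phi> x = 0"
      by (rule locally_constant_derivative_zero[OF d(4), of "- {a..b}" x 0]) (use z' that in auto)
  qed
  have cu: "continuous_on {0<..} u"
    by (rule continuous_on_vector_derivative) (use u(1) in \<open>auto intro: has_vector_derivative_at_within\<close>)
  have i: "integrable lebP (\<lambda>x. u x * deriv2 \<phi> x)" "integrable lebP (\<lambda>x. u'' x * \<phi> x)"
    by (intro L2loc_mult_test_fun_integrable L2loc_continuous cu c d phi)+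
  have "(LINT x|lebP. u x * deriv2 \<phi> x - u'' x * \<phi> x) =
     (u (b + 1) * \<phi>' (b + 1) - u' (b + 1) * \<phi> (b + 1)) - (u (a/2) * \<phi>' (a/2) - u' (a/2) * \<phi> (a/2))"
  proof (rule integral_FTC_lebP)
    show "continuous_on {a/2..b+1} (\<lambda>x. u x * deriv2 \<phi> x - u'' x * \<phi> x)"
      using ab by (intro continuous_intros continuous_on_subset[OF cu] continuous_on_subset[OF c]
          smooth_continuous_on test_fun_smooth d phi) auto
    show "u x * deriv2 \<phi> x - u'' x * \<phi> x = 0" if "x \<notin> {a/2..b+1}" for x
      using that ab z[of x] by auto
    show "((\<lambda>x. u x * \<phi>' x - u' x * \<phi> x) has_vector_derivative u x * deriv2 \<phi> x - u'' x * \<phi> x) (at x)"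
      if "a/2 \<le> x" for x
    proof -
      have "0 < x" using that ab by simp
      from has_vector_derivative_diff[OF has_vector_derivative_mult[OF u(1)[OF this] d(4)]
          has_vector_derivative_mult[OF u(2)[OF this] d(3)]]
      show ?thesis by (simp add: algebra_simps)
    qed
  qed (use ab in auto)
  also have "\<dots> = 0" using ab z[of "b+1"] z[of "a/2"] by simp
  finally show ?thesis using i by simp
qed

lemma test_fun_H20:
  assumes phi: "\<phi> \<in> test_fun" shows "\<phi> \<in> H20" "dist_deriv2 \<phi> (deriv2 \<phi>)"
proof -
  obtain \<phi>' where d: "\<phi>' \<in> test_fun" "deriv2 \<phi> \<in> test_fun"
    "\<And>x. (\<phi> has_vector_derivative \<phi>' x) (at x)" "\<And>x. (\<phi>' has_vector_derivative deriv2 \<phi> x) (at x)"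
    using phi by (rule test_fun_derivatives) blast
  show w: "dist_deriv2 \<phi> (deriv2 \<phi>)"
    unfolding dist_deriv2_def
    by (intro ballI classical_weak_deriv2[where u'=\<phi>'] d smooth_continuous_on test_fun_smooth)
  show "\<phi> \<in> H20"
    by (rule H20I(1)[OF test_fun_L2[OF phi] test_fun_L2[OF d(2)] w test_fun_over_square[OF phi]])
qed

lemma H20_subspace: "cfun.subspace H20"
proof (rule cfun.subspaceI)
  have L0: "(\<lambda>_. 0) \<in> L2" by (simp add: L2_def)
  have "dist_deriv2 (\<lambda>_. 0) (\<lambda>_. 0)" by (simp add: dist_deriv2_def)
  from H20I(1)[OF L0 L0 this] L0 have "(\<lambda>_. 0) \<in> H20" by simp
  then show "0 \<in> H20" by (simp add: zero_fun_def)
next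
  fix f g assume "f \<in> H20" "g \<in> H20"
  then obtain h k where f: "f \<in> L2" "h \<in> L2" "dist_deriv2 f h" "(\<lambda>x. f x / of_real (x\<^sup>2)) \<in> L2"
    and g: "g \<in> L2" "k \<in> L2" "dist_deriv2 g k" "(\<lambda>x. g x / of_real (x\<^sup>2)) \<in> L2"
    by (elim H20E) blast
  have "dist_deriv2 (\<lambda>x. f x + g x) (\<lambda>x. h x + k x)"
    unfolding dist_deriv2_def
  proof
    fix \<phi> assume phi: "\<phi> \<in> test_fun"
    then have "deriv2 \<phi> \<in> test_fun" by (rule test_fun_derivatives)
    note i = L2loc_mult_test_fun_integrable[OF L2loc_L2 this] L2loc_mult_test_fun_integrable[OF L2loc_L2 phi]
    show "(LINT x|lebP. (f x + g x) * deriv2 \<phi> x) = (LINT x|lebP. (h x + k x) * \<phi> x)"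
      using f(3) g(3) phi i[OF f(1)] i[OF g(1)] i[OF f(2)] i[OF g(2)]
      by (simp add: distrib_right dist_deriv2_def)
  qed
  from H20I(1)[OF L2_add[OF f(1) g(1)] L2_add[OF f(2) g(2)] this] L2_add[OF f(4) g(4)]
  show "f + g \<in> H20" by (simp add: plus_fun_def add_divide_distrib)
next
  fix c f assume "f \<in> H20"
  then obtain h where f: "f \<in> L2" "h \<in> L2" "dist_deriv2 f h" "(\<lambda>x. f x / of_real (x\<^sup>2)) \<in> L2"
    by (elim H20E) blast
  have "dist_deriv2 (\<lambda>x. c * f x) (\<lambda>x. c * h x)"
    using f(3) by (simp add: dist_deriv2_def mult.assoc)
  from H20I(1)[OF L2_cmult[OF f(1)] L2_cmult[OF f(2)] this] L2_cmult[OF f(4), of c]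
  show "(\<lambda>x. c * f x) \<in> H20" by simp
qed

section \<open>Approximation in \<open>H20\<close>\<close>

text \<open>Beyond the support the positive part in the kernel has no effect, and the second
  primitive is affine, with the moments of \<open>h\<close> as coefficients.\<close>

lemma wint_beyond_support:
  assumes h: "h \<in> L2" and R: "0 < R" and z: "\<And>t. R < t \<Longrightarrow> h t = 0" and x: "R \<le> x"
  shows "wint h x = of_real x * (LINT t|lebP. h t) - (LINT t|lebP. of_real t * h t)"
proof -
  have [measurable]: "h \<in> borel_measurable lebP" using h by (rule L2_measurable)
  have L: "(\<lambda>t. indicator {0..R} t * g t) \<in> L2" if "g \<in> borel_measurable lebP" "\<And>t. t \<in> {0..R} \<Longrightarrow> cmod (g t) \<le> C"
    for g C
    by (rule L2_bounded_Icc(1)[of 0 R _ C]) (use that R in \<open>auto simp: indicator_def\<close>)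
  have i1: "integrable lebP h"
  proof -
    have "integrable lebP (\<lambda>t. (indicator {0..R} t * 1) * h t)"
      by (rule integrable_mult_L2[OF L h]) auto
    then show ?thesis
      by (rule Bochner_Integration.integrable_cong[THEN iffD1, rotated -1]) (use z in \<open>auto simp: indicator_def not_le\<close>)
  qed
  have i2: "integrable lebP (\<lambda>t. of_real t * h t)"
  proof -
    have "integrable lebP (\<lambda>t. (indicator {0..R} t * of_real t) * h t)"
      by (rule integrable_mult_L2[OF L[of _ R] h]) auto
    then show ?thesis
      by (rule Bochner_Integration.integrable_cong[THEN iffD1, rotated -1]) (use z in \<open>auto simp: indicator_def not_le\<close>)
  qed
  have "wint h x = (LINT t|lebP. of_real x * h t - of_real t * h t)"
    unfolding wint_def
  proof (rule Bochner_Integration.integral_cong)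
    fix t show "of_real (max 0 (x - t)) * h t = of_real x * h t - of_real t * h t"
      using z[of t] x by (cases "t \<le> R") (auto simp: left_diff_distrib)
  qed simp
  then show ?thesis using i1 i2 by simp
qed

text \<open>The approximants of \<open>k\<close> are corrected so as to have, like \<open>k\<close> itself, vanishing moments of order
  \<open>0\<close> and \<open>1\<close>; this keeps the supports of their second primitives in a fixed compact set.\<close>

lemma wint_compact_approx:
  assumes k: "k \<in> L2" and ab: "0 < a" "a < b" and kz: "\<And>x. x \<notin> {a..b} \<Longrightarrow> k x = 0"
    and wz: "\<And>x. b < x \<Longrightarrow> wint k x = 0" and e: "0 < e"
  obtains \<phi> where "\<phi> \<in> test_fun" "L2_sq (\<lambda>x. k x - deriv2 \<phi> x) < e" "(\<lambda>x. wint k x - \<phi> x) \<in> L2"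
    "L2_sq (\<lambda>x. wint k x - \<phi> x) < e" "L2_sq (\<lambda>x. (wint k x - \<phi> x) / of_real (x\<^sup>2)) < e"
proof -
  obtain \<rho>\<^sub>0 \<rho>\<^sub>1 where r: "\<rho>\<^sub>0 \<in> test_fun" "\<rho>\<^sub>1 \<in> test_fun"
    "(LINT x|lebP. \<rho>\<^sub>0 x) = 1" "(LINT x|lebP. of_real x * \<rho>\<^sub>0 x) = 0"
    "(LINT x|lebP. \<rho>\<^sub>1 x) = 0" "(LINT x|lebP. of_real x * \<rho>\<^sub>1 x) = 1"
    by (rule test_fun_moments) blast
  obtain d\<^sub>0 where r0: "0 < d\<^sub>0" "\<And>x. d\<^sub>0 < x \<Longrightarrow> \<rho>\<^sub>0 x = 0"
    using r(1) by (elim test_funE) (metis atLeastAtMost_iff linorder_not_less order_less_trans)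
  obtain d\<^sub>1 where r1: "0 < d\<^sub>1" "\<And>x. d\<^sub>1 < x \<Longrightarrow> \<rho>\<^sub>1 x = 0"
    using r(2) by (elim test_funE) (metis atLeastAtMost_iff linorder_not_less order_less_trans)
  define R where "R = max (2 * b) (max d\<^sub>0 d\<^sub>1)"
  have R: "0 < R" "2 * b \<le> R" "d\<^sub>0 \<le> R" "d\<^sub>1 \<le> R" "b < R" using ab r0 by (auto simp: R_def)
  note kmom = wint_beyond_support[OF k _ kz, of b]
  \<comment> \<open>Past \<open>b\<close> the function \<open>wint k\<close> is affine with these
    moments as coefficients; its vanishing at the two points b + 1 and b + 2 makes both of them
    0.\<close>
  have km: "(LINT t|lebP. k t) = 0" "(LINT t|lebP. of_real t * k t) = 0"
  proof -
    have 1: "of_real (b+1) * (LINT t|lebP. k t) - (LINT t|lebP. of_real t * k t) = 0"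
      using kmom[of "b+1"] wz[of "b+1"] ab by simp
    have 2: "of_real (b+2) * (LINT t|lebP. k t) - (LINT t|lebP. of_real t * k t) = 0"
      using kmom[of "b+2"] wz[of "b+2"] ab by simp
    have "(of_real (b+2) - of_real (b+1)) * (LINT t|lebP. k t) = 0"
      unfolding left_diff_distrib using 1 2 by (metis eq_iff_diff_eq_0)
    then show "(LINT t|lebP. k t) = 0" by simp
    with 1 show "(LINT t|lebP. of_real t * k t) = 0" by simp
  qed
  define u\<^sub>0 u\<^sub>1 :: "real \<Rightarrow> complex" where "u\<^sub>0 x = indicator {a/2..2*b} x" and "u\<^sub>1 x = indicator {a/2..2*b} x * of_real x" for x
  have u0: "u\<^sub>0 \<in> L2"
  proof (rule L2_bounded_Icc(1)[where a="a/2" and b="2*b" and C=1])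
    show "u\<^sub>0 \<in> borel_measurable lebP" unfolding u\<^sub>0_def by (rule borel_measurable_lebP) measurable
    show "cmod (u\<^sub>0 x) \<le> 1" for x by (simp add: u\<^sub>0_def indicator_def)
    show "u\<^sub>0 x = 0" if "x \<notin> {a/2..2*b}" for x using that by (simp add: u\<^sub>0_def)
  qed (use ab in simp)
  have u1: "u\<^sub>1 \<in> L2"
  proof (rule L2_bounded_Icc(1)[where a="a/2" and b="2*b" and C="2*b"])
    show "u\<^sub>1 \<in> borel_measurable lebP" unfolding u\<^sub>1_def by (rule borel_measurable_lebP) measurable
    show "cmod (u\<^sub>1 x) \<le> 2 * b" if "x \<in> {a/2..2*b}" for x
      using that ab by (simp add: u\<^sub>1_def)
    show "u\<^sub>1 x = 0" if "x \<notin> {a/2..2*b}" for x using that by (simp add: u\<^sub>1_def)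
  qed (use ab in simp)
  note u = u0 u1
  \<comment> \<open>K \<delta> will bound the squared error of the corrected approximant \<psi>: the
    summand 2 comes from the first approximation, the others from the two moment
    corrections.\<close>
  define K where "K = 2 + 4 * L2_sq u\<^sub>0 * L2_sq \<rho>\<^sub>0 + 4 * L2_sq u\<^sub>1 * L2_sq \<rho>\<^sub>1"
  have K: "2 \<le> K" by (simp add: K_def)
  \<comment> \<open>Hardy's inequality turns K \<delta> into 4 K \<delta> for the error divided by
    x^2, and the factor x^2 <= R^2 then gives 4 R^4 K \<delta> for the error itself; the factor 8
    makes all inequalities strict.\<close>
  define \<delta> where "\<delta> = e / (8 * K * (1 + R^4))"
  have R4: "0 < 1 + R^4" using R by (simp add: add_pos_nonneg)
  have d: "0 < \<delta>" unfolding \<delta>_def using e K R4 by (intro divide_pos_pos mult_pos_pos) auto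
  have dK: "8 * K * (1 + R^4) * \<delta> = e" unfolding \<delta>_def using K R4 by simp
  obtain \<phi>\<^sub>0 where phi: "\<phi>\<^sub>0 \<in> test_fun" "\<And>x. x \<notin> {a/2..2*b} \<Longrightarrow> \<phi>\<^sub>0 x = 0" "L2_sq (\<lambda>x. k x - \<phi>\<^sub>0 x) < \<delta>"
    using L2_test_fun_approx[OF k ab kz d] by blast
  define m\<^sub>0 m\<^sub>1 where "m\<^sub>0 = (LINT x|lebP. \<phi>\<^sub>0 x)" and "m\<^sub>1 = (LINT x|lebP. of_real x * \<phi>\<^sub>0 x)"
  note i = test_fun_integrable
  note kp = L2_diff[OF k test_fun_L2[OF phi(1)]]
  have k0: "u\<^sub>0 x * k x = k x" "u\<^sub>0 x * \<phi>\<^sub>0 x = \<phi>\<^sub>0 x" "u\<^sub>1 x * k x = of_real x * k x"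
    "u\<^sub>1 x * \<phi>\<^sub>0 x = of_real x * \<phi>\<^sub>0 x" for x
  proof -
    have k': "k x = 0" "\<phi>\<^sub>0 x = 0" if "x \<notin> {a/2..2*b}" for x
      using kz[of x] phi(2)[OF that] that ab by auto
    have "u\<^sub>0 x = 1" "u\<^sub>1 x = of_real x" if "x \<in> {a/2..2*b}" for x
      using that by (simp_all add: u\<^sub>0_def u\<^sub>1_def)
    then show "u\<^sub>0 x * k x = k x" "u\<^sub>0 x * \<phi>\<^sub>0 x = \<phi>\<^sub>0 x" "u\<^sub>1 x * k x = of_real x * k x"
      "u\<^sub>1 x * \<phi>\<^sub>0 x = of_real x * \<phi>\<^sub>0 x"
      using k'[of x] by (cases "x \<in> {a/2..2*b}"; simp)+
  qed
  \<comment> \<open>Written as pairings with the windows \<open>u\<^sub>0\<close> and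
    \<open>u\<^sub>1\<close>, the moments of the error are controlled by Cauchy-Schwarz; those of
    \<open>k\<close> being 0, they are the moments of \<open>\<phi>\<^sub>0\<close> up to
    sign.\<close>
  have m0: "(LINT x|lebP. u\<^sub>0 x * (k x - \<phi>\<^sub>0 x)) = - m\<^sub>0"
    unfolding right_diff_distrib
    using integrable_mult_L2[OF u(1) k] i(1)[OF phi(1)] km(1) by (simp add: k0 m\<^sub>0_def)
  have m1: "(LINT x|lebP. u\<^sub>1 x * (k x - \<phi>\<^sub>0 x)) = - m\<^sub>1"
    unfolding right_diff_distrib
    using integrable_mult_L2[OF u(2) k] i(2)[OF phi(1)] km(2) by (simp add: k0 m\<^sub>1_def)
  have m0b: "(cmod m\<^sub>0)\<^sup>2 \<le> L2_sq u\<^sub>0 * \<delta>"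
    using Cauchy_Schwarz_L2[OF u(1) kp] mult_left_mono[OF less_imp_le[OF phi(3)], of "L2_sq u\<^sub>0"]
    by (simp add: m0)
  have m1b: "(cmod m\<^sub>1)\<^sup>2 \<le> L2_sq u\<^sub>1 * \<delta>"
    using Cauchy_Schwarz_L2[OF u(2) kp] mult_left_mono[OF less_imp_le[OF phi(3)], of "L2_sq u\<^sub>1"]
    by (simp add: m1)
  define \<psi> where "\<psi> x = \<phi>\<^sub>0 x - m\<^sub>0 * \<rho>\<^sub>0 x - m\<^sub>1 * \<rho>\<^sub>1 x" for x
  have psi: "\<psi> \<in> test_fun" unfolding \<psi>_def by (intro test_fun_diff test_fun_cmult phi r)
  have psi_m0: "(LINT x|lebP. \<psi> x) = 0"
    using i[OF phi(1)] i[OF r(1)] i[OF r(2)] r by (simp add: \<psi>_def m\<^sub>0_def)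
  have psi_m1: "(LINT x|lebP. of_real x * \<psi> x) = 0"
  proof -
    have "(\<lambda>x. of_real x * \<psi> x) = (\<lambda>x. of_real x * \<phi>\<^sub>0 x - m\<^sub>0 * (of_real x * \<rho>\<^sub>0 x) - m\<^sub>1 * (of_real x * \<rho>\<^sub>1 x))"
      by (simp add: \<psi>_def algebra_simps)
    then show ?thesis using i[OF phi(1)] i[OF r(1)] i[OF r(2)] r by (simp add: m\<^sub>1_def)
  qed
  note W = wint_test_fun[OF psi psi_m0 psi_m1]
  note psiL = test_fun_L2[OF psi]
  have psiz: "\<psi> t = 0" if "R < t" for t
    using that R phi(2)[of t] r0(2)[of t] r1(2)[of t] by (simp add: \<psi>_def)
  have bd: "L2_sq (\<lambda>x. k x - \<psi> x) \<le> K * \<delta>"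
  proof -
    note rL = test_fun_L2[OF r(1)] test_fun_L2[OF r(2)]
    have "(\<lambda>x. k x - \<psi> x) = (\<lambda>x. (k x - \<phi>\<^sub>0 x) + (m\<^sub>0 * \<rho>\<^sub>0 x + m\<^sub>1 * \<rho>\<^sub>1 x))"
      by (simp add: \<psi>_def algebra_simps)
    then have "L2_sq (\<lambda>x. k x - \<psi> x) \<le> 2 * L2_sq (\<lambda>x. k x - \<phi>\<^sub>0 x) + 2 * L2_sq (\<lambda>x. m\<^sub>0 * \<rho>\<^sub>0 x + m\<^sub>1 * \<rho>\<^sub>1 x)"
      using L2_sq_add_le[OF kp L2_add[OF L2_cmult[OF rL(1)] L2_cmult[OF rL(2)]]] by simp
    also have "\<dots> \<le> 2 * \<delta> + 2 * (2 * L2_sq (\<lambda>x. m\<^sub>0 * \<rho>\<^sub>0 x) + 2 * L2_sq (\<lambda>x. m\<^sub>1 * \<rho>\<^sub>1 x))"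
      using phi(3) L2_sq_add_le[OF L2_cmult[OF rL(1)] L2_cmult[OF rL(2)]] by (intro add_mono mult_left_mono) auto
    also have "\<dots> = 2 * \<delta> + 4 * ((cmod m\<^sub>0)\<^sup>2 * L2_sq \<rho>\<^sub>0) + 4 * ((cmod m\<^sub>1)\<^sup>2 * L2_sq \<rho>\<^sub>1)"
      by (simp add: L2_sq_cmult)
    also have "\<dots> \<le> 2 * \<delta> + 4 * ((L2_sq u\<^sub>0 * \<delta>) * L2_sq \<rho>\<^sub>0) + 4 * ((L2_sq u\<^sub>1 * \<delta>) * L2_sq \<rho>\<^sub>1)"
      using m0b m1b by (intro add_mono mult_left_mono mult_right_mono) auto
    also have "\<dots> = K * \<delta>" by (simp add: K_def algebra_simps)
    finally show ?thesis .
  qed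
  have wd: "wint (\<lambda>t. k t - \<psi> t) x = wint k x - wint \<psi> x" for x by (rule wint_diff[OF k psiL])
  note H = Hardy_inequality(3,4)[OF L2_diff[OF k psiL], unfolded wd]
  have b2: "L2_sq (\<lambda>x. (wint k x - wint \<psi> x) / of_real (x\<^sup>2)) \<le> 4 * (K * \<delta>)"
    using H(2) bd by linarith
  \<comment> \<open>Past \<open>R\<close> both second primitives vanish, so the error is its
    quotient by x^2 times a bounded factor: the weighted estimate implies the plain one.\<close>
  define g :: "real \<Rightarrow> complex" where "g x = indicator {..R} x * of_real (x\<^sup>2)" for x
  have gz: "wint k x - wint \<psi> x = g x * ((wint k x - wint \<psi> x) / of_real (x\<^sup>2))" if "0 < x" for x
  proof (cases "x \<le> R")
    case True then show ?thesis using that by (simp add: g_def)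
  next
    case False
    then have "wint \<psi> x = 0" using wint_beyond_support[OF psiL R(1) psiz, of x] psi_m0 psi_m1 by simp
    then show ?thesis using wz[of x] False R by simp
  qed
  have gm: "g \<in> borel_measurable lebP" unfolding g_def by (rule borel_measurable_lebP) measurable
  have gb: "cmod (g x) \<le> R\<^sup>2" if "0 < x" for x
    using that by (auto simp: g_def indicator_def norm_power power_mono)
  have mm: "(\<lambda>x. wint k x - wint \<psi> x) \<in> borel_measurable lebP"
    by (intro continuous_measurable_lebP continuous_intros wint_continuous k psiL)
  note B = L2_mult_bounded[OF H(1) gm gb]
  have ae: "AE x in lebP. wint k x - wint \<psi> x = g x * ((wint k x - wint \<psi> x) / of_real (x\<^sup>2))"
    by (rule AE_I2) (use gz in auto)
  note B' = L2_AE[OF B(1) mm ae]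
  have b3: "L2_sq (\<lambda>x. wint k x - wint \<psi> x) \<le> (R\<^sup>2)\<^sup>2 * (4 * (K * \<delta>))"
    using B'(2) B(2) mult_left_mono[OF b2, of "(R\<^sup>2)\<^sup>2"] by simp
  have p: "0 < K * \<delta>" "0 \<le> R^4 * (K * \<delta>)" using K d by auto
  have eK: "e = 8 * (K * \<delta>) + 8 * (R^4 * (K * \<delta>))" using dK by (simp add: algebra_simps)
  show ?thesis
  proof (rule that[OF W(1)])
    show "L2_sq (\<lambda>x. k x - deriv2 (wint \<psi>) x) < e" unfolding W(2) using bd p eK by linarith
    show "L2_sq (\<lambda>x. (wint k x - wint \<psi> x) / of_real (x\<^sup>2)) < e" using b2 p eK by linarith
    have "(R\<^sup>2)\<^sup>2 * (4 * (K * \<delta>)) = 4 * (R^4 * (K * \<delta>))" by simp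
    then show "L2_sq (\<lambda>x. wint k x - wint \<psi> x) < e" using b3 p eK by linarith
  qed (rule B'(1))
qed

section \<open>Scale-invariant cutoffs at 0 and infinity\<close>

lemma test_fun_weighted_bound:
  assumes "\<phi> \<in> test_fun"
  obtains C where "0 \<le> C" "\<And>x. cmod (of_real x ^ n * \<phi> x) \<le> C"
proof -
  have "(\<lambda>x. of_real x ^ n * \<phi> x) \<in> test_fun"
    by (intro test_fun_mult smooth_power smooth_of_real assms)
  then obtain B where B: "\<And>x. cmod (of_real x ^ n * \<phi> x) \<le> B" using test_fun_bounded by blast
  moreover have "0 \<le> B" using order_trans[OF norm_ge_zero B] .
  ultimately show ?thesis using that by blast
qed

lemma has_vector_derivative_scale:
  fixes f :: "real \<Rightarrow> complex"
  assumes "\<And>x. (f has_vector_derivative f' x) (at x)"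
  shows "((\<lambda>x. f (c * x)) has_vector_derivative of_real c * f' (c * x)) (at x)"
proof -
  have "((\<lambda>x. c * x) has_vector_derivative c) (at x)"
    by (auto intro!: derivative_eq_intros)
  from vector_diff_chain_at[OF this assms] show ?thesis
    by (simp add: o_def scaleR_conv_of_real)
qed

lemma smooth_scale: "smooth f \<Longrightarrow> smooth (\<lambda>x. f (c * x))"
  using smooth_affine_compose[of f c 0] by simp

lemma smooth_uminus: "smooth f \<Longrightarrow> smooth (\<lambda>x. - f x)"
  using smooth_diff[OF smooth_const[of 0], of f] by simp

lemma cmod_mult_mono: "cmod p \<le> u \<Longrightarrow> cmod q \<le> v \<Longrightarrow> cmod (p * q) \<le> u * v"
  by (simp add: norm_mult mult_mono order_trans[OF norm_ge_zero])

text \<open>The cutoffs \<kappa>(N x) (1 - \<kappa>(x/N)) are built by dilations, for which x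
  \<eta>' and x^2 \<eta>'' are bounded independently of N. These weights match the quotients by x
  and x^2 that Hardy's inequality controls.\<close>

lemma cutoff_sequence:
  obtains \<eta> \<eta>' \<eta>'' :: "nat \<Rightarrow> real \<Rightarrow> complex" and C :: real where
    "\<And>n. \<eta> n \<in> test_fun" "\<And>n. \<eta>' n \<in> test_fun" "\<And>n. \<eta>'' n \<in> test_fun"
    "\<And>n x. (\<eta> n has_vector_derivative \<eta>' n x) (at x)" "\<And>n x. (\<eta>' n has_vector_derivative \<eta>'' n x) (at x)"
    "\<And>n. \<exists>a b. 0 < a \<and> a < b \<and> (\<forall>x. x \<notin> {a..b} \<longrightarrow> \<eta> n x = 0 \<and> \<eta>' n x = 0 \<and> \<eta>'' n x = 0)"
    "0 \<le> C" "\<And>n x. cmod (\<eta> n x) \<le> 1" "\<And>n x. cmod (of_real x * \<eta>' n x) \<le> C"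
    "\<And>n x. cmod (of_real (x\<^sup>2) * \<eta>'' n x) \<le> C"
    "\<And>x. 0 < x \<Longrightarrow> eventually (\<lambda>n. \<eta> n x = 1 \<and> \<eta>' n x = 0 \<and> \<eta>'' n x = 0) sequentially"
proof -
  obtain \<kappa> \<kappa>' \<kappa>'' :: "real \<Rightarrow> complex" where s: "smooth \<kappa>" and t: "\<kappa>' \<in> test_fun" "\<kappa>'' \<in> test_fun"
    and d: "\<And>x. (\<kappa> has_vector_derivative \<kappa>' x) (at x)" "\<And>x. (\<kappa>' has_vector_derivative \<kappa>'' x) (at x)"
    and k: "\<And>x. x \<le> 1 \<Longrightarrow> \<kappa> x = 0" "\<And>x. 2 \<le> x \<Longrightarrow> \<kappa> x = 1"
    and b: "\<And>x. cmod (\<kappa> x) \<le> 1" "\<And>x. cmod (1 - \<kappa> x) \<le> 1"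
    and z: "\<And>x. x \<notin> {1..2} \<Longrightarrow> \<kappa>' x = 0" "\<And>x. x \<notin> {1..2} \<Longrightarrow> \<kappa>'' x = 0"
    by (rule smooth_step_derivatives) blast
  obtain C1 where C1: "0 \<le> C1" "\<And>x. cmod (of_real x ^ 1 * \<kappa>' x) \<le> C1" using test_fun_weighted_bound[OF t(1)] by blast
  obtain C2 where C2: "0 \<le> C2" "\<And>x. cmod (of_real x ^ 2 * \<kappa>'' x) \<le> C2" using test_fun_weighted_bound[OF t(2)] by blast
  define N where "N n = real n + 2" for n
  have N: "2 \<le> N n" for n by (simp add: N_def)
  define A A' A'' where "A n x = \<kappa> (N n * x)" and "A' n x = of_real (N n) * \<kappa>' (N n * x)"
    and "A'' n x = of_real (N n) * (of_real (N n) * \<kappa>'' (N n * x))" for n x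
  define B B' B'' where "B n x = 1 - \<kappa> (1 / N n * x)" and "B' n x = - (of_real (1 / N n) * \<kappa>' (1 / N n * x))"
    and "B'' n x = - (of_real (1 / N n) * (of_real (1 / N n) * \<kappa>'' (1 / N n * x)))" for n x
  have dA: "(A n has_vector_derivative A' n x) (at x)" "(A' n has_vector_derivative A'' n x) (at x)" for n x
    unfolding A_def A'_def A''_def
    by (intro has_vector_derivative_scale d has_vector_derivative_mult_right)+
  have dB: "(B n has_vector_derivative B' n x) (at x)" "(B' n has_vector_derivative B'' n x) (at x)" for n x
    unfolding B_def B'_def B''_def
    using has_vector_derivative_diff[OF has_vector_derivative_const[of 1] has_vector_derivative_scale[OF d(1), of "1 / N n" x]]
      has_vector_derivative_minus[OF has_vector_derivative_mult_right[OF has_vector_derivative_scale[OF d(2), of "1 / N n" x], of "of_real (1 / N n)"]]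
    by simp_all
  have sA: "smooth (A n)" "smooth (A' n)" "smooth (A'' n)" and sB: "smooth (B n)" "smooth (B' n)" "smooth (B'' n)" for n
    unfolding A_def A'_def A''_def B_def B'_def B''_def
    by (intro smooth_uminus smooth_mult smooth_const smooth_diff smooth_scale[OF s]
        smooth_scale[OF test_fun_smooth[OF t(1)]] smooth_scale[OF test_fun_smooth[OF t(2)]])+
  have bA: "cmod (A n x) \<le> 1" "cmod (of_real x * A' n x) \<le> C1" "cmod (of_real (x\<^sup>2) * A'' n x) \<le> C2" for n x
    using b(1) C1(2)[of "N n * x"] C2(2)[of "N n * x"]
    by (simp_all add: A_def A'_def A''_def mult_ac power2_eq_square)
  have bB: "cmod (B n x) \<le> 1" "cmod (of_real x * B' n x) \<le> C1" "cmod (of_real (x\<^sup>2) * B'' n x) \<le> C2" for n x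
    using b(2) C1(2)[of "1 / N n * x"] C2(2)[of "1 / N n * x"]
    by (simp_all add: B_def B'_def B''_def mult_ac power2_eq_square)
  have zA: "A n x = 0" "A' n x = 0" "A'' n x = 0" if "x < 1 / N n" for n x
  proof -
    have "N n * x < 1" using that N[of n] by (simp add: pos_less_divide_eq mult.commute)
    then show "A n x = 0" "A' n x = 0" "A'' n x = 0" using k(1) z by (auto simp: A_def A'_def A''_def)
  qed
  have zB: "B n x = 0" "B' n x = 0" "B'' n x = 0" if "2 * N n < x" for n x
  proof -
    have "2 < 1 / N n * x" using that N[of n] by (simp add: pos_less_divide_eq)
    then show "B n x = 0" "B' n x = 0" "B'' n x = 0" using k(2) z by (auto simp: B_def B'_def B''_def)
  qed
  define \<eta> \<eta>' \<eta>'' where "\<eta> n x = A n x * B n x" and "\<eta>' n x = A n x * B' n x + A' n x * B n x"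
    and "\<eta>'' n x = (A n x * B'' n x + A' n x * B' n x) + (A' n x * B' n x + A'' n x * B n x)" for n x
  have zE: "\<eta> n x = 0 \<and> \<eta>' n x = 0 \<and> \<eta>'' n x = 0" if "x \<notin> {1 / N n..2 * N n}" for n x
    using that zA[of x n] zB[of n x] by (cases "x < 1 / N n") (auto simp: \<eta>_def \<eta>'_def \<eta>''_def)
  have Nlt: "0 < 1 / N n" "1 / N n < 2 * N n" for n
  proof -
    have "1 / N n \<le> 1" using N[of n] by simp
    then show "1 / N n < 2 * N n" using N[of n] by linarith
  qed (use N[of n] in simp)
  have sE: "smooth (\<eta> n)" "smooth (\<eta>' n)" "smooth (\<eta>'' n)" for n
    unfolding \<eta>_def \<eta>'_def \<eta>''_def by (intro smooth_add smooth_mult sA sB)+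
  have ev: "eventually (\<lambda>n. \<eta> n x = 1 \<and> \<eta>' n x = 0 \<and> \<eta>'' n x = 0) sequentially" if x: "0 < x" for x
  proof -
    have "eventually (\<lambda>n. max x (3/x) < real n) sequentially"
      using filterlim_real_sequentially unfolding filterlim_at_top_dense by blast
    then show ?thesis
    proof eventually_elim
      case (elim n)
      have "3 / x < N n" "x < N n" using elim by (auto simp: N_def)
      then have "2 < N n * x" "1 / N n * x < 1" using x N[of n] by (auto simp: pos_divide_less_eq)
      then show ?case using k z
        by (auto simp: \<eta>_def \<eta>'_def \<eta>''_def A_def A'_def A''_def B_def B'_def B''_def)
    qed
  qed
  show ?thesis
  \<comment> \<open>Leibniz' rule puts 2 C1 on the first derivative, and 2 C2 with the mixed term 2
    C1^2 on the second; one constant serves for both.\<close>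
  proof (rule that[of \<eta> \<eta>' \<eta>'' "2 * C1 + 2 * C2 + 2 * C1 * C1"])
    show "\<eta> n \<in> test_fun" "\<eta>' n \<in> test_fun" "\<eta>'' n \<in> test_fun" for n
      by (rule test_funI[OF sE(1) Nlt] test_funI[OF sE(2) Nlt] test_funI[OF sE(3) Nlt]; use zE in blast)+
    show "(\<eta> n has_vector_derivative \<eta>' n x) (at x)" for n x
      unfolding \<eta>_def \<eta>'_def by (intro has_vector_derivative_mult dA dB)
    show "(\<eta>' n has_vector_derivative \<eta>'' n x) (at x)" for n x
      unfolding \<eta>'_def \<eta>''_def by (intro has_vector_derivative_add has_vector_derivative_mult dA dB)
    show "\<exists>a b. 0 < a \<and> a < b \<and> (\<forall>x. x \<notin> {a..b} \<longrightarrow> \<eta> n x = 0 \<and> \<eta>' n x = 0 \<and> \<eta>'' n x = 0)" for n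
      using Nlt zE by blast
    show "0 \<le> 2 * C1 + 2 * C2 + 2 * C1 * C1" using C1 C2 by simp
    show "cmod (\<eta> n x) \<le> 1" for n x
      using bA(1)[of n x] bB(1)[of n x] by (simp add: \<eta>_def norm_mult mult_le_one)
    show "cmod (of_real x * \<eta>' n x) \<le> 2 * C1 + 2 * C2 + 2 * C1 * C1" for n x
    proof -
      have "of_real x * \<eta>' n x = A n x * (of_real x * B' n x) + (of_real x * A' n x) * B n x"
        by (simp add: \<eta>'_def algebra_simps)
      also have "cmod \<dots> \<le> 1 * C1 + C1 * 1"
        by (intro order_trans[OF norm_triangle_ineq] add_mono cmod_mult_mono bA bB)
      finally show ?thesis using C1(1) C2(1) mult_nonneg_nonneg[OF C1(1) C1(1)] by linarith
    qed
    show "cmod (of_real (x\<^sup>2) * \<eta>'' n x) \<le> 2 * C1 + 2 * C2 + 2 * C1 * C1" for n x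
    proof -
      have "of_real (x\<^sup>2) * \<eta>'' n x = (A n x * (of_real (x\<^sup>2) * B'' n x) + (of_real x * A' n x) * (of_real x * B' n x))
        + ((of_real x * A' n x) * (of_real x * B' n x) + (of_real (x\<^sup>2) * A'' n x) * B n x)"
        by (simp add: \<eta>''_def algebra_simps power2_eq_square)
      also have "cmod \<dots> \<le> (1 * C2 + C1 * C1) + (C1 * C1 + C2 * 1)"
        by (intro order_trans[OF norm_triangle_ineq] add_mono cmod_mult_mono bA bB)
      finally show ?thesis using C1 C2 by simp
    qed
  qed (rule ev)
qed

lemma wint_integration_by_parts:
  assumes h: "h \<in> L2" and psi: "\<psi> \<in> test_fun" "\<psi>' \<in> test_fun" and d: "\<And>x. (\<psi> has_vector_derivative \<psi>' x) (at x)"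
  shows "(LINT x|lebP. wint h x * \<psi>' x + vint h x * \<psi> x) = 0"
proof -
  obtain a b where ab: "0 < a" "a < b" "\<And>x. x \<notin> {a..b} \<Longrightarrow> \<psi> x = 0" using psi(1) by (rule test_funE) blast
  have z': "\<psi>' x = 0" if "x \<notin> {a..b}" for x
    using ab(3) that by (intro locally_constant_derivative_zero[OF d, of "- {a..b}" x 0]) auto
  have "(LINT x|lebP. wint h x * \<psi>' x + vint h x * \<psi> x) = wint h (b+1) * \<psi> (b+1) - wint h (a/2) * \<psi> (a/2)"
  proof (rule integral_FTC_lebP)
    show "continuous_on {a/2..b+1} (\<lambda>x. wint h x * \<psi>' x + vint h x * \<psi> x)"
      by (intro continuous_on_add continuous_on_mult wint_continuous vint_continuous smooth_continuous_on test_fun_smooth psi h)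
    show "wint h x * \<psi>' x + vint h x * \<psi> x = 0" if "x \<notin> {a/2..b+1}" for x
      using that ab(1) ab(3)[of x] z'[of x] by auto
    show "((\<lambda>x. wint h x * \<psi> x) has_vector_derivative wint h x * \<psi>' x + vint h x * \<psi> x) (at x)" for x
      by (intro has_vector_derivative_mult wint_has_derivative h d)
  qed (use ab in auto)
  then show ?thesis using ab(3)[of "b+1"] ab(3)[of "a/2"] ab(1) by simp
qed

text \<open>\<open>k\<close> is what Leibniz' rule gives for the second derivative of \<eta> times
  \<open>wint h\<close>. As \<eta> vanishes near 0, the product divided by x^2 is in L2, and
  \<open>H20I\<close> identifies it with a second primitive: cutting off does not leave the class of
  functions \<open>wint k\<close>.\<close>

lemma wint_cutoff:
  assumes h: "h \<in> L2" and e: "\<eta> \<in> test_fun" "\<eta>' \<in> test_fun" "\<eta>'' \<in> test_fun"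
    and d: "\<And>x. (\<eta> has_vector_derivative \<eta>' x) (at x)" "\<And>x. (\<eta>' has_vector_derivative \<eta>'' x) (at x)"
  defines "k \<equiv> \<lambda>x. \<eta> x * h x + 2 * \<eta>' x * vint h x + \<eta>'' x * wint h x"
  shows "k \<in> L2" "\<And>x. 0 < x \<Longrightarrow> \<eta> x * wint h x = wint k x"
proof -
  have c: "continuous_on S \<eta>" "continuous_on S \<eta>'" "continuous_on S \<eta>''" for S
    using e by (auto intro: smooth_continuous_on test_fun_smooth)
  obtain B where B: "\<And>x. cmod (\<eta> x) \<le> B" using e(1) by (rule test_fun_bounded) blast
  have t: "(\<lambda>x. \<phi> x * u x) \<in> L2" if phi: "\<phi> \<in> test_fun" and u: "continuous_on {0<..} u" for \<phi> u
  proof -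
    obtain a b where ab: "0 < a" "a < b" "\<And>x. x \<notin> {a..b} \<Longrightarrow> \<phi> x = 0" using phi by (rule test_funE) blast
    have "continuous_on {a..b} (\<lambda>x. \<phi> x * u x)"
      by (intro continuous_on_mult smooth_continuous_on test_fun_smooth phi continuous_on_subset[OF u])
        (use ab in auto)
    then show ?thesis
      by (rule L2_of_compact_support[OF ab(1) less_imp_le[OF ab(2)]]) (simp add: ab(3))
  qed
  have "(\<lambda>x. \<eta> x * h x) \<in> L2"
    by (rule L2_mult_bounded(1)[OF h test_fun_measurable[OF e(1)] B])
  then show kL: "k \<in> L2"
    unfolding k_def mult.assoc
    using L2_add[OF L2_add[OF _ L2_cmult[OF t[OF e(2) vint_continuous[OF h]], of 2]] t[OF e(3) wint_continuous[OF h]]]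
    by simp
  define f where "f x = \<eta> x * wint h x" for x
  have fL: "f \<in> L2" unfolding f_def by (intro t e wint_continuous h)
  have "(\<lambda>x. (\<eta> x / of_real (x\<^sup>2)) * wint h x) \<in> L2"
  proof -
    have "(\<lambda>x. \<eta> x * (wint h x / of_real (x\<^sup>2))) \<in> L2"
      by (intro t e continuous_intros wint_continuous h) auto
    then show ?thesis by simp
  qed
  then have fq: "(\<lambda>x. f x / of_real (x\<^sup>2)) \<in> L2" by (simp add: f_def)
  have dist: "dist_deriv2 f k"
    unfolding dist_deriv2_def
  proof
    fix \<phi> assume phi: "\<phi> \<in> test_fun"
    obtain \<phi>' where p: "\<phi>' \<in> test_fun" "deriv2 \<phi> \<in> test_fun"
      "\<And>x. (\<phi> has_vector_derivative \<phi>' x) (at x)" "\<And>x. (\<phi>' has_vector_derivative deriv2 \<phi> x) (at x)"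
      using phi by (rule test_fun_derivatives) blast
    have s: "smooth \<eta>" "smooth \<eta>'" "smooth \<eta>''" using e by (auto intro: test_fun_smooth)
    have ep: "(\<lambda>x. \<eta> x * \<phi> x) \<in> test_fun" by (rule test_fun_mult[OF s(1) phi])
    have dd: "deriv2 (\<lambda>x. \<eta> x * \<phi> x) = (\<lambda>x. (\<eta> x * deriv2 \<phi> x + \<eta>' x * \<phi>' x) + (\<eta>' x * \<phi>' x + \<eta>'' x * \<phi> x))"
      by (rule deriv2_eqI[of _ "\<lambda>x. \<eta> x * \<phi>' x + \<eta>' x * \<phi> x"])
        (intro has_vector_derivative_add has_vector_derivative_mult d p)+
    have psi: "(\<lambda>x. \<eta>' x * \<phi> x) \<in> test_fun" "(\<lambda>x. \<eta>' x * \<phi>' x + \<eta>'' x * \<phi> x) \<in> test_fun"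
      by (intro test_fun_add test_fun_mult s phi p)+
    have dpsi: "((\<lambda>x. \<eta>' x * \<phi> x) has_vector_derivative \<eta>' x * \<phi>' x + \<eta>'' x * \<phi> x) (at x)" for x
      by (intro has_vector_derivative_mult d p)
    note w = L2loc_continuous[OF wint_continuous[OF h]] and v = L2loc_continuous[OF vint_continuous[OF h]]
    have "deriv2 (\<lambda>x. \<eta> x * \<phi> x) \<in> test_fun" using ep by (rule test_fun_derivatives)
    then have i1: "integrable lebP (\<lambda>x. wint h x * deriv2 (\<lambda>x. \<eta> x * \<phi> x) x)"
      by (rule L2loc_mult_test_fun_integrable[OF w])
    have i2: "integrable lebP (\<lambda>x. h x * (\<eta> x * \<phi> x))"
      by (rule L2loc_mult_test_fun_integrable[OF L2loc_L2[OF h] ep])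
    have i3: "integrable lebP (\<lambda>x. wint h x * (\<eta>' x * \<phi>' x + \<eta>'' x * \<phi> x) + vint h x * (\<eta>' x * \<phi> x))"
      by (intro Bochner_Integration.integrable_add L2loc_mult_test_fun_integrable w v psi)
    have i4: "integrable lebP (\<lambda>x. f x * deriv2 \<phi> x)" "integrable lebP (\<lambda>x. k x * \<phi> x)"
      by (intro L2loc_mult_test_fun_integrable L2loc_L2 fL kL p phi)+
    \<comment> \<open>The integrand is regrouped so that the second derivative falls on the test
      function \<eta> \<phi>; what remains is -2 times the derivative of \<open>wint h\<close>
      \<eta>' \<phi>. Both groups have integral 0.\<close>
    have "(LINT x|lebP. f x * deriv2 \<phi> x - k x * \<phi> x) = (LINT x|lebP. (wint h x * deriv2 (\<lambda>x. \<eta> x * \<phi> x) x - h x * (\<eta> x * \<phi> x))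
        - 2 * (wint h x * (\<eta>' x * \<phi>' x + \<eta>'' x * \<phi> x) + vint h x * (\<eta>' x * \<phi> x)))"
      by (rule Bochner_Integration.integral_cong) (auto simp: dd f_def k_def algebra_simps)
    also have "\<dots> = ((LINT x|lebP. wint h x * deriv2 (\<lambda>x. \<eta> x * \<phi> x) x) - (LINT x|lebP. h x * (\<eta> x * \<phi> x)))
        - 2 * (LINT x|lebP. wint h x * (\<eta>' x * \<phi>' x + \<eta>'' x * \<phi> x) + vint h x * (\<eta>' x * \<phi> x))"
      by (subst Bochner_Integration.integral_diff[OF Bochner_Integration.integrable_diff[OF i1 i2] integrable_mult_right[OF i3]])
        (simp only: Bochner_Integration.integral_diff[OF i1 i2] integral_mult_right_zero)
    also have "\<dots> = 0"
      by (simp only: wint_weak_deriv2[OF h ep] wint_integration_by_parts[OF h psi dpsi]) simp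
    finally show "(LINT x|lebP. f x * deriv2 \<phi> x) = (LINT x|lebP. k x * \<phi> x)"
      using i4 by simp
  qed
  have ae: "AE x in lebP. f x = wint k x" by (rule H20I(2)[OF fL kL dist fq])
  show "\<eta> x * wint h x = wint k x" if "0 < x" for x
  proof -
    have "f x - wint k x = 0"
    proof (rule continuous_AE_zero[OF _ _ that])
      show "continuous_on {0<..} (\<lambda>x. f x - wint k x)"
        unfolding f_def by (intro continuous_intros c wint_continuous h kL)
      show "AE x in lebP. f x - wint k x = 0" using ae by eventually_elim simp
    qed
    then show ?thesis by (simp add: f_def)
  qed
qed

lemma cmod_add3_sq_le: "(cmod (a + b + c))\<^sup>2 \<le> 4 * (cmod a)\<^sup>2 + 4 * (cmod b)\<^sup>2 + 2 * (cmod c)\<^sup>2"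
  using cmod_add_sq_le[of "a + b" c] cmod_add_sq_le[of a b] by linarith

lemma cmod_mult_sq_le: "cmod p \<le> s \<Longrightarrow> (cmod (p * q))\<^sup>2 \<le> s\<^sup>2 * (cmod q)\<^sup>2"
  unfolding norm_mult power_mult_distrib by (intro mult_right_mono power_mono) auto

lemma eventually_L2_sq_less:
  assumes "(\<lambda>n. L2_sq (f n)) \<longlonglongrightarrow> 0" "0 < e" shows "eventually (\<lambda>n. L2_sq (f n) < e) sequentially"
  using order_tendstoD(2)[OF assms] .

text \<open>Cutting off replaces \<open>h\<close> by \<eta> h plus commutator terms. Hardy's
  inequality shows that these are bounded multipliers times square integrable functions; they tend
  to 0 pointwise, hence in norm. What remains has compact support and is left to
  \<open>wint_compact_approx\<close>.\<close>

lemma wint_test_fun_dense: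
  assumes h: "h \<in> L2" and w: "wint h \<in> L2" and e: "0 < e"
  obtains \<phi> where "\<phi> \<in> test_fun" "L2_sq (\<lambda>x. h x - deriv2 \<phi> x) < e"
    "L2_sq (\<lambda>x. wint h x - \<phi> x) < e" "L2_sq (\<lambda>x. (wint h x - \<phi> x) / of_real (x\<^sup>2)) < e"
proof -
  obtain \<eta> \<eta>' \<eta>'' :: "nat \<Rightarrow> real \<Rightarrow> complex" and C :: real where
    t: "\<And>n. \<eta> n \<in> test_fun" "\<And>n. \<eta>' n \<in> test_fun" "\<And>n. \<eta>'' n \<in> test_fun"
    and d: "\<And>n x. (\<eta> n has_vector_derivative \<eta>' n x) (at x)" "\<And>n x. (\<eta>' n has_vector_derivative \<eta>'' n x) (at x)"
    and z: "\<And>n. \<exists>a b. 0 < a \<and> a < b \<and> (\<forall>x. x \<notin> {a..b} \<longrightarrow> \<eta> n x = 0 \<and> \<eta>' n x = 0 \<and> \<eta>'' n x = 0)"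
    and C: "0 \<le> C" "\<And>n x. cmod (\<eta> n x) \<le> 1" "\<And>n x. cmod (of_real x * \<eta>' n x) \<le> C"
    "\<And>n x. cmod (of_real (x\<^sup>2) * \<eta>'' n x) \<le> C"
    and ev: "\<And>x. 0 < x \<Longrightarrow> eventually (\<lambda>n. \<eta> n x = 1 \<and> \<eta>' n x = 0 \<and> \<eta>'' n x = 0) sequentially"
    by (rule cutoff_sequence) blast
  define k where "k n x = \<eta> n x * h x + 2 * \<eta>' n x * vint h x + \<eta>'' n x * wint h x" for n x
  have kL: "k n \<in> L2" and kw: "\<And>x. 0 < x \<Longrightarrow> \<eta> n x * wint h x = wint (k n) x" for n
    using wint_cutoff[OF h t(1)[of n] t(2)[of n] t(3)[of n] d(1)[of n] d(2)[of n]]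
    unfolding k_def[symmetric] by auto
  have [measurable]: "h \<in> borel_measurable lebP" "vint h \<in> borel_measurable lebP" "wint h \<in> borel_measurable lebP"
    "\<eta> n \<in> borel_measurable lebP" "\<eta>' n \<in> borel_measurable lebP" "\<eta>'' n \<in> borel_measurable lebP" "k n \<in> borel_measurable lebP" for n
    by (intro L2_measurable[OF h] L2_measurable[OF kL] test_fun_measurable[OF t(1)] test_fun_measurable[OF t(2)]
        test_fun_measurable[OF t(3)] continuous_measurable_lebP vint_continuous[OF h] wint_continuous[OF h])+
  have b2: "cmod (1 - \<eta> n x) \<le> 2" for n x
    using norm_triangle_ineq4[of 1 "\<eta> n x"] C(2)[of n x] by simp
  have lim1: "(\<lambda>n. L2_sq (\<lambda>x. (1 - \<eta> n x) * f x)) \<longlonglongrightarrow> 0" if f: "f \<in> L2" for f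
  proof (rule L2_sq_tendsto_0I)
    have [measurable]: "f \<in> borel_measurable lebP" using f by (rule L2_measurable)
    show "(\<lambda>x. (1 - \<eta> n x) * f x) \<in> borel_measurable lebP" for n by measurable
    show "integrable lebP (\<lambda>x. 2\<^sup>2 * (cmod (f x))\<^sup>2)" using L2_integrable[OF f] by simp
    show "(cmod ((1 - \<eta> n x) * f x))\<^sup>2 \<le> 2\<^sup>2 * (cmod (f x))\<^sup>2" for n x
      unfolding norm_mult power_mult_distrib by (intro mult_right_mono power_mono b2) auto
    show "AE x in lebP. (\<lambda>n. (1 - \<eta> n x) * f x) \<longlonglongrightarrow> 0"
    proof (rule AE_I2)
      fix x assume "x \<in> space lebP"
      then have "eventually (\<lambda>n. 0 = (1 - \<eta> n x) * f x) sequentially"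
        using ev[of x] by (auto elim: eventually_mono)
      then show "(\<lambda>n. (1 - \<eta> n x) * f x) \<longlonglongrightarrow> 0" by (rule Lim_transform_eventually[OF tendsto_const])
    qed
  qed
  have lim2: "(\<lambda>n. L2_sq (\<lambda>x. h x - k n x)) \<longlonglongrightarrow> 0"
  proof (rule L2_sq_tendsto_0I)
    show "(\<lambda>x. h x - k n x) \<in> borel_measurable lebP" for n by measurable
    let ?g = "\<lambda>x. 4 * (2\<^sup>2 * (cmod (h x))\<^sup>2) + 4 * ((2 * C)\<^sup>2 * (cmod (vint h x / of_real x))\<^sup>2) + 2 * (C\<^sup>2 * (cmod (wint h x / of_real (x\<^sup>2)))\<^sup>2)"
    show "integrable lebP ?g"
      by (intro Bochner_Integration.integrable_add integrable_mult_right L2_integrable h Hardy_inequality)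
    show "(cmod (h x - k n x))\<^sup>2 \<le> ?g x" if x: "0 < x" for n x
    proof -
      have eq: "h x - k n x = (1 - \<eta> n x) * h x + (- 2 * (of_real x * \<eta>' n x)) * (vint h x / of_real x)
          + (- (of_real (x\<^sup>2) * \<eta>'' n x)) * (wint h x / of_real (x\<^sup>2))"
        using x by (simp add: k_def field_simps)
      have "cmod (- 2 * (of_real x * \<eta>' n x)) \<le> 2 * C" "cmod (- (of_real (x\<^sup>2) * \<eta>'' n x)) \<le> C"
        using C(3)[where n=n and x=x] C(4)[where n=n and x=x] by (simp_all only: norm_mult norm_minus_cancel) simp_all
      then show ?thesis
        unfolding eq using b2[of n x]
        by (intro order_trans[OF cmod_add3_sq_le] add_mono mult_left_mono cmod_mult_sq_le) auto
    qed
    show "AE x in lebP. (\<lambda>n. h x - k n x) \<longlonglongrightarrow> 0"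
    proof (rule AE_I2)
      fix x assume "x \<in> space lebP"
      then have "eventually (\<lambda>n. 0 = h x - k n x) sequentially"
        using ev[of x] by (auto elim!: eventually_mono simp: k_def)
      then show "(\<lambda>n. h x - k n x) \<longlonglongrightarrow> 0" by (rule Lim_transform_eventually[OF tendsto_const])
    qed
  qed
  have e4: "0 < e/4" using e by simp
  have "eventually (\<lambda>n. L2_sq (\<lambda>x. h x - k n x) < e/4 \<and> L2_sq (\<lambda>x. (1 - \<eta> n x) * wint h x) < e/4 \<and>
      L2_sq (\<lambda>x. (1 - \<eta> n x) * (wint h x / of_real (x\<^sup>2))) < e/4) sequentially"
    by (intro eventually_conj eventually_L2_sq_less[OF _ e4] lim2 lim1 w Hardy_inequality h)
  then obtain n where n: "L2_sq (\<lambda>x. h x - k n x) < e/4" "L2_sq (\<lambda>x. (1 - \<eta> n x) * wint h x) < e/4"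
    "L2_sq (\<lambda>x. (1 - \<eta> n x) * (wint h x / of_real (x\<^sup>2))) < e/4"
    by (auto dest: eventually_happens)
  from z[of n] obtain a b where ab: "0 < a" "a < b" "\<And>x. x \<notin> {a..b} \<Longrightarrow> \<eta> n x = 0 \<and> \<eta>' n x = 0 \<and> \<eta>'' n x = 0" by blast
  have kz: "k n x = 0" if "x \<notin> {a..b}" for x using ab(3)[OF that] by (simp add: k_def)
  have wz: "wint (k n) x = 0" if "b < x" for x
    using kw[of x n] ab(3)[of x] that ab by simp
  obtain \<phi> where phi: "\<phi> \<in> test_fun" "L2_sq (\<lambda>x. k n x - deriv2 \<phi> x) < e/4" "(\<lambda>x. wint (k n) x - \<phi> x) \<in> L2"
    "L2_sq (\<lambda>x. wint (k n) x - \<phi> x) < e/4" "L2_sq (\<lambda>x. (wint (k n) x - \<phi> x) / of_real (x\<^sup>2)) < e/4"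
    using wint_compact_approx[OF kL ab(1,2) kz wz e4] by blast
  have d2: "deriv2 \<phi> \<in> L2" using phi(1) by (intro test_fun_L2) (rule test_fun_derivatives)
  have comb: "L2_sq f < e" if "p \<in> L2" "q \<in> L2" "L2_sq p < e/4" "L2_sq q < e/4" "f \<in> L2" "\<And>x. 0 < x \<Longrightarrow> f x = p x + q x" for f p q
  proof -
    have "L2_sq f = L2_sq (\<lambda>x. p x + q x)"
      by (rule L2_sq_cong_AE[OF that(5) L2_add[OF that(1,2)]]) (use that(6) in \<open>auto intro!: AE_I2\<close>)
    then show ?thesis using L2_sq_add_le[OF that(1,2)] that(3,4) by linarith
  qed
  have mL: "(\<lambda>x. (1 - \<eta> n x) * f x) \<in> L2" if "f \<in> L2" for f
    by (rule L2_mult_bounded(1)[OF that _ b2]) measurable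
  have phiL: "\<phi> \<in> L2" "(\<lambda>x. \<phi> x / of_real (x\<^sup>2)) \<in> L2"
    by (rule test_fun_L2[OF phi(1)], rule test_fun_over_square[OF phi(1)])
  show ?thesis
  proof (rule that[OF phi(1)])
    show "L2_sq (\<lambda>x. h x - deriv2 \<phi> x) < e"
      by (rule comb[OF L2_diff[OF h kL] L2_diff[OF kL d2] n(1) phi(2) L2_diff[OF h d2]]) simp
    show "L2_sq (\<lambda>x. wint h x - \<phi> x) < e"
      by (rule comb[OF mL[OF w] phi(3) n(2) phi(4) L2_diff[OF w phiL(1)]])
        (simp add: kw[symmetric] algebra_simps)
    have 1: "(\<lambda>x. (wint h x - \<phi> x) / of_real (x\<^sup>2)) \<in> L2" "(\<lambda>x. (wint (k n) x - \<phi> x) / of_real (x\<^sup>2)) \<in> L2"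
      using L2_diff[OF Hardy_inequality(3)[OF h] phiL(2)] L2_diff[OF Hardy_inequality(3)[OF kL] phiL(2)]
      by (simp_all add: diff_divide_distrib)
    show "L2_sq (\<lambda>x. (wint h x - \<phi> x) / of_real (x\<^sup>2)) < e"
      by (rule comb[OF mL[OF Hardy_inequality(3)[OF h]] 1(2) n(3) phi(5) 1(1)])
        (simp add: kw[symmetric] diff_divide_distrib add_divide_distrib algebra_simps)
  qed
qed

section \<open>The minimal and maximal operators\<close>

text \<open>Here \<open>h\<close> plays the role of f''; on \<open>H20\<close> the two terms are
  separately in L2.\<close>

definition L_expr :: "complex \<Rightarrow> (real \<Rightarrow> complex) \<Rightarrow> (real \<Rightarrow> complex) \<Rightarrow> real \<Rightarrow> complex" where
  "L_expr \<alpha> f h x = (\<alpha> - 1/4) * (f x / of_real (x\<^sup>2)) - h x"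

lemma L_expr_L2: "(\<lambda>x. f x / of_real (x\<^sup>2)) \<in> L2 \<Longrightarrow> h \<in> L2 \<Longrightarrow> L_expr \<alpha> f h \<in> L2"
  unfolding L_expr_def[abs_def] by (intro L2_diff L2_cmult)

lemma L_expr_test_fun:
  "(\<lambda>x. - deriv2 \<phi> x + (\<alpha> - 1/4) / (of_real x)\<^sup>2 * \<phi> x) = L_expr \<alpha> \<phi> (deriv2 \<phi>)"
  by (simp add: L_expr_def fun_eq_iff)

lemma L_expr_test_fun_L2: "\<phi> \<in> test_fun \<Longrightarrow> L_expr \<alpha> \<phi> (deriv2 \<phi>) \<in> L2"
  by (intro L_expr_L2 test_fun_over_square test_fun_L2) (auto elim: test_fun_derivatives)

lemma dist_L_iff:
  "dist_L \<alpha> f g \<longleftrightarrow> (\<forall>\<phi>\<in>test_fun. (LINT x|lebP. f x * L_expr \<alpha> \<phi> (deriv2 \<phi>) x) = (LINT x|lebP. g x * \<phi> x))"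
  unfolding dist_L_def L_expr_test_fun[symmetric] ..

lemma L_maxI:
  assumes f: "f \<in> L2" "(\<lambda>x. f x / of_real (x\<^sup>2)) \<in> L2" and h: "h \<in> L2" and d: "dist_deriv2 f h"
  shows "(f, L_expr \<alpha> f h) \<in> L_max \<alpha>"
proof -
  have "dist_L \<alpha> f (L_expr \<alpha> f h)"
    unfolding dist_L_iff
  proof
    fix \<phi> assume phi: "\<phi> \<in> test_fun"
    have p2: "deriv2 \<phi> \<in> test_fun" using phi by (rule test_fun_derivatives)
    note i = L2loc_mult_test_fun_integrable[OF L2loc_L2[OF f(1)] p2] L2loc_mult_test_fun_integrable[OF L2loc_L2[OF h] phi]
      integrable_mult_right[OF L2loc_mult_test_fun_integrable[OF L2loc_L2[OF f(2)] phi], of "\<alpha> - 1/4"]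
    have "(LINT x|lebP. f x * L_expr \<alpha> \<phi> (deriv2 \<phi>) x) =
        (LINT x|lebP. (\<alpha> - 1/4) * ((f x / of_real (x\<^sup>2)) * \<phi> x) - f x * deriv2 \<phi> x)"
      by (rule Bochner_Integration.integral_cong) (auto simp: L_expr_def right_diff_distrib)
    also have "\<dots> = (LINT x|lebP. (\<alpha> - 1/4) * ((f x / of_real (x\<^sup>2)) * \<phi> x)) - (LINT x|lebP. f x * deriv2 \<phi> x)"
      by (rule Bochner_Integration.integral_diff[OF i(3) i(1)])
    also have "(LINT x|lebP. f x * deriv2 \<phi> x) = (LINT x|lebP. h x * \<phi> x)"
      using d phi by (simp add: dist_deriv2_def)
    also have "(LINT x|lebP. (\<alpha> - 1/4) * ((f x / of_real (x\<^sup>2)) * \<phi> x)) - (LINT x|lebP. h x * \<phi> x) =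
        (LINT x|lebP. (\<alpha> - 1/4) * ((f x / of_real (x\<^sup>2)) * \<phi> x) - h x * \<phi> x)"
      by (rule Bochner_Integration.integral_diff[OF i(3) i(2), symmetric])
    also have "\<dots> = (LINT x|lebP. L_expr \<alpha> f h x * \<phi> x)"
      by (rule Bochner_Integration.integral_cong) (auto simp: L_expr_def left_diff_distrib)
    finally show "(LINT x|lebP. f x * L_expr \<alpha> \<phi> (deriv2 \<phi>) x) = (LINT x|lebP. L_expr \<alpha> f h x * \<phi> x)" .
  qed
  then show ?thesis using f h by (auto simp: L_max_def intro: L_expr_L2)
qed

lemma L_max_test_fun: "\<phi> \<in> test_fun \<Longrightarrow> (\<phi>, L_expr \<alpha> \<phi> (deriv2 \<phi>)) \<in> L_max \<alpha>"
  by (intro L_maxI test_fun_L2 test_fun_over_square test_fun_H20(2)) (auto elim: test_fun_derivatives)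

text \<open>A graph consists of pairs of representatives, so one \<open>f\<close> has many images.
  Knowing that they agree almost everywhere carries approximations of one image over to
  another.\<close>

lemma L_max_unique:
  assumes "(f, g) \<in> L_max \<alpha>" "(f, g') \<in> L_max \<alpha>" shows "AE x in lebP. g x = g' x"
proof -
  have L: "g \<in> L2" "g' \<in> L2" and d: "dist_L \<alpha> f g" "dist_L \<alpha> f g'" using assms by (auto simp: L_max_def)
  have "AE x in lebP. g x - g' x = 0"
  proof (rule fundamental_lemma_variations[OF L2loc_diff[OF L2loc_L2[OF L(1)] L2loc_L2[OF L(2)]]])
    fix \<phi> assume "\<phi> \<in> test_fun"
    then show "(LINT x|lebP. (g x - g' x) * \<phi> x) = 0"
      using d L2loc_mult_test_fun_integrable[OF L2loc_L2[OF L(1)]] L2loc_mult_test_fun_integrable[OF L2loc_L2[OF L(2)]]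
      by (simp add: dist_L_iff left_diff_distrib)
  qed
  then show ?thesis by eventually_elim simp
qed

lemma L_max_linear:
  assumes "(f, g) \<in> L_max \<alpha>" "(f', g') \<in> L_max \<alpha>"
  shows "((\<lambda>x. f x + c * f' x), (\<lambda>x. g x + c * g' x)) \<in> L_max \<alpha>"
proof -
  have L: "f \<in> L2" "f' \<in> L2" "g \<in> L2" "g' \<in> L2" and d: "dist_L \<alpha> f g" "dist_L \<alpha> f' g'"
    using assms by (auto simp: L_max_def)
  have "dist_L \<alpha> (\<lambda>x. f x + c * f' x) (\<lambda>x. g x + c * g' x)"
    unfolding dist_L_iff
  proof
    fix \<phi> assume phi: "\<phi> \<in> test_fun"
    note i = integrable_mult_L2[OF L(1) L_expr_test_fun_L2[OF phi]] integrable_mult_L2[OF L(2) L_expr_test_fun_L2[OF phi]]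
      integrable_mult_L2[OF L(3) test_fun_L2[OF phi]] integrable_mult_L2[OF L(4) test_fun_L2[OF phi]]
    show "(LINT x|lebP. (f x + c * f' x) * L_expr \<alpha> \<phi> (deriv2 \<phi>) x) = (LINT x|lebP. (g x + c * g' x) * \<phi> x)"
      using d phi i unfolding dist_L_iff distrib_right mult.assoc by simp
  qed
  then show ?thesis using L by (auto simp: L_max_def intro: L2_add L2_cmult)
qed

text \<open>For a fixed test function both sides of the defining identity are continuous in the L2
  norm.\<close>

lemma L_max_closed:
  assumes L: "f \<in> L2" "g \<in> L2"
    and c: "\<And>e. 0 < e \<Longrightarrow> \<exists>f' g'. (f', g') \<in> L_max \<alpha> \<and> L2_sq (\<lambda>x. f x - f' x) < e \<and> L2_sq (\<lambda>x. g x - g' x) < e"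
  shows "(f, g) \<in> L_max \<alpha>"
proof -
  have "dist_L \<alpha> f g" unfolding dist_L_iff
  proof
    fix \<phi> assume phi: "\<phi> \<in> test_fun"
    define u where "u = L_expr \<alpha> \<phi> (deriv2 \<phi>)"
    have u: "u \<in> L2" and pL: "\<phi> \<in> L2" unfolding u_def using L_expr_test_fun_L2[OF phi] test_fun_L2[OF phi] by auto
    define z where "z = (LINT x|lebP. f x * u x) - (LINT x|lebP. g x * \<phi> x)"
    define K where "K = 2 * L2_sq u + 2 * L2_sq \<phi> + 1"
    have K: "0 < K" unfolding K_def using L2_sq_nonneg[of u] L2_sq_nonneg[of \<phi>] by linarith
    have bd: "(cmod z)\<^sup>2 \<le> K * e" if e: "0 < e" for e
    proof -
      obtain f' g' where fg: "(f', g') \<in> L_max \<alpha>" "L2_sq (\<lambda>x. f x - f' x) < e" "L2_sq (\<lambda>x. g x - g' x) < e"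
        using c[OF e] by blast
      then have L': "f' \<in> L2" "g' \<in> L2" and d: "dist_L \<alpha> f' g'" by (auto simp: L_max_def)
      have "(LINT x|lebP. f' x * u x) = (LINT x|lebP. g' x * \<phi> x)"
        using d phi unfolding dist_L_iff u_def by blast
      then have zz: "z = (LINT x|lebP. (f x - f' x) * u x) - (LINT x|lebP. (g x - g' x) * \<phi> x)"
        unfolding z_def left_diff_distrib
        using integrable_mult_L2[OF L(1) u] integrable_mult_L2[OF L'(1) u]
          integrable_mult_L2[OF L(2) pL] integrable_mult_L2[OF L'(2) pL] by simp
      have "(cmod z)\<^sup>2 \<le> 2 * (cmod (LINT x|lebP. (f x - f' x) * u x))\<^sup>2 + 2 * (cmod (LINT x|lebP. (g x - g' x) * \<phi> x))\<^sup>2"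
        unfolding zz using cmod_add_sq_le[of _ "- _"] by simp
      also have "\<dots> \<le> 2 * (L2_sq (\<lambda>x. f x - f' x) * L2_sq u) + 2 * (L2_sq (\<lambda>x. g x - g' x) * L2_sq \<phi>)"
        by (intro add_mono mult_left_mono Cauchy_Schwarz_L2 L2_diff L L' u pL) auto
      also have "\<dots> \<le> 2 * (e * L2_sq u) + 2 * (e * L2_sq \<phi>)"
        using fg by (intro add_mono mult_left_mono mult_right_mono) auto
      also have "\<dots> \<le> K * e" using e by (simp add: K_def algebra_simps)
      finally show ?thesis .
    qed
    have "(cmod z)\<^sup>2 \<le> 0"
    proof (rule field_le_epsilon)
      fix e :: real assume "0 < e"
      then show "(cmod z)\<^sup>2 \<le> 0 + e" using bd[of "e / K"] K by simp
    qed
    then have "z = 0" by simp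
    then show "(LINT x|lebP. f x * L_expr \<alpha> \<phi> (deriv2 \<phi>) x) = (LINT x|lebP. g x * \<phi> x)"
      by (simp add: z_def u_def)
  qed
  then show ?thesis using L by (simp add: L_max_def)
qed

section \<open>Graph norm, closure and the minimal operator\<close>

lemma graph_norm_less_iff:
  assumes "0 < e"
  shows "graph_norm (p - q) < e \<longleftrightarrow> L2_sq (\<lambda>x. fst p x - fst q x) + L2_sq (\<lambda>x. snd p x - snd q x) < e\<^sup>2"
proof -
  have "graph_norm (p - q) = sqrt (L2_sq (\<lambda>x. fst p x - fst q x) + L2_sq (\<lambda>x. snd p x - snd q x))"
    by (simp add: graph_norm_def L2_norm_sq fun_diff_def)
  moreover have "sqrt s < e \<longleftrightarrow> s < e\<^sup>2" for s
    using real_sqrt_less_iff[of s "e\<^sup>2"] assms by simp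
  ultimately show ?thesis by simp
qed

lemma op_closureI:
  assumes "f \<in> L2" "g \<in> L2"
    and c: "\<And>e. 0 < e \<Longrightarrow> \<exists>f' g'. (f', g') \<in> T \<and> L2_sq (\<lambda>x. f x - f' x) < e \<and> L2_sq (\<lambda>x. g x - g' x) < e"
  shows "(f, g) \<in> op_closure T"
  unfolding op_closure_def
proof (intro CollectI conjI allI impI)
  fix e :: real assume e: "0 < e"
  then have "0 < e\<^sup>2 / 2" by simp
  from c[OF this] obtain f' g' where "(f', g') \<in> T" "L2_sq (\<lambda>x. f x - f' x) < e\<^sup>2 / 2" "L2_sq (\<lambda>x. g x - g' x) < e\<^sup>2 / 2"
    by blast
  then show "\<exists>q\<in>T. graph_norm ((f, g) - q) < e"
    using graph_norm_less_iff[OF e, of "(f, g)" "(f', g')"] by (intro bexI[of _ "(f', g')"]) auto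
qed (use assms in auto)

lemma op_closureD:
  assumes p: "(f, g) \<in> op_closure T" and e: "0 < e"
  shows "\<exists>f' g'. (f', g') \<in> T \<and> L2_sq (\<lambda>x. f x - f' x) < e \<and> L2_sq (\<lambda>x. g x - g' x) < e"
proof -
  have s: "0 < sqrt e" using e by simp
  from p s obtain q where q: "q \<in> T" "graph_norm ((f, g) - q) < sqrt e"
    unfolding op_closure_def by blast
  have "L2_sq (\<lambda>x. f x - fst q x) + L2_sq (\<lambda>x. g x - snd q x) < e"
    using q(2) graph_norm_less_iff[OF s, of "(f, g)" q] e by simp
  then have "L2_sq (\<lambda>x. f x - fst q x) < e" "L2_sq (\<lambda>x. g x - snd q x) < e"
    using L2_sq_nonneg[of "\<lambda>x. f x - fst q x"] L2_sq_nonneg[of "\<lambda>x. g x - snd q x"] by linarith+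
  with q(1) show ?thesis by (intro exI[of _ "fst q"] exI[of _ "snd q"]) auto
qed

lemma op_closure_L2: "(f, g) \<in> op_closure T \<Longrightarrow> f \<in> L2" "(f, g) \<in> op_closure T \<Longrightarrow> g \<in> L2"
  by (auto simp: op_closure_def)

lemma L_min_subset_L_max: "L_min \<alpha> \<subseteq> L_max \<alpha>"
proof clarify
  fix f g assume p: "(f, g) \<in> L_min \<alpha>"
  show "(f, g) \<in> L_max \<alpha>"
  proof (rule L_max_closed)
    fix e :: real assume "0 < e"
    from op_closureD[OF p[unfolded L_min_def] this]
    show "\<exists>f' g'. (f', g') \<in> L_max \<alpha> \<and> L2_sq (\<lambda>x. f x - f' x) < e \<and> L2_sq (\<lambda>x. g x - g' x) < e"
      by (auto simp: op_restrict_def)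
  qed (use p in \<open>auto simp: L_min_def dest: op_closure_L2\<close>)
qed

lemma L2_sq_triangle:
  assumes "f \<in> L2" "g \<in> L2" "h \<in> L2" "L2_sq (\<lambda>x. f x - g x) < e/4" "L2_sq (\<lambda>x. g x - h x) < e/4"
  shows "L2_sq (\<lambda>x. f x - h x) < e"
  using L2_sq_add_le[OF L2_diff[OF assms(1,2)] L2_diff[OF assms(2,3)]] assms(4,5) by simp

lemma L_min_closed:
  assumes L: "f \<in> L2" "g \<in> L2"
    and c: "\<And>e. 0 < e \<Longrightarrow> \<exists>f' g'. (f', g') \<in> L_min \<alpha> \<and> L2_sq (\<lambda>x. f x - f' x) < e \<and> L2_sq (\<lambda>x. g x - g' x) < e"
  shows "(f, g) \<in> L_min \<alpha>"
  unfolding L_min_def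
proof (rule op_closureI[OF L])
  fix e :: real assume "0 < e"
  then have e4: "0 < e/4" by simp
  from c[OF e4] obtain f' g' where 1: "(f', g') \<in> L_min \<alpha>" "L2_sq (\<lambda>x. f x - f' x) < e/4" "L2_sq (\<lambda>x. g x - g' x) < e/4"
    by blast
  from op_closureD[OF 1(1)[unfolded L_min_def] e4] obtain f'' g'' where
    2: "(f'', g'') \<in> op_restrict (L_max \<alpha>) test_fun" "L2_sq (\<lambda>x. f' x - f'' x) < e/4" "L2_sq (\<lambda>x. g' x - g'' x) < e/4"
    by blast
  have "f' \<in> L2" "g' \<in> L2" using 1(1) unfolding L_min_def by (auto dest: op_closure_L2)
  moreover have "f'' \<in> L2" "g'' \<in> L2" using 2(1) by (auto simp: op_restrict_def L_max_def)
  ultimately have "L2_sq (\<lambda>x. f x - f'' x) < e" "L2_sq (\<lambda>x. g x - g'' x) < e"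
    using L2_sq_triangle[OF L(1) _ _ 1(2) 2(2)] L2_sq_triangle[OF L(2) _ _ 1(3) 2(3)] by auto
  with 2(1) show "\<exists>f' g'. (f', g') \<in> op_restrict (L_max \<alpha>) test_fun \<and> L2_sq (\<lambda>x. f x - f' x) < e \<and> L2_sq (\<lambda>x. g x - g' x) < e"
    by blast
qed

lemma L_min_linear:
  assumes p: "(f, g) \<in> L_min \<alpha>" and q: "(f', g') \<in> L_min \<alpha>"
  shows "((\<lambda>x. f x + c * f' x), (\<lambda>x. g x + c * g' x)) \<in> L_min \<alpha>"
  unfolding L_min_def
proof (rule op_closureI)
  note p = p[unfolded L_min_def] and q = q[unfolded L_min_def]
  have L: "f \<in> L2" "g \<in> L2" "f' \<in> L2" "g' \<in> L2" using op_closure_L2 p q by blast+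
  then show "(\<lambda>x. f x + c * f' x) \<in> L2" "(\<lambda>x. g x + c * g' x) \<in> L2" by (auto intro: L2_add L2_cmult)
  fix e :: real assume e: "0 < e"
  define d where "d = e / (4 * (1 + (cmod c)\<^sup>2))"
  have c1: "0 < 1 + (cmod c)\<^sup>2" by (simp add: add_pos_nonneg)
  have d: "0 < d" using e c1 by (simp add: d_def)
  have de: "4 * (d + (cmod c)\<^sup>2 * d) = e"
  proof -
    have "4 * (d + (cmod c)\<^sup>2 * d) = 4 * (1 + (cmod c)\<^sup>2) * d" by (simp add: algebra_simps)
    then show ?thesis unfolding d_def using c1 by simp
  qed
  from op_closureD[OF p d] obtain u v where
    1: "(u, v) \<in> op_restrict (L_max \<alpha>) test_fun" "L2_sq (\<lambda>x. f x - u x) < d" "L2_sq (\<lambda>x. g x - v x) < d" by blast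
  from op_closureD[OF q d] obtain u' v' where
    2: "(u', v') \<in> op_restrict (L_max \<alpha>) test_fun" "L2_sq (\<lambda>x. f' x - u' x) < d" "L2_sq (\<lambda>x. g' x - v' x) < d" by blast
  have L': "u \<in> L2" "v \<in> L2" "u' \<in> L2" "v' \<in> L2" using 1 2 by (auto simp: op_restrict_def L_max_def)
  have b: "L2_sq (\<lambda>x. (f x + c * f' x) - (u x + c * u' x)) < e"
    if "f \<in> L2" "f' \<in> L2" "u \<in> L2" "u' \<in> L2" "L2_sq (\<lambda>x. f x - u x) < d" "L2_sq (\<lambda>x. f' x - u' x) < d" for f f' u u'
  proof -
    have "(\<lambda>x. (f x + c * f' x) - (u x + c * u' x)) = (\<lambda>x. (f x - u x) + c * (f' x - u' x))"
      by (simp add: algebra_simps)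
    then have "L2_sq (\<lambda>x. (f x + c * f' x) - (u x + c * u' x)) \<le> 2 * L2_sq (\<lambda>x. f x - u x) + 2 * ((cmod c)\<^sup>2 * L2_sq (\<lambda>x. f' x - u' x))"
      using L2_sq_add_le[OF L2_diff[OF that(1,3)] L2_cmult[OF L2_diff[OF that(2,4)], of c]] by (simp add: L2_sq_cmult)
    also have "\<dots> \<le> 2 * d + 2 * ((cmod c)\<^sup>2 * d)" using that by (intro add_mono mult_left_mono) auto
    also have "\<dots> < e" using de e by (simp add: distrib_left)
    finally show ?thesis .
  qed
  have "((\<lambda>x. u x + c * u' x), (\<lambda>x. v x + c * v' x)) \<in> op_restrict (L_max \<alpha>) test_fun"
    using 1(1) 2(1) by (auto simp: op_restrict_def intro: L_max_linear test_fun_add test_fun_cmult)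
  with b[OF L(1,3) L'(1,3) 1(2) 2(2)] b[OF L(2,4) L'(2,4) 1(3) 2(3)]
  show "\<exists>f'' g''. (f'', g'') \<in> op_restrict (L_max \<alpha>) test_fun \<and> L2_sq (\<lambda>x. f x + c * f' x - f'' x) < e \<and> L2_sq (\<lambda>x. g x + c * g' x - g'' x) < e"
    by blast
qed

text \<open>Test functions approximate \<open>f\<close>, f'' and f / x^2 simultaneously, hence also
  every combination of the last two; this is why \<alpha> is arbitrary.\<close>

lemma L_min_H20:
  assumes f: "f \<in> L2" "(\<lambda>x. f x / of_real (x\<^sup>2)) \<in> L2" and h: "h \<in> L2" and d: "dist_deriv2 f h"
  shows "(f, L_expr \<alpha> f h) \<in> L_min \<alpha>"
  unfolding L_min_def
proof (rule op_closureI[OF f(1) L_expr_L2[OF f(2) h]])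
  fix e :: real assume e: "0 < e"
  have ae: "AE x in lebP. f x = wint h x" by (rule H20I(2)[OF f(1) h d f(2)])
  have w: "wint h \<in> L2"
    by (rule L2_AE(1)[OF f(1) continuous_measurable_lebP[OF wint_continuous[OF h]]]) (use ae in eventually_elim, simp)
  \<comment> \<open>Chosen so that K \<delta> = e exceeds both \<delta> and the error 2 |\<alpha> -
    1/4|^2 \<delta> + 2 \<delta> of the image.\<close>
  define K where "K = 2 * (cmod (\<alpha> - 1/4))\<^sup>2 + 3"
  have K: "3 \<le> K" by (simp add: K_def)
  define \<delta> where "\<delta> = e / K"
  have dl: "0 < \<delta>" "K * \<delta> = e" using e K by (auto simp: \<delta>_def)
  obtain \<phi> where phi: "\<phi> \<in> test_fun" "L2_sq (\<lambda>x. h x - deriv2 \<phi> x) < \<delta>"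
    "L2_sq (\<lambda>x. wint h x - \<phi> x) < \<delta>" "L2_sq (\<lambda>x. (wint h x - \<phi> x) / of_real (x\<^sup>2)) < \<delta>"
    using wint_test_fun_dense[OF h w dl(1)] by blast
  have pL: "\<phi> \<in> L2" "(\<lambda>x. \<phi> x / of_real (x\<^sup>2)) \<in> L2" "deriv2 \<phi> \<in> L2"
    using test_fun_L2[OF phi(1)] test_fun_over_square[OF phi(1)] test_fun_L2 phi(1)
    by (auto elim: test_fun_derivatives)
  have 1: "L2_sq (\<lambda>x. f x - \<phi> x) < \<delta>"
  proof -
    have "L2_sq (\<lambda>x. f x - \<phi> x) = L2_sq (\<lambda>x. wint h x - \<phi> x)"
      by (rule L2_sq_cong_AE[OF L2_diff[OF f(1) pL(1)] L2_diff[OF w pL(1)]]) (use ae in eventually_elim, simp)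
    with phi show ?thesis by simp
  qed
  have q: "(\<lambda>x. (f x - \<phi> x) / of_real (x\<^sup>2)) \<in> L2" "(\<lambda>x. (wint h x - \<phi> x) / of_real (x\<^sup>2)) \<in> L2"
    using L2_diff[OF f(2) pL(2)] L2_diff[OF Hardy_inequality(3)[OF h] pL(2)] by (simp_all add: diff_divide_distrib)
  have 2: "L2_sq (\<lambda>x. (f x - \<phi> x) / of_real (x\<^sup>2)) < \<delta>"
  proof -
    have "L2_sq (\<lambda>x. (f x - \<phi> x) / of_real (x\<^sup>2)) = L2_sq (\<lambda>x. (wint h x - \<phi> x) / of_real (x\<^sup>2))"
      by (rule L2_sq_cong_AE[OF q]) (use ae in eventually_elim, simp)
    with phi show ?thesis by simp
  qed
  have "(\<lambda>x. L_expr \<alpha> f h x - L_expr \<alpha> \<phi> (deriv2 \<phi>) x) =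
      (\<lambda>x. (\<alpha> - 1/4) * ((f x - \<phi> x) / of_real (x\<^sup>2)) - (h x - deriv2 \<phi> x))"
    by (simp add: L_expr_def fun_eq_iff diff_divide_distrib right_diff_distrib)
  then have "L2_sq (\<lambda>x. L_expr \<alpha> f h x - L_expr \<alpha> \<phi> (deriv2 \<phi>) x) \<le>
      2 * ((cmod (\<alpha> - 1/4))\<^sup>2 * L2_sq (\<lambda>x. (f x - \<phi> x) / of_real (x\<^sup>2))) + 2 * L2_sq (\<lambda>x. h x - deriv2 \<phi> x)"
    using L2_sq_diff_le[OF L2_cmult[OF q(1), of "\<alpha> - 1/4"] L2_diff[OF h pL(3)]] by (simp only: L2_sq_cmult)
  also have "\<dots> \<le> 2 * ((cmod (\<alpha> - 1/4))\<^sup>2 * \<delta>) + 2 * \<delta>"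
    using phi(2) 2 by (intro add_mono mult_left_mono) auto
  also have "\<dots> < K * \<delta>" using dl(1) by (simp add: K_def algebra_simps)
  finally have 3: "L2_sq (\<lambda>x. L_expr \<alpha> f h x - L_expr \<alpha> \<phi> (deriv2 \<phi>) x) < e" using dl by simp
  have "1 * \<delta> \<le> K * \<delta>" using K dl(1) by (intro mult_right_mono) auto
  then have "\<delta> \<le> e" using dl by simp
  with 1 have 4: "L2_sq (\<lambda>x. f x - \<phi> x) < e" by simp
  have "(\<phi>, L_expr \<alpha> \<phi> (deriv2 \<phi>)) \<in> op_restrict (L_max \<alpha>) test_fun"
    using L_max_test_fun[OF phi(1)] phi(1) by (simp add: op_restrict_def)
  with 3 4 show "\<exists>f' g'. (f', g') \<in> op_restrict (L_max \<alpha>) test_fun \<and> L2_sq (\<lambda>x. f x - f' x) < e \<and> L2_sq (\<lambda>x. L_expr \<alpha> f h x - g' x) < e"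
    by blast
qed

section \<open>Powers of \<open>x\<close> in the minimal domain\<close>

text \<open>The critical weight: logw(x)/x has a divergent integral at 0, while logw(x)^2/x is
  integrable over the whole half-line.\<close>

definition logw :: "real \<Rightarrow> real" where
  "logw x = 1 / sqrt ((ln x)\<^sup>2 + 1)"

lemma logw_pos: "0 < logw x"
  by (simp add: logw_def add_nonneg_pos)

lemma logw_le_1: "logw x \<le> 1"
proof -
  have "1 \<le> sqrt ((ln x)\<^sup>2 + 1)" by simp
  then show ?thesis unfolding logw_def by (subst divide_le_eq_1) linarith
qed

lemma logw_sq: "(logw x)\<^sup>2 = 1 / ((ln x)\<^sup>2 + 1)"
  by (simp add: logw_def power_divide add_nonneg_pos)

text \<open>A primitive is arctan (ln x), which has finite limits at both ends.\<close>

lemma integrable_logw: "integrable lebP (\<lambda>x. (logw x)\<^sup>2 / x)"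
proof -
  have "set_integrable lborel (einterval (ereal 0) \<infinity>) (\<lambda>x. (logw x)\<^sup>2 / x)"
  proof (rule interval_integral_FTC_nonneg(1)[where F="\<lambda>x. arctan (ln x)" and A="- (pi/2)" and B="pi/2"])
    show "DERIV (\<lambda>x. arctan (ln x)) x :> (logw x)\<^sup>2 / x" if "ereal 0 < ereal x" for x
    proof -
      have x: "0 < x" using that by simp
      show ?thesis
        by (rule DERIV_cong[OF DERIV_chain2[OF DERIV_arctan DERIV_ln[OF x]]])
          (simp add: logw_sq divide_inverse add.commute)
    qed
    show "isCont (\<lambda>x. (logw x)\<^sup>2 / x) x" if "ereal 0 < ereal x" for x
      using that unfolding logw_sq by (intro continuous_intros) (auto simp: add_nonneg_eq_0_iff)
    show "AE x in lborel. ereal 0 < ereal x \<longrightarrow> ereal x < \<infinity> \<longrightarrow> 0 \<le> (logw x)\<^sup>2 / x"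
      by (intro AE_I2) auto
    show "(((\<lambda>x. arctan (ln x)) \<circ> real_of_ereal) \<longlongrightarrow> - (pi/2)) (at_right (ereal 0))"
      unfolding ereal_tendsto_simps by (rule filterlim_compose[OF tendsto_arctan_at_bot ln_at_0])
    show "(((\<lambda>x. arctan (ln x)) \<circ> real_of_ereal) \<longlongrightarrow> pi/2) (at_left \<infinity>)"
      unfolding ereal_tendsto_simps by (rule filterlim_compose[OF tendsto_arctan_at_top ln_at_top])
  qed auto
  then have "integrable lebP (\<lambda>x. indicator {0<..} x *\<^sub>R ((logw x)\<^sup>2 / x))"
    by (intro integrable_lebP_of_lborel) (simp add: set_integrable_def)
  then show ?thesis
    by (rule Bochner_Integration.integrable_cong[THEN iffD1, rotated -1]) auto
qed

lemma integrable_powr_Icc: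
  assumes "- 1 < p" "0 \<le> R" shows "integrable lebP (\<lambda>x. indicator {0..R} x * x powr p)"
proof (rule integrableI_nonneg)
  show "(\<lambda>x. indicator {0..R} x * x powr p) \<in> borel_measurable lebP"
    by (rule borel_measurable_lebP) measurable
  have "(\<integral>\<^sup>+x. ennreal (indicator {0..R} x * x powr p) \<partial>lebP) = (\<integral>\<^sup>+x. ennreal (x powr p) * indicator {0..R} x \<partial>lebP)"
    by (rule nn_integral_cong) (auto simp: indicator_def)
  also have "\<dots> = ennreal (R powr (p + 1) / (p + 1))"
    by (rule nn_integral_lebP_has_integral[OF _ _ _ _ has_integral_powr_from_0]) (use assms in auto)
  finally show "(\<integral>\<^sup>+x. ennreal (indicator {0..R} x * x powr p) \<partial>lebP) < \<infinity>" by simp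
qed (auto intro!: AE_I2)

section \<open>Complex powers of x times a slowly varying factor\<close>

lemma cmod_of_real_powr: "0 < x \<Longrightarrow> cmod (complex_of_real x powr s) = x powr Re s"
  by (simp add: norm_powr_real_powr)

lemma of_real_powr_has_vector_derivative:
  assumes "0 < x"
  shows "((\<lambda>x. complex_of_real x powr s) has_vector_derivative s * of_real x powr (s - 1)) (at x)"
  by (rule has_vector_derivative_real_field, rule has_field_derivative_powr) (use assms in \<open>simp add: complex_nonpos_Reals_iff\<close>)

lemma of_real_powr_shift:
  assumes "0 < x"
  shows "complex_of_real x powr (s - 1) = of_real x powr (s - 2) * of_real x"
    and "complex_of_real x powr s = of_real x powr (s - 2) * of_real (x\<^sup>2)"
proof -
  have "complex_of_real x powr (s - 2 + 1) = of_real x powr (s - 2) * of_real x powr 1"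
    "complex_of_real x powr (s - 2 + of_nat 2) = of_real x powr (s - 2) * of_real x powr of_nat 2"
    by (rule powr_add)+
  moreover have "complex_of_real x powr 1 = of_real x" "complex_of_real x powr of_nat 2 = of_real (x\<^sup>2)"
    using assms by (simp_all only: powr_complexpow of_real_eq_0_iff) simp_all
  moreover have "s - 2 + 1 = s - 1" "s - 2 + of_nat 2 = s" by simp_all
  ultimately show "complex_of_real x powr (s - 1) = of_real x powr (s - 2) * of_real x"
    "complex_of_real x powr s = of_real x powr (s - 2) * of_real (x\<^sup>2)" by metis+
qed

text \<open>The second derivative is arranged with x^(s-2) in front, leaving in the bracket only
  \<open>g\<close> and the scale-invariant quantities x g' and x^2 g'', which are bounded in the
  applications.\<close>

lemma powr_times_derivatives:
  assumes g: "\<And>x. 0 < x \<Longrightarrow> (g has_vector_derivative g' x) (at x)" "\<And>x. 0 < x \<Longrightarrow> (g' has_vector_derivative g'' x) (at x)"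
    and x: "0 < x"
  shows "((\<lambda>x. complex_of_real x powr s * g x) has_vector_derivative
      of_real x powr s * g' x + s * of_real x powr (s - 1) * g x) (at x)" (is ?A)
    and "((\<lambda>x. of_real x powr s * g' x + s * of_real x powr (s - 1) * g x) has_vector_derivative
      of_real x powr (s - 2) * (s * (s - 1) * g x + 2 * s * (of_real x * g' x) + of_real (x\<^sup>2) * g'' x)) (at x)" (is ?B)
proof -
  note P = of_real_powr_has_vector_derivative[OF x]
  show ?A by (intro has_vector_derivative_mult P g x)
  have "((\<lambda>x. of_real x powr s * g' x + (s * of_real x powr (s - 1)) * g x) has_vector_derivative
      (of_real x powr s * g'' x + s * of_real x powr (s - 1) * g' x) +
      ((s * of_real x powr (s - 1)) * g' x + (s * ((s - 1) * of_real x powr (s - 1 - 1))) * g x)) (at x)"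
    by (intro has_vector_derivative_add has_vector_derivative_mult has_vector_derivative_mult_right P g x)
  moreover have "(of_real x powr s * g'' x + s * of_real x powr (s - 1) * g' x) +
      ((s * of_real x powr (s - 1)) * g' x + (s * ((s - 1) * of_real x powr (s - 1 - 1))) * g x) =
      of_real x powr (s - 2) * (s * (s - 1) * g x + 2 * s * (of_real x * g' x) + of_real (x\<^sup>2) * g'' x)"
    unfolding of_real_powr_shift[OF x, of s] by (simp add: algebra_simps)
  ultimately show ?B by simp
qed

lemma of_real_powr_measurable: "(\<lambda>x. complex_of_real x powr s) \<in> borel_measurable lebP"
proof (rule continuous_measurable_lebP, rule continuous_on_vector_derivative)
  show "((\<lambda>x. complex_of_real x powr s) has_vector_derivative s * of_real x powr (s - 1)) (at x within {0<..})"
    if "x \<in> {0<..}" for x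
    using that by (auto intro: has_vector_derivative_at_within of_real_powr_has_vector_derivative)
qed

lemma powr_times_bounded_L2:
  assumes [measurable]: "B \<in> borel_measurable lebP" and p: "- 1/2 < Re t" and R: "0 \<le> R"
    and b: "\<And>x. 0 < x \<Longrightarrow> cmod (B x) \<le> C" and z: "\<And>x. R < x \<Longrightarrow> B x = 0"
  shows "(\<lambda>x. of_real x powr t * B x) \<in> L2"
proof (rule L2_bound(1))
  show "(\<lambda>x. complex_of_real x powr t * B x) \<in> borel_measurable lebP"
    using of_real_powr_measurable[of t] by measurable
  show "integrable lebP (\<lambda>x. C\<^sup>2 * (indicator {0..R} x * x powr (2 * Re t)))"
    by (intro integrable_mult_right integrable_powr_Icc) (use p R in auto)
  fix x :: real assume x: "0 < x"
  show "(cmod (of_real x powr t * B x))\<^sup>2 \<le> C\<^sup>2 * (indicator {0..R} x * x powr (2 * Re t))"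
  proof (cases "x \<le> R")
    case True
    have "(x powr Re t)\<^sup>2 = x powr (2 * Re t)" by (simp add: power2_eq_square flip: powr_add)
    moreover have "(cmod (B x))\<^sup>2 \<le> C\<^sup>2" using b[OF x] by (intro power_mono) auto
    ultimately have "(x powr Re t)\<^sup>2 * (cmod (B x))\<^sup>2 \<le> x powr (2 * Re t) * C\<^sup>2"
      by (intro mult_mono) auto
    moreover have "indicator {0..R} x = (1::real)" using True x by simp
    ultimately show ?thesis
      by (simp add: norm_mult cmod_of_real_powr[OF x] power_mult_distrib mult.commute)
  next
    case False
    then show ?thesis using z[of x] by simp
  qed
qed

text \<open>For x <= 1 put u = e |ln x|: then e (1 + |ln x|) <= 1 + u <= exp u = x^(-e), and 1 + |ln
  x| is at least the inverse of \<open>logw x\<close>. For 1 <= x <= R crude bounds in R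
  suffice.\<close>

lemma powr_eps_le_logw:
  assumes x: "0 < x" "x \<le> R" and R: "1 \<le> R" and e: "0 < e" "e \<le> 1"
  shows "e * x powr e \<le> 2 * R\<^sup>2 * logw x" "x powr e \<le> R"
proof -
  define T where "T = sqrt ((ln x)\<^sup>2 + 1)"
  have T: "0 < T" by (simp add: T_def add_nonneg_pos)
  have "(ln x)\<^sup>2 + 1 \<le> (1 + \<bar>ln x\<bar>)\<^sup>2" by (simp add: power2_sum)
  then have T1: "T \<le> 1 + \<bar>ln x\<bar>" unfolding T_def by (intro real_le_lsqrt) auto
  have R2: "1 \<le> R\<^sup>2" using R by simp
  have main: "e * x powr e * T \<le> 2 * R\<^sup>2 \<and> x powr e \<le> R"
  proof (cases "x \<le> 1")
    case True
    define u where "u = e * \<bar>ln x\<bar>"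
    have "x powr e = exp (- u)" using True x by (simp add: powr_def u_def)
    then have xe: "x powr e = 1 / exp u" by (simp add: exp_minus divide_inverse)
    have u: "0 \<le> u" using e by (simp add: u_def)
    have "e * T \<le> e * (1 + \<bar>ln x\<bar>)" using T1 e by (intro mult_left_mono) auto
    also have "\<dots> \<le> 1 + u" using e by (simp add: u_def distrib_left)
    also have "\<dots> \<le> exp u" by simp
    finally have "e * T * (1 / exp u) \<le> exp u * (1 / exp u)" by (intro mult_right_mono) auto
    then have "e * x powr e * T \<le> 1" by (simp add: xe mult_ac)
    moreover have "x powr e \<le> 1" using u by (simp add: xe)
    ultimately show ?thesis using R R2 by linarith
  next
    case False
    have "x powr e \<le> x powr 1" using False e by (intro powr_mono) auto
    then have xe: "x powr e \<le> R" using x by simp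
    have "T \<le> R" using T1 False x ln_le_minus_one[of x] by simp
    then have "e * x powr e * T \<le> (1 * R) * R"
      using xe e T R x by (intro mult_mono) auto
    then show ?thesis using xe R2 by (simp add: power2_eq_square)
  qed
  then show "x powr e \<le> R" by simp
  have "e * x powr e = e * x powr e * T * logw x" using T by (simp add: logw_def T_def)
  also have "\<dots> \<le> 2 * R\<^sup>2 * logw x" using main logw_pos[of x] by (intro mult_right_mono) auto
  finally show "e * x powr e \<le> 2 * R\<^sup>2 * logw x" .
qed

text \<open>Here \<open>L\<^sub>\<alpha>\<close> with \<open>\<alpha> = m\<^sup>2\<close> annihilates the power of \<open>x\<close>, so that only derivatives of \<open>g\<close> remain.  The
  approximants \<open>of_real x powr (1/2 + m + \<epsilon>) * g x\<close> lie in \<open>H20\<close>; the error \<open>\<epsilon> x powr \<epsilon>\<close> which they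
  create is dominated by \<open>logw x\<close>, uniformly in \<open>\<epsilon>\<close>.\<close>

lemma powr_times_in_L_min:
  fixes g :: "real \<Rightarrow> complex"
  assumes m: "Re m = 1" and R: "1 \<le> R"
    and g: "\<And>x. 0 < x \<Longrightarrow> (g has_vector_derivative g' x) (at x)" "\<And>x. 0 < x \<Longrightarrow> (g' has_vector_derivative g'' x) (at x)"
    and c: "continuous_on {0<..} g''"
    and z: "\<And>x. R < x \<Longrightarrow> g x = 0 \<and> g' x = 0 \<and> g'' x = 0"
    and b: "\<And>x. 0 < x \<Longrightarrow> cmod (g x) \<le> C" "\<And>x. 0 < x \<Longrightarrow> cmod (of_real x * g' x) \<le> C * logw x"
      "\<And>x. 0 < x \<Longrightarrow> cmod (of_real (x\<^sup>2) * g'' x) \<le> C * logw x"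
  shows "(\<lambda>x. of_real x powr (1/2 + m) * g x) \<in> Domain (L_min (m\<^sup>2))"
proof -
  define a where "a = 1/2 + m"
  have a: "Re a = 3/2" using m by (simp add: a_def)
  \<comment> \<open>The exponent a solves the indicial equation, so that x^a is annihilated by the
    expression with \<alpha> = m^2.\<close>
  have ma: "m\<^sup>2 - 1/4 = a * (a - 1)" by (simp add: a_def power2_eq_square algebra_simps)
  have C: "0 \<le> C" using order_trans[OF norm_ge_zero b(1)[of 1]] by simp
  have bC: "cmod (of_real x * g' x) \<le> C" "cmod (of_real (x\<^sup>2) * g'' x) \<le> C" if "0 < x" for x
    using b(2,3)[OF that] mult_left_mono[OF logw_le_1[of x] C] by auto
  have cg: "continuous_on {0<..} g" "continuous_on {0<..} g'"
    using g by (auto intro!: continuous_on_vector_derivative intro: has_vector_derivative_at_within)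
  have [measurable]: "g \<in> borel_measurable lebP" "g' \<in> borel_measurable lebP" "g'' \<in> borel_measurable lebP"
    using cg c by (auto intro: continuous_measurable_lebP)
  have x2m [measurable]: "(\<lambda>x. complex_of_real (x\<^sup>2)) \<in> borel_measurable lebP"
    by (rule borel_measurable_lebP) measurable
  note Pm [measurable] = of_real_powr_measurable
  define f where "f s x = of_real x powr s * g x" for s x
  define f2 where "f2 s x = of_real x powr (s - 2) * (s * (s - 1) * g x + 2 * s * (of_real x * g' x) + of_real (x\<^sup>2) * g'' x)" for s x
  have R0: "0 \<le> R" using R by simp
  have fL: "f s \<in> L2" if "- 1/2 < Re s" for s
    unfolding f_def by (rule powr_times_bounded_L2[OF _ that R0 b(1)]) (use z in auto)
  \<comment> \<open>The strict inequality is essential: for Re s = 3/2 the exponent s - 2 is exactly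
    on the border of square integrability at 0. This is why the exponent a has to be raised.\<close>
  have fq: "(\<lambda>x. f s x / of_real (x\<^sup>2)) \<in> L2" if "3/2 < Re s" for s
  proof -
    have L: "(\<lambda>x. of_real x powr (s - 2) * g x) \<in> L2"
      by (rule powr_times_bounded_L2[OF _ _ R0 b(1)]) (use z that in auto)
    show ?thesis
    proof (rule L2_AE(1)[OF L])
      show "(\<lambda>x. f s x / of_real (x\<^sup>2)) \<in> borel_measurable lebP" unfolding f_def by measurable
      show "AE x in lebP. f s x / of_real (x\<^sup>2) = of_real x powr (s - 2) * g x"
        by (rule AE_I2) (simp add: f_def of_real_powr_shift(2)[of _ s])
    qed
  qed
  have f2L: "f2 s \<in> L2" if "3/2 < Re s" for s
    unfolding f2_def
  proof (rule powr_times_bounded_L2[OF _ _ R0])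
    show "cmod (s * (s - 1) * g x + 2 * s * (of_real x * g' x) + of_real (x\<^sup>2) * g'' x)
        \<le> cmod (s * (s - 1)) * C + cmod (2 * s) * C + C" if "0 < x" for x
      using b(1)[OF that] bC[OF that]
      by (intro order_trans[OF norm_triangle_ineq] add_mono)
        (simp_all only: norm_mult[of "s * (s - 1)"] norm_mult[of "2 * s"], auto intro: mult_left_mono)
  qed (measurable, use z that in auto)
  have fd: "dist_deriv2 (f s) (f2 s)" for s
    unfolding dist_deriv2_def
  proof (intro ballI classical_weak_deriv2)
    show "0 < x \<Longrightarrow> (f s has_vector_derivative of_real x powr s * g' x + s * of_real x powr (s - 1) * g x) (at x)" for x
      unfolding f_def by (rule powr_times_derivatives(1)[OF g])
    show "0 < x \<Longrightarrow> ((\<lambda>x. of_real x powr s * g' x + s * of_real x powr (s - 1) * g x) has_vector_derivative f2 s x) (at x)" for x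
      unfolding f2_def by (rule powr_times_derivatives(2)[OF g])
    show "continuous_on {0<..} (f2 s)"
    proof -
      have cP: "continuous_on {0<..} (\<lambda>x. complex_of_real x powr (s - 2))"
        by (rule continuous_on_vector_derivative)
          (auto intro: has_vector_derivative_at_within of_real_powr_has_vector_derivative)
      show ?thesis unfolding f2_def by (rule continuous_on_mult[OF cP]) (intro continuous_intros cg c)
    qed
  qed
  \<comment> \<open>The image of x^a g: the terms without a derivative of \<open>g\<close> have
    cancelled.\<close>
  define G where "G x = - (of_real x powr (a - 2)) * (2 * a * (of_real x * g' x) + of_real (x\<^sup>2) * g'' x)" for x
  define \<epsilon> where "\<epsilon> n = 1 / (real n + 1)" for n :: nat
  have eps: "0 < \<epsilon> n" "\<epsilon> n \<le> 1" for n by (auto simp: \<epsilon>_def)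
  have eps0: "\<epsilon> \<longlonglongrightarrow> 0" unfolding \<epsilon>_def using LIMSEQ_inverse_real_of_nat by (simp add: inverse_eq_divide add.commute)
  define s where "s n = a + of_real (\<epsilon> n)" for n
  have s: "3/2 < Re (s n)" for n using a eps by (simp add: s_def)
  define k where "k n = L_expr (m\<^sup>2) (f (s n)) (f2 (s n))" for n
  have fk: "(f (s n), k n) \<in> L_min (m\<^sup>2)" for n
    unfolding k_def by (rule L_min_H20[OF fL fq f2L fd]) (use s[of n] in auto)
  then have kL: "k n \<in> L2" for n by (auto simp: L_min_def dest: op_closure_L2)
  have Ps: "of_real x powr (s n + t) = of_real x powr (a + t) * complex_of_real (x powr \<epsilon> n)" if "0 < x" for x n t
  proof -
    have "of_real x powr (s n + t) = complex_of_real x powr ((a + t) + of_real (\<epsilon> n))" by (simp add: s_def add_ac)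
    also have "\<dots> = of_real x powr (a + t) * of_real x powr of_real (\<epsilon> n)" by (rule powr_add)
    also have "complex_of_real x powr of_real (\<epsilon> n) = of_real (x powr \<epsilon> n)" using that by (simp add: powr_of_real)
    finally show ?thesis .
  qed
  have xe_lim: "(\<lambda>n. x powr \<epsilon> n) \<longlonglongrightarrow> 1" if "0 < x" for x
  proof -
    have "(\<lambda>n. x powr \<epsilon> n) \<longlonglongrightarrow> x powr 0" by (intro tendsto_intros eps0) (use that in auto)
    then show ?thesis using that by simp
  qed
  have f0: "f a \<in> L2" by (rule fL) (simp add: a)
  have lim1: "(\<lambda>n. L2_sq (\<lambda>x. f a x - f (s n) x)) \<longlonglongrightarrow> 0"
  proof (rule L2_sq_tendsto_0I)
    show "(\<lambda>x. f a x - f (s n) x) \<in> borel_measurable lebP" for n unfolding f_def by measurable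
    show "integrable lebP (\<lambda>x. (1 + R)\<^sup>2 * (cmod (f a x))\<^sup>2)" using L2_integrable[OF f0] by simp
    have eq: "f a x - f (s n) x = (1 - of_real (x powr \<epsilon> n)) * f a x" if "0 < x" for x n
      using Ps[OF that, of n 0] by (simp add: f_def algebra_simps)
    show "(cmod (f a x - f (s n) x))\<^sup>2 \<le> (1 + R)\<^sup>2 * (cmod (f a x))\<^sup>2" if x: "0 < x" for n x
    proof (cases "x \<le> R")
      case True
      have "cmod (1 - of_real (x powr \<epsilon> n)) \<le> 1 + x powr \<epsilon> n"
        using norm_triangle_ineq4[of 1 "complex_of_real (x powr \<epsilon> n)"] by simp
      also have "\<dots> \<le> 1 + R" using powr_eps_le_logw(2)[OF x True R eps] by simp
      finally show ?thesis unfolding eq[OF x] by (rule cmod_mult_sq_le)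
    next
      case False
      then show ?thesis using z[of x] by (simp add: f_def)
    qed
    show "AE x in lebP. (\<lambda>n. f a x - f (s n) x) \<longlonglongrightarrow> 0"
    proof (rule AE_I2)
      fix x assume "x \<in> space lebP"
      then have x: "0 < x" by simp
      have "(\<lambda>n. (1 - of_real (x powr \<epsilon> n)) * f a x) \<longlonglongrightarrow> (1 - of_real 1) * f a x"
        by (intro tendsto_intros xe_lim x)
      then show "(\<lambda>n. f a x - f (s n) x) \<longlonglongrightarrow> 0" by (simp add: eq[OF x])
    qed
  qed
  define K where "K = (1 + R) * ((cmod (2 * a) + 1) * C) + 2 * R\<^sup>2 * ((cmod (2 * m) + 1) * C + 2 * C)"
  \<comment> \<open>Two sources of error, both of size \<open>logw x\<close> in the bracket:
    replacing 1 by x^\<epsilon> in front of the derivatives of \<open>g\<close>, which are that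
    small by assumption, and the terms with a factor \<epsilon> x^\<epsilon>, for which
    \<open>powr_eps_le_logw\<close> is made. The coefficient 2 m + \<epsilon> comes from s (s - 1) -
    a (a - 1) = \<epsilon> (2 m + \<epsilon>).\<close>
  have Gk: "G x - k n x = of_real x powr (a - 2) * ((of_real (x powr \<epsilon> n) - 1) * (2 * a * (of_real x * g' x) + of_real (x\<^sup>2) * g'' x)
      + of_real (\<epsilon> n * x powr \<epsilon> n) * ((2 * m + of_real (\<epsilon> n)) * g x + 2 * (of_real x * g' x)))" if x: "0 < x" for x n
  proof -
    have fs: "f (s n) x / of_real (x\<^sup>2) = of_real x powr (s n - 2) * g x"
      using x by (simp add: f_def of_real_powr_shift(2)[of _ "s n"])
    have P2: "of_real x powr (s n - 2) = of_real x powr (a - 2) * complex_of_real (x powr \<epsilon> n)"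
      using Ps[OF x, of n "-2"] by simp
    have e1: "a * (a - 1) - s n * (s n - 1) = - of_real (\<epsilon> n) * (2 * m + of_real (\<epsilon> n))"
      by (simp add: s_def a_def algebra_simps)
    have "k n x = of_real x powr (s n - 2) * ((a * (a - 1) - s n * (s n - 1)) * g x - 2 * s n * (of_real x * g' x) - of_real (x\<^sup>2) * g'' x)"
      unfolding k_def L_expr_def fs f2_def ma by (simp add: algebra_simps)
    then have "k n x = of_real x powr (a - 2) * complex_of_real (x powr \<epsilon> n) * (- of_real (\<epsilon> n) * (2 * m + of_real (\<epsilon> n)) * g x
        - 2 * (a + of_real (\<epsilon> n)) * (of_real x * g' x) - of_real (x\<^sup>2) * g'' x)"
      unfolding e1 P2 unfolding s_def .
    moreover have "- p * (2 * a * u + v) - p * q * (- \<theta> * (2 * m + \<theta>) * w - 2 * (a + \<theta>) * u - v) =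
        p * ((q - 1) * (2 * a * u + v) + \<theta> * q * ((2 * m + \<theta>) * w + 2 * u))" for p q u v w \<theta> :: complex
      by (simp add: algebra_simps)
    ultimately show ?thesis unfolding G_def of_real_mult by simp
  qed
  have Kb: "(cmod (G x - k n x))\<^sup>2 \<le> K\<^sup>2 * ((logw x)\<^sup>2 / x)" if x: "0 < x" for x n
  proof (cases "x \<le> R")
    case False
    then show ?thesis using z[of x] x unfolding Gk[OF x] by simp
  next
    case True
    note pe = powr_eps_le_logw[OF x True R eps, of n]
    have 1: "cmod (of_real (x powr \<epsilon> n) - 1) \<le> 1 + R"
      using norm_triangle_ineq4[of "complex_of_real (x powr \<epsilon> n)" 1] pe(2) by simp
    have 2: "cmod (2 * a * (of_real x * g' x) + of_real (x\<^sup>2) * g'' x) \<le> cmod (2 * a) * (C * logw x) + C * logw x"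
      by (intro order_trans[OF norm_triangle_ineq] add_mono cmod_mult_mono b(2,3)[OF x] order_refl)
    have 3: "cmod (of_real (\<epsilon> n * x powr \<epsilon> n)) \<le> 2 * R\<^sup>2 * logw x"
      unfolding norm_of_real using pe(1) eps(1)[of n] by simp
    have 4: "cmod ((2 * m + of_real (\<epsilon> n)) * g x + 2 * (of_real x * g' x)) \<le> (cmod (2 * m) + 1) * C + 2 * C"
    proof (rule order_trans[OF norm_triangle_ineq], intro add_mono cmod_mult_mono b(1)[OF x] bC(1)[OF x])
      show "cmod (2 * m + of_real (\<epsilon> n)) \<le> cmod (2 * m) + 1"
        using norm_triangle_ineq[of "2 * m" "of_real (\<epsilon> n)"] eps[of n] by simp
    qed simp
    have "cmod ((of_real (x powr \<epsilon> n) - 1) * (2 * a * (of_real x * g' x) + of_real (x\<^sup>2) * g'' x)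
      + of_real (\<epsilon> n * x powr \<epsilon> n) * ((2 * m + of_real (\<epsilon> n)) * g x + 2 * (of_real x * g' x)))
      \<le> (1 + R) * (cmod (2 * a) * (C * logw x) + C * logw x) + (2 * R\<^sup>2 * logw x) * ((cmod (2 * m) + 1) * C + 2 * C)"
      by (intro order_trans[OF norm_triangle_ineq] add_mono cmod_mult_mono 1 2 3 4)
    also have "\<dots> = K * logw x" by (simp add: K_def algebra_simps)
    finally have 5: "cmod ((of_real (x powr \<epsilon> n) - 1) * (2 * a * (of_real x * g' x) + of_real (x\<^sup>2) * g'' x)
      + of_real (\<epsilon> n * x powr \<epsilon> n) * ((2 * m + of_real (\<epsilon> n)) * g x + 2 * (of_real x * g' x))) \<le> K * logw x" .
    have "Re (a - 2) = - 1/2" using a by simp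
    then have "cmod (of_real x powr (a - 2)) \<le> x powr (- 1/2)"
      unfolding cmod_of_real_powr[OF x] by simp
    then have "cmod (G x - k n x) \<le> x powr (- 1/2) * (K * logw x)"
      unfolding Gk[OF x] by (rule cmod_mult_mono[OF _ 5])
    then have "(cmod (G x - k n x))\<^sup>2 \<le> (x powr (- 1/2) * (K * logw x))\<^sup>2" by (intro power_mono) auto
    also have "\<dots> = K\<^sup>2 * ((logw x)\<^sup>2 / x)"
    proof -
      have "(x powr (- 1/2))\<^sup>2 = x powr (- 1)" by (simp add: power2_eq_square flip: powr_add)
      also have "\<dots> = 1 / x" using x by (simp add: powr_minus divide_inverse)
      finally show ?thesis by (simp add: power_mult_distrib)
    qed
    finally show ?thesis .
  qed
  have Gm: "G \<in> borel_measurable lebP" unfolding G_def by measurable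
  have km [measurable]: "k n \<in> borel_measurable lebP" for n using kL by (rule L2_measurable)
  have ik: "integrable lebP (\<lambda>x. K\<^sup>2 * ((logw x)\<^sup>2 / x))" by (intro integrable_mult_right integrable_logw)
  have GkL: "(\<lambda>x. G x - k n x) \<in> L2" for n
    by (rule L2_bound(1)[OF _ ik Kb]) (use Gm in measurable)
  \<comment> \<open>The convergence estimate itself yields this: the difference from
    \<open>k 0\<close> is dominated, and \<open>k 0\<close> is in L2.\<close>
  have GL: "G \<in> L2" using L2_add[OF GkL[of 0] kL[of 0]] by simp
  have lim2: "(\<lambda>n. L2_sq (\<lambda>x. G x - k n x)) \<longlonglongrightarrow> 0"
  proof (rule L2_sq_tendsto_0I[OF _ ik Kb])
    show "(\<lambda>x. G x - k n x) \<in> borel_measurable lebP" for n using Gm by measurable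
    show "AE x in lebP. (\<lambda>n. G x - k n x) \<longlonglongrightarrow> 0"
    proof (rule AE_I2)
      fix x assume "x \<in> space lebP"
      then have x: "0 < x" by simp
      have "(\<lambda>n. of_real x powr (a - 2) * ((of_real (x powr \<epsilon> n) - 1) * (2 * a * (of_real x * g' x) + of_real (x\<^sup>2) * g'' x)
        + of_real (\<epsilon> n * x powr \<epsilon> n) * ((2 * m + of_real (\<epsilon> n)) * g x + 2 * (of_real x * g' x)))) \<longlonglongrightarrow>
        of_real x powr (a - 2) * ((of_real 1 - 1) * (2 * a * (of_real x * g' x) + of_real (x\<^sup>2) * g'' x)
        + of_real (0 * 1) * ((2 * m + of_real 0) * g x + 2 * (of_real x * g' x)))"
        by (intro tendsto_intros xe_lim x eps0)
      then show "(\<lambda>n. G x - k n x) \<longlonglongrightarrow> 0" by (simp add: Gk[OF x])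
    qed
  qed auto
  have "(f a, G) \<in> L_min (m\<^sup>2)"
  proof (rule L_min_closed[OF f0 GL])
    fix e :: real assume "0 < e"
    then have "eventually (\<lambda>n. L2_sq (\<lambda>x. f a x - f (s n) x) < e \<and> L2_sq (\<lambda>x. G x - k n x) < e) sequentially"
      by (intro eventually_conj eventually_L2_sq_less lim1 lim2)
    then obtain n where "L2_sq (\<lambda>x. f a x - f (s n) x) < e" "L2_sq (\<lambda>x. G x - k n x) < e"
      by (auto dest: eventually_happens)
    then show "\<exists>f' g'. (f', g') \<in> L_min (m\<^sup>2) \<and> L2_sq (\<lambda>x. f a x - f' x) < e \<and> L2_sq (\<lambda>x. G x - g' x) < e"
      using fk by blast
  qed
  then show ?thesis unfolding f_def a_def by (rule DomainI)
qed

text \<open>\<open>logw\<close> is bounded below by a positive constant on compact subsets of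
  ]0,\<infinity>[, so logarithmic bounds hold for every continuous function that vanishes near 0 and
  near infinity.\<close>

lemma compact_support_le_logw:
  fixes f :: "real \<Rightarrow> complex"
  assumes c: "continuous_on {0<..} f" and d: "0 < d" and z: "\<And>x. 0 < x \<Longrightarrow> x < d \<or> R < x \<Longrightarrow> f x = 0"
  obtains C where "0 \<le> C" "\<And>x. 0 < x \<Longrightarrow> cmod (f x) \<le> C * logw x"
proof -
  define h where "h x = f x * of_real (sqrt ((ln x)\<^sup>2 + 1))" for x
  have "continuous_on {d..R} h"
    unfolding h_def using d by (intro continuous_intros continuous_on_subset[OF c]) auto
  then obtain B where B0: "0 \<le> B" and B: "\<And>x. x \<in> {d..R} \<Longrightarrow> cmod (h x) \<le> B"
    by (rule continuous_on_Icc_bounded) blast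
  have s: "0 < sqrt ((ln x)\<^sup>2 + 1)" for x :: real by (simp add: add_nonneg_pos)
  have "cmod (f x) \<le> B * logw x" if x: "0 < x" for x
  proof (cases "x \<in> {d..R}")
    case True
    have "cmod (f x) = cmod (h x) * logw x"
      using s[of x] by (simp add: h_def norm_mult logw_def)
    also have "\<dots> \<le> B * logw x" using B[OF True] logw_pos[of x] by (intro mult_right_mono) auto
    finally show ?thesis .
  next
    case False
    then show ?thesis using z[OF x] logw_pos[of x] B0 by auto
  qed
  with B0 show ?thesis by (rule that)
qed

text \<open>The cutoff is constant near 0, so its derivatives satisfy the logarithmic bounds
  trivially. Only two derivatives enter, and the lemma serves both the cutoff that defines
  \<open>H_op\<close> and the C^2 cutoffs of (2).\<close>

lemma cutoff_power_in_L_min: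
  assumes m: "Re m = 1" and xi: "\<xi> \<in> Ck_c_half 2" "one_near_0 \<xi>"
  shows "cutoff_power m \<xi> \<in> Domain (L_min (m\<^sup>2))"
proof -
  obtain R0 where R0: "\<And>x. R0 < x \<Longrightarrow> \<xi> x = 0" and "Ck_on (Suc (Suc 0)) {0..} \<xi>"
    using xi(1) unfolding Ck_c_half_def numeral_2_eq_2 by blast
  then obtain g' g'' where g: "\<And>x. 0 \<le> x \<Longrightarrow> (\<xi> has_vector_derivative g' x) (at x within {0..})"
    "\<And>x. 0 \<le> x \<Longrightarrow> (g' has_vector_derivative g'' x) (at x within {0..})" "continuous_on {0..} g''"
    unfolding Ck_on.simps atLeast_iff[symmetric] by blast
  obtain d where d: "0 < d" "\<And>x. 0 \<le> x \<Longrightarrow> x < d \<Longrightarrow> \<xi> x = 1" using xi(2) by (auto simp: one_near_0_def)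
  define R where "R = max 1 R0"
  have at: "at x within {0..} = at x" if "0 < x" for x :: real
    using that by (intro at_within_interior) (simp add: interior_real_atLeast)
  have d1: "(\<xi> has_vector_derivative g' x) (at x)" and d2: "(g' has_vector_derivative g'' x) (at x)" if "0 < x" for x
    using g(1,2)[of x] that at[OF that] by auto
  have z0: "\<xi> x = 0" if "R < x" for x using that R0 by (simp add: R_def)
  have z1: "g' x = 0" if "0 < x" "x < d \<or> R < x" for x
  proof (cases "x < d")
    case True
    then show ?thesis using d that
      by (intro locally_constant_derivative_zero[OF d1[OF that(1)], of "{0<..<d}" 1]) auto
  next
    case False
    then show ?thesis using z0 that
      by (intro locally_constant_derivative_zero[OF d1[OF that(1)], of "{R<..}" 0]) auto
  qed
  have z2: "g'' x = 0" if "0 < x" "x < d \<or> R < x" for x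
  proof (cases "x < d")
    case True
    then show ?thesis using z1 that
      by (intro locally_constant_derivative_zero[OF d2[OF that(1)], of "{0<..<d}" 0]) auto
  next
    case False
    then show ?thesis using z1 that
      by (intro locally_constant_derivative_zero[OF d2[OF that(1)], of "{max 0 R<..}" 0]) auto
  qed
  have c: "continuous_on {0..} \<xi>"
    by (rule continuous_on_vector_derivative) (use g(1) in auto)
  have c1: "continuous_on {0<..} g'"
    by (rule continuous_on_vector_derivative) (use d2 in \<open>auto intro: has_vector_derivative_at_within\<close>)
  have c2: "continuous_on {0<..} g''" by (rule continuous_on_subset[OF g(3)]) auto
  have "continuous_on {0..R} \<xi>" by (rule continuous_on_subset[OF c]) auto
  then obtain B where B0: "0 \<le> B" and B: "\<And>x. x \<in> {0..R} \<Longrightarrow> cmod (\<xi> x) \<le> B"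
    by (rule continuous_on_Icc_bounded) blast
  have C0: "cmod (\<xi> x) \<le> B" if "0 < x" for x
    using B[of x] z0[of x] B0 that by (cases "x \<le> R") auto
  obtain C1 where C1: "\<And>x. 0 < x \<Longrightarrow> cmod (of_real x * g' x) \<le> C1 * logw x"
    by (rule compact_support_le_logw[of "\<lambda>x. of_real x * g' x" d R]) (use d z1 in \<open>auto intro!: continuous_intros c1\<close>)
  obtain C2 where C2: "\<And>x. 0 < x \<Longrightarrow> cmod (of_real (x\<^sup>2) * g'' x) \<le> C2 * logw x"
    by (rule compact_support_le_logw[of "\<lambda>x. of_real (x\<^sup>2) * g'' x" d R]) (use d z2 in \<open>auto intro!: continuous_intros c2\<close>)
  define C where "C = max B (max C1 C2)"
  have CC: "C1 * logw x \<le> C * logw x" "C2 * logw x \<le> C * logw x" for x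
    using logw_pos[of x] by (auto simp: C_def intro: mult_right_mono)
  have "(\<lambda>x. of_real x powr (1/2 + m) * \<xi> x) \<in> Domain (L_min (m\<^sup>2))"
  proof (rule powr_times_in_L_min[OF m _ d1 d2 c2])
    show "1 \<le> R" by (simp add: R_def)
    show "\<xi> x = 0 \<and> g' x = 0 \<and> g'' x = 0" if "R < x" for x
      using that z0 z1[of x] z2[of x] by (auto simp: R_def)
    show "cmod (\<xi> x) \<le> C" if "0 < x" for x
      using C0[OF that] by (simp add: C_def)
    show "cmod (of_real x * g' x) \<le> C * logw x" "cmod (of_real (x\<^sup>2) * g'' x) \<le> C * logw x" if "0 < x" for x
      using C1[OF that] C2[OF that] CC[of x] by linarith+
  qed
  then show ?thesis by (simp add: cutoff_power_def[abs_def])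
qed

text \<open>The generator of H_m damped at 0 by a power of 1 + ln^2 x, with r = 0 for the generator
  itself. Different r give different orders of magnitude at 0, which keeps these functions
  independent.\<close>

definition log_power :: "(real \<Rightarrow> complex) \<Rightarrow> complex \<Rightarrow> real \<Rightarrow> real \<Rightarrow> complex" where
  "log_power \<eta> m r x = of_real x powr (1/2 + m) * (\<eta> x * of_real (((ln x)\<^sup>2 + 1) powr (- r)))"

text \<open>With L = ln x and T = L^2 + 1 the function is T^(-r), and its scale-invariant
  derivatives carry a factor L / T or 1 / T, of modulus at most T^(-1/2). The condition r <= 1/2
  gives 2 r <= 1 and 2 (r + 1) <= 3, hence absolute constants; 5 is 3 + 1 for the bounded terms plus
  1 for ln x.\<close>

lemma log_power_derivatives:
  fixes r x :: real
  assumes x: "0 < x" and r: "0 \<le> r" "r \<le> 1/2"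
  defines "q \<equiv> \<lambda>x. ((ln x)\<^sup>2 + 1) powr (- r)"
    and "q' \<equiv> \<lambda>x. - (2 * r) * ((ln x)\<^sup>2 + 1) powr (- r - 1) * ln x / x"
    and "q'' \<equiv> \<lambda>x. 2 * r * ((ln x)\<^sup>2 + 1) powr (- r - 1) * (2 * (r + 1) * (ln x)\<^sup>2 / ((ln x)\<^sup>2 + 1) - 1 + ln x) / x\<^sup>2"
  shows "(q has_real_derivative q' x) (at x)" "(q' has_real_derivative q'' x) (at x)"
    and "\<bar>q x\<bar> \<le> 1" "\<bar>x * q' x\<bar> \<le> logw x" "\<bar>x\<^sup>2 * q'' x\<bar> \<le> 5 * logw x"
proof -
  define L T where "L = ln x" and "T = L\<^sup>2 + 1"
  have T: "1 \<le> T" "0 < T" by (auto simp: T_def add_nonneg_pos)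
  have Tx: "0 < (ln x)\<^sup>2 + 1" for x :: real by (simp add: add_nonneg_pos)
  have dT: "((\<lambda>x. (ln x)\<^sup>2 + 1) has_real_derivative 2 * ln x / x) (at x)"
    using x by (auto intro!: derivative_eq_intros)
  have dp: "((\<lambda>x. ((ln x)\<^sup>2 + 1) powr p) has_real_derivative p * ((ln x)\<^sup>2 + 1) powr (p - 1) * (2 * ln x / x)) (at x)" for p
    by (rule DERIV_cong[OF DERIV_chain2[OF has_real_derivative_powr[OF Tx] dT]]) simp
  show "(q has_real_derivative q' x) (at x)"
    unfolding q_def q'_def by (rule DERIV_cong[OF dp]) simp
  have dl: "((\<lambda>x. ln x / x) has_real_derivative (1 - ln x) / x\<^sup>2) (at x)"
    using x by (auto intro!: derivative_eq_intros simp: field_simps power2_eq_square)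
  have "((\<lambda>x. - (2 * r) * (((ln x)\<^sup>2 + 1) powr (- r - 1) * (ln x / x))) has_real_derivative
      - (2 * r) * (((- r - 1) * ((ln x)\<^sup>2 + 1) powr (- r - 1 - 1) * (2 * ln x / x)) * (ln x / x)
        + (1 - ln x) / x\<^sup>2 * ((ln x)\<^sup>2 + 1) powr (- r - 1))) (at x)"
    by (intro DERIV_cmult DERIV_mult dp dl)
  moreover have "- (2 * r) * (((- r - 1) * ((ln x)\<^sup>2 + 1) powr (- r - 1 - 1) * (2 * ln x / x)) * (ln x / x)
        + (1 - ln x) / x\<^sup>2 * ((ln x)\<^sup>2 + 1) powr (- r - 1)) = q'' x"
  proof -
    have p: "T powr (- r - 1 - 1) = T powr (- r - 1) / T" using T by (simp only: powr_diff powr_one)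
    have "- (2 * r) * (((- r - 1) * (P / T) * (2 * L / x)) * (L / x) + (1 - L) / x\<^sup>2 * P)
      = 2 * r * P * (2 * (r + 1) * L\<^sup>2 / T - 1 + L) / x\<^sup>2" for P
      using x T by (simp add: field_simps power2_eq_square)
    then show ?thesis unfolding q''_def L_def[symmetric] T_def[symmetric] p by simp
  qed
  moreover have "(\<lambda>x. - (2 * r) * (((ln x)\<^sup>2 + 1) powr (- r - 1) * (ln x / x))) = q'"
    by (simp add: q'_def fun_eq_iff)
  ultimately show "(q' has_real_derivative q'' x) (at x)" by simp
  have Tr: "T powr (- r) \<le> 1" "0 \<le> T powr (- r)"
    using powr_mono[of "- r" 0 T] T r by auto
  then show "\<bar>q x\<bar> \<le> 1" by (simp add: q_def T_def L_def)
  have T1: "T powr (- r - 1) = T powr (- r) / T" using T by (simp only: powr_diff powr_one)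
  have sT: "0 < sqrt T" "sqrt T * sqrt T = T" "1 \<le> sqrt T" using T by auto
  have lw: "logw x = 1 / sqrt T" by (simp add: logw_def T_def L_def)
  have Lle: "\<bar>L\<bar> \<le> sqrt T" by (rule real_le_rsqrt) (simp add: T_def)
  have LT: "\<bar>L\<bar> / T \<le> logw x"
  proof -
    have "\<bar>L\<bar> / T \<le> sqrt T / T" using Lle T by (intro divide_right_mono) auto
    also have "\<dots> = logw x" unfolding lw using sT by (metis nonzero_divide_mult_cancel_left order_less_irrefl)
    finally show ?thesis .
  qed
  have iT: "1 / T \<le> logw x"
  proof -
    have "1 / T \<le> sqrt T / T" using sT T by (intro divide_right_mono) auto
    also have "\<dots> = logw x" unfolding lw using sT by (metis nonzero_divide_mult_cancel_left order_less_irrefl)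
    finally show ?thesis .
  qed
  have coeff: "2 * r * T powr (- r) \<le> 1" by (rule mult_le_one) (use r Tr in auto)
  have "x * q' x = - (2 * r * T powr (- r)) * (L / T)"
    using x by (simp add: q'_def L_def[symmetric] T_def[symmetric] T1)
  then have "\<bar>x * q' x\<bar> = (2 * r * T powr (- r)) * (\<bar>L\<bar> / T)"
    using r T by (simp add: abs_mult)
  also have "\<dots> \<le> 1 * logw x"
    using T by (intro mult_mono coeff LT) auto
  finally show "\<bar>x * q' x\<bar> \<le> logw x" by simp
  have "x\<^sup>2 * q'' x = (2 * r * T powr (- r)) * ((2 * (r + 1) * L\<^sup>2 / T - 1 + L) / T)"
    using x by (simp add: q''_def L_def[symmetric] T_def[symmetric] T1)
  then have "\<bar>x\<^sup>2 * q'' x\<bar> = (2 * r * T powr (- r)) * \<bar>(2 * (r + 1) * L\<^sup>2 / T - 1 + L) / T\<bar>"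
    using r T by (simp add: abs_mult)
  also have "\<dots> \<le> 1 * (5 * logw x)"
  proof (rule mult_mono[OF coeff])
    have "L\<^sup>2 / T \<le> 1" using T by (simp add: T_def)
    then have "2 * (r + 1) * (L\<^sup>2 / T) \<le> 3 * 1" using r T by (intro mult_mono) auto
    moreover have "0 \<le> 2 * (r + 1) * (L\<^sup>2 / T)" using r T by simp
    ultimately have "\<bar>2 * (r + 1) * L\<^sup>2 / T - 1 + L\<bar> \<le> 4 + \<bar>L\<bar>" by (auto simp: abs_le_iff)
    then have "\<bar>(2 * (r + 1) * L\<^sup>2 / T - 1 + L) / T\<bar> \<le> (4 + \<bar>L\<bar>) / T"
      using T by (simp add: divide_right_mono)
    also have "\<dots> = 4 * (1 / T) + \<bar>L\<bar> / T" by (simp add: add_divide_distrib)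
    also have "\<dots> \<le> 5 * logw x" using iT LT by linarith
    finally show "\<bar>(2 * (r + 1) * L\<^sup>2 / T - 1 + L) / T\<bar> \<le> 5 * logw x" .
  qed auto
  finally show "\<bar>x\<^sup>2 * q'' x\<bar> \<le> 5 * logw x" by simp
qed

lemma log_power_in_L_min:
  assumes m: "Re m = 1" and r: "0 \<le> r" "r \<le> 1/2"
    and k: "\<And>x. (\<kappa> has_vector_derivative \<kappa>' x) (at x)" "\<And>x. (\<kappa>' has_vector_derivative \<kappa>'' x) (at x)"
    "\<kappa>' \<in> test_fun" "\<kappa>'' \<in> test_fun" "\<And>x. 2 \<le> x \<Longrightarrow> \<kappa> x = 1" "\<And>x. cmod (1 - \<kappa> x) \<le> 1"
    "\<And>x. x \<notin> {1..2} \<Longrightarrow> \<kappa>' x = 0" "\<And>x. x \<notin> {1..2} \<Longrightarrow> \<kappa>'' x = 0"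
  shows "log_power (\<lambda>x. 1 - \<kappa> x) m r \<in> Domain (L_min (m\<^sup>2))"
proof -
  define q where "q = (\<lambda>x::real. ((ln x)\<^sup>2 + 1) powr (- r))"
  define q' where "q' = (\<lambda>x::real. - (2 * r) * ((ln x)\<^sup>2 + 1) powr (- r - 1) * ln x / x)"
  define q'' where "q'' = (\<lambda>x::real. 2 * r * ((ln x)\<^sup>2 + 1) powr (- r - 1) * (2 * (r + 1) * (ln x)\<^sup>2 / ((ln x)\<^sup>2 + 1) - 1 + ln x) / x\<^sup>2)"
  have dq: "(q has_real_derivative q' x) (at x)" "(q' has_real_derivative q'' x) (at x)"
    and bq: "\<bar>q x\<bar> \<le> 1" "\<bar>x * q' x\<bar> \<le> logw x" "\<bar>x\<^sup>2 * q'' x\<bar> \<le> 5 * logw x" if "0 < x" for x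
    using log_power_derivatives[OF that r] unfolding q_def q'_def q''_def by blast+
  have cq: "continuous_on {0<..} q" "continuous_on {0<..} q'"
    using dq by (auto intro!: DERIV_continuous_on intro: has_field_derivative_at_within)
  have Tx: "(ln x)\<^sup>2 + 1 \<noteq> (0::real)" for x :: real by (simp add: add_nonneg_eq_0_iff)
  have cq'': "continuous_on {0<..} q''"
    unfolding q''_def using Tx by (intro continuous_intros) auto
  have dc: "((\<lambda>x. complex_of_real (q x)) has_vector_derivative of_real (q' x)) (at x)"
    "((\<lambda>x. complex_of_real (q' x)) has_vector_derivative of_real (q'' x)) (at x)" if "0 < x" for x
    using has_vector_derivative_of_real[OF dq(1)[OF that]] has_vector_derivative_of_real[OF dq(2)[OF that]] by auto
  have ck: "continuous_on S \<kappa>" "continuous_on S \<kappa>'" "continuous_on S \<kappa>''" for S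
    using k(1) smooth_continuous_on[OF test_fun_smooth[OF k(3)]] smooth_continuous_on[OF test_fun_smooth[OF k(4)]]
    by (auto intro!: continuous_on_vector_derivative intro: has_vector_derivative_at_within)
  obtain C1 where C1: "0 \<le> C1" "\<And>x. 0 < x \<Longrightarrow> cmod (of_real x * \<kappa>' x) \<le> C1 * logw x"
    by (rule compact_support_le_logw[of "\<lambda>x. of_real x * \<kappa>' x" 1 2]) (use k(7) in \<open>auto intro!: continuous_intros ck\<close>)
  obtain C2 where C2: "0 \<le> C2" "\<And>x. 0 < x \<Longrightarrow> cmod (of_real (x\<^sup>2) * \<kappa>'' x) \<le> C2 * logw x"
    by (rule compact_support_le_logw[of "\<lambda>x. of_real (x\<^sup>2) * \<kappa>'' x" 1 2]) (use k(8) in \<open>auto intro!: continuous_intros ck\<close>)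
  define g' where "g' x = (1 - \<kappa> x) * of_real (q' x) + (- \<kappa>' x) * of_real (q x)" for x
  define g'' where "g'' x = ((1 - \<kappa> x) * of_real (q'' x) + (- \<kappa>' x) * of_real (q' x)) + ((- \<kappa>' x) * of_real (q' x) + (- \<kappa>'' x) * of_real (q x))" for x
  have de: "((\<lambda>x. 1 - \<kappa> x) has_vector_derivative - \<kappa>' x) (at x)" "((\<lambda>x. - \<kappa>' x) has_vector_derivative - \<kappa>'' x) (at x)" for x
    using has_vector_derivative_diff[OF has_vector_derivative_const[of 1] k(1)[of x]] has_vector_derivative_minus[OF k(2)[of x]] by auto
  \<comment> \<open>5 bounds x^2 q'', 2 C1 the two mixed terms of the second derivative, C2 the term
    with the second derivative of the cutoff.\<close>
  define C where "C = 5 + 2 * C1 + C2"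
  have "(\<lambda>x. of_real x powr (1/2 + m) * ((1 - \<kappa> x) * of_real (q x))) \<in> Domain (L_min (m\<^sup>2))"
  proof (rule powr_times_in_L_min[OF m, where R=3 and g'=g' and g''=g'' and C=C])
    show "((\<lambda>x. (1 - \<kappa> x) * of_real (q x)) has_vector_derivative g' x) (at x)" if "0 < x" for x
      unfolding g'_def by (intro has_vector_derivative_mult de dc that)
    show "(g' has_vector_derivative g'' x) (at x)" if "0 < x" for x
      unfolding g'_def g''_def by (intro has_vector_derivative_add has_vector_derivative_mult de dc that)
    show "continuous_on {0<..} g''"
      unfolding g''_def by (intro continuous_intros ck cq cq'')
    show "(1 - \<kappa> x) * of_real (q x) = 0 \<and> g' x = 0 \<and> g'' x = 0" if "3 < x" for x
      using that k(5)[of x] k(7,8)[of x] by (simp add: g'_def g''_def)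
    fix x :: real assume x: "0 < x"
    have lw: "0 \<le> logw x" "logw x \<le> 1" using logw_pos[of x] logw_le_1[of x] by auto
    have b: "cmod (of_real (q x)) \<le> 1" "cmod (of_real (x * q' x)) \<le> logw x" "cmod (of_real (x\<^sup>2 * q'' x)) \<le> 5 * logw x"
      unfolding norm_of_real using bq[OF x] by auto
    have b': "cmod (of_real (x * q' x)) \<le> 1" using b(2) lw by linarith
    have n1: "cmod (- (of_real x * \<kappa>' x)) \<le> C1 * logw x" "cmod (- (of_real (x\<^sup>2) * \<kappa>'' x)) \<le> C2 * logw x"
      unfolding norm_minus_cancel using C1(2)[OF x] C2(2)[OF x] by auto
    have "cmod ((1 - \<kappa> x) * of_real (q x)) \<le> 1 * 1" by (intro cmod_mult_mono k(6) b)
    then show "cmod ((1 - \<kappa> x) * of_real (q x)) \<le> C" using C1 C2 by (simp add: C_def)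
    have "of_real x * g' x = (1 - \<kappa> x) * of_real (x * q' x) + (- (of_real x * \<kappa>' x)) * of_real (q x)"
      by (simp add: g'_def algebra_simps)
    also have "cmod \<dots> \<le> 1 * logw x + (C1 * logw x) * 1"
      by (intro order_trans[OF norm_triangle_ineq] add_mono cmod_mult_mono k(6) b n1)
    also have "\<dots> \<le> C * logw x"
      using mult_nonneg_nonneg[OF C1(1) lw(1)] mult_nonneg_nonneg[OF C2(1) lw(1)] lw by (simp add: C_def algebra_simps)
    finally show "cmod (of_real x * g' x) \<le> C * logw x" .
    have "of_real (x\<^sup>2) * g'' x = ((1 - \<kappa> x) * of_real (x\<^sup>2 * q'' x) + (- (of_real x * \<kappa>' x)) * of_real (x * q' x))
        + ((- (of_real x * \<kappa>' x)) * of_real (x * q' x) + (- (of_real (x\<^sup>2) * \<kappa>'' x)) * of_real (q x))"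
      by (simp add: g''_def algebra_simps power2_eq_square)
    also have "cmod \<dots> \<le> (1 * (5 * logw x) + (C1 * logw x) * 1) + ((C1 * logw x) * 1 + (C2 * logw x) * 1)"
      by (intro order_trans[OF norm_triangle_ineq] add_mono cmod_mult_mono k(6) b b' n1)
    also have "\<dots> = C * logw x" by (simp add: C_def algebra_simps)
    finally show "cmod (of_real (x\<^sup>2) * g'' x) \<le> C * logw x" .
  qed simp
  then show ?thesis by (simp add: q_def log_power_def[abs_def])
qed

text \<open>After division by x^4 the hypothesis bounds |f / x^2|^2 from below by c logw(x) / x near
  0, which is not integrable, whereas f / x^2 is in L2 for f in \<open>H20\<close>.\<close>

lemma not_H20_if_log_lower_bound:
  assumes c: "0 < c" and d: "0 < d"
    and le: "\<And>x. 0 < x \<Longrightarrow> x < d \<Longrightarrow> c * x ^ 3 * logw x \<le> (cmod (f x))\<^sup>2"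
  shows "f \<notin> H20"
proof
  assume "f \<in> H20"
  then have q: "(\<lambda>x. f x / of_real (x\<^sup>2)) \<in> L2" by (rule H20E)
  show False
  proof (rule log_not_integrable[OF q c d], rule AE_I2, rule impI)
    fix x assume "x \<in> space lebP" "x < d"
    then have x: "0 < x" "x < d" by auto
    have "c / (x * sqrt ((ln x)\<^sup>2 + 1)) = c * x ^ 3 * logw x / x ^ 4"
      using x by (simp add: logw_def eval_nat_numeral)
    also have "\<dots> \<le> (cmod (f x))\<^sup>2 / x ^ 4" using le[OF x] x by (intro divide_right_mono) auto
    also have "\<dots> = (cmod (f x / of_real (x\<^sup>2)))\<^sup>2"
      by (simp add: norm_divide norm_power power_divide power_mult[symmetric])
    finally show "c / (x * sqrt ((ln x)\<^sup>2 + 1)) \<le> (cmod (f x / of_real (x\<^sup>2)))\<^sup>2" .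
  qed
qed

lemma cmod_powr_sq:
  assumes m: "Re m = 1" and x: "0 < x"
  shows "(cmod (of_real x powr (1/2 + m)))\<^sup>2 = x ^ 3"
proof -
  have "(cmod (of_real x powr (1/2 + m)))\<^sup>2 = x powr (3/2) * x powr (3/2)"
    using x m by (simp add: cmod_of_real_powr power2_eq_square)
  also have "\<dots> = x powr (of_nat 3)" by (simp flip: powr_add)
  also have "\<dots> = x ^ 3" using x by (simp only: powr_realpow)
  finally show ?thesis .
qed

lemma cutoff_power_not_H20:
  assumes m: "Re m = 1" and xi: "one_near_0 \<xi>" shows "cutoff_power m \<xi> \<notin> H20"
proof -
  obtain d where d: "0 < d" "\<And>x. 0 \<le> x \<Longrightarrow> x < d \<Longrightarrow> \<xi> x = 1" using xi by (auto simp: one_near_0_def)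
  show ?thesis
  proof (rule not_H20_if_log_lower_bound[of 1 d])
    fix x assume x: "0 < x" "x < d"
    have "x ^ 3 * logw x \<le> x ^ 3 * 1" using x logw_le_1[of x] by (intro mult_left_mono) auto
    then show "1 * x ^ 3 * logw x \<le> (cmod (cutoff_power m \<xi> x))\<^sup>2"
      using x d cmod_powr_sq[OF m x(1)] by (simp add: cutoff_power_def)
  qed (use d in auto)
qed

text \<open>Near 0 the combination is x^(1/2+m) p(y), with a non-zero polynomial p and y = (1 + ln^2
  x)^(-s) tending to 0. If j is the order of p at 0, then |p(y)| is at least a constant times y^j,
  and y^(2j) >= \<open>logw x\<close> because j s <= 1/4: no cancellation brings the function below
  the critical rate.\<close>

lemma log_power_combination_not_H20:
  fixes c :: "nat \<Rightarrow> complex"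
  assumes m: "Re m = 1" and k: "\<And>x. x \<le> 1 \<Longrightarrow> \<kappa> x = 0" and c: "\<exists>i\<le>n. c i \<noteq> 0"
  defines "s \<equiv> 1 / (4 * (real n + 1))"
  shows "(\<lambda>x. \<Sum>i\<le>n. c i * log_power (\<lambda>x. 1 - \<kappa> x) m (s * real i) x) \<notin> H20"
proof -
  define p where "p = (\<Sum>i\<le>n. monom (c i) i)"
  have "coeff p i = c i" if "i \<le> n" for i
    using that by (simp add: p_def coeff_sum)
  then have p0: "p \<noteq> 0" using c by (metis coeff_0)
  have "degree p \<le> n" unfolding p_def
    by (rule degree_sum_le) (auto intro: order_trans[OF degree_monom_le])
  define j where "j = order 0 p"
  have j: "j \<le> n" using order_degree[OF p0, of 0] \<open>degree p \<le> n\<close> by (simp add: j_def)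
  obtain Q where Q: "p = [:-0, 1:] ^ j * Q" "\<not> [:-0, 1:] dvd Q" using order_decomp[OF p0, of 0] by (auto simp: j_def)
  have Q0: "poly Q 0 \<noteq> 0" using Q(2) unfolding poly_eq_0_iff_dvd by simp
  define y where "y x = ((ln x)\<^sup>2 + 1) powr (- s)" for x :: real
  have s: "0 < s" by (simp add: s_def)
  have T: "0 < (ln x)\<^sup>2 + 1" for x :: real by (simp add: add_nonneg_pos)
  have yi: "((ln x)\<^sup>2 + 1) powr (- (s * real i)) = y x ^ i" for x i
    using T[of x] by (simp add: y_def powr_power mult.commute)
  have "LIM x at_right 0. (ln x)\<^sup>2 :> (at_top :: real filter)"
    by (rule filterlim_pow_at_bot_even[OF _ ln_at_0]) auto
  then have "LIM x at_right 0. 1 + (ln x)\<^sup>2 :> (at_top :: real filter)"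
    by (rule filterlim_tendsto_add_at_top[OF tendsto_const])
  then have "((\<lambda>x. (1 + (ln x)\<^sup>2) powr (- s)) \<longlongrightarrow> 0) (at_right 0)"
    by (intro tendsto_neg_powr) (use s in auto)
  then have "(y \<longlongrightarrow> 0) (at_right 0)" by (simp add: y_def[abs_def] add.commute)
  then have "((\<lambda>x. cmod (poly Q (of_real (y x)))) \<longlongrightarrow> cmod (poly Q (of_real 0))) (at_right 0)"
    by (intro tendsto_intros)
  then have "eventually (\<lambda>x. cmod (poly Q 0) / 2 < cmod (poly Q (of_real (y x)))) (at_right 0)"
    using Q0 by (intro order_tendstoD(1)) auto
  then obtain d where d: "0 < d" "\<And>x. 0 < x \<Longrightarrow> x < d \<Longrightarrow> cmod (poly Q 0) / 2 < cmod (poly Q (of_real (y x)))"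
    by (auto simp: eventually_at_right_field)
  show ?thesis
  proof (rule not_H20_if_log_lower_bound[of "(cmod (poly Q 0) / 2)\<^sup>2" "min d 1"])
    fix x assume "0 < x" "x < min d 1"
    then have x: "0 < x" "x < d" "x < 1" by auto
    have "(\<Sum>i\<le>n. c i * log_power (\<lambda>x. 1 - \<kappa> x) m (s * real i) x)
        = of_real x powr (1/2 + m) * poly p (of_real (y x))"
      using x k[of x] by (simp add: log_power_def yi p_def poly_sum poly_monom sum_distrib_left mult_ac)
    also have "poly p (of_real (y x)) = of_real (y x ^ j) * poly Q (of_real (y x))"
      by (simp add: Q(1))
    finally have eq: "(\<Sum>i\<le>n. c i * log_power (\<lambda>x. 1 - \<kappa> x) m (s * real i) x)
        = of_real x powr (1/2 + m) * (of_real (y x ^ j) * poly Q (of_real (y x)))" .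
    have yj: "logw x \<le> (y x ^ j)\<^sup>2"
    proof -
      \<comment> \<open>The size of s is fixed here: squaring y^j doubles the exponent, which must
        not exceed the 1/2 of \<open>logw\<close>.\<close>
      have "s * real j \<le> s * (real n + 1)" using j s by (intro mult_left_mono) auto
      also have "\<dots> = 1/4" by (simp add: s_def)
      finally have sj: "2 * (s * real j) \<le> 1/2" by simp
      have "logw x = ((ln x)\<^sup>2 + 1) powr (- (1/2))"
        unfolding powr_minus powr_half_sqrt[OF less_imp_le[OF T]] logw_def by (simp add: inverse_eq_divide)
      also have "\<dots> \<le> ((ln x)\<^sup>2 + 1) powr (- (2 * (s * real j)))"
        using sj by (intro powr_mono) auto
      also have "\<dots> = (y x ^ j)\<^sup>2"
        unfolding yi[symmetric] power2_eq_square by (simp flip: powr_add)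
      finally show ?thesis .
    qed
    have "(cmod (poly Q 0) / 2)\<^sup>2 * x ^ 3 * logw x \<le> (cmod (poly Q (of_real (y x))))\<^sup>2 * x ^ 3 * (y x ^ j)\<^sup>2"
      using d(2)[OF x(1,2)] yj x logw_pos[of x] by (intro mult_mono power_mono) auto
    also have "\<dots> = (cmod (of_real x powr (1/2 + m) * (of_real (y x ^ j) * poly Q (of_real (y x)))))\<^sup>2"
      unfolding norm_mult power_mult_distrib cmod_powr_sq[OF m x(1)] norm_of_real by simp
    finally show "(cmod (poly Q 0) / 2)\<^sup>2 * x ^ 3 * logw x \<le> (cmod (\<Sum>i\<le>n. c i * log_power (\<lambda>x. 1 - \<kappa> x) m (s * real i) x))\<^sup>2"
      unfolding eq .
  qed (use Q0 d in auto)
qed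

section \<open>The operator \<open>H\<^sub>m\<close>\<close>

text \<open>Each \<open>f i\<close> splits into a part in \<open>V\<close> and a part in the span of
  \<open>F\<close>. There are \<open>card F + 1\<close> of the latter, so they satisfy a non-trivial
  relation, and the same relation between the \<open>f i\<close> lands in \<open>V\<close>.\<close>

lemma finite_codim_relation:
  fixes f :: "nat \<Rightarrow> real \<Rightarrow> complex"
  assumes V: "cfun.subspace V" and F: "finite F" and f: "\<And>i. i \<le> card F \<Longrightarrow> f i \<in> cfun.span (V \<union> F)"
  obtains c where "\<exists>i\<le>card F. c i \<noteq> 0" "(\<lambda>x. \<Sum>i\<le>card F. c i * f i x) \<in> V"
proof -
  have "\<exists>v b. v \<in> V \<and> b \<in> cfun.span F \<and> f i = v + b" if "i \<le> card F" for i
  proof -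
    have "cfun.span V = V" using V by (simp add: cfun.span_eq_iff)
    then show ?thesis using f[OF that] unfolding cfun.span_Un by blast
  qed
  then obtain v b where vb: "\<And>i. i \<le> card F \<Longrightarrow> v i \<in> V \<and> b i \<in> cfun.span F \<and> f i = v i + b i" by metis
  have sum_apply: "(\<Sum>i\<in>A. g i) x = (\<Sum>i\<in>A. g i x)" for A :: "nat set" and g :: "nat \<Rightarrow> real \<Rightarrow> complex" and x
    by (induction A rule: infinite_finite_induct) auto
  have sum_apply': "(\<Sum>u\<in>A. g u) x = (\<Sum>u\<in>A. g u x)" for A :: "(real \<Rightarrow> complex) set" and g :: "(real \<Rightarrow> complex) \<Rightarrow> real \<Rightarrow> complex" and x
    by (induction A rule: infinite_finite_induct) auto
  have "\<exists>c. (\<exists>i\<le>card F. c i \<noteq> 0) \<and> (\<forall>x. (\<Sum>i\<le>card F. c i * b i x) = 0)"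
  proof (cases "inj_on b {..card F}")
    \<comment> \<open>Dependence is a property of sets of vectors, so a repetition among the
      \<open>b i\<close> is treated apart; it gives a relation directly.\<close>
    case False
    then obtain i j where ij: "i \<le> card F" "j \<le> card F" "i \<noteq> j" "b i = b j" by (auto simp: inj_on_def)
    define c where "c l = (if l = i then 1 else if l = j then -1 else 0 :: complex)" for l
    have "(\<Sum>l\<le>card F. c l * b l x) = 0" for x
    proof -
      have "(\<Sum>l\<le>card F. c l * b l x) = (\<Sum>l\<in>{i,j}. c l * b l x)"
        by (rule sum.mono_neutral_right) (use ij in \<open>auto simp: c_def\<close>)
      also have "\<dots> = 0" using ij by (simp add: c_def)
      finally show ?thesis .
    qed
    then show ?thesis using ij by (intro exI[of _ c]) (auto simp: c_def)
  next
    case True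
    then have card: "card (b ` {..card F}) = card F + 1" by (simp add: card_image)
    have sub: "b ` {..card F} \<subseteq> cfun.span F" using vb by auto
    have "cfun.dependent (b ` {..card F})"
      using cfun.independent_span_bound[OF F _ sub] card by auto
    then obtain u where u: "\<exists>w\<in>b ` {..card F}. u w \<noteq> 0" "(\<Sum>w\<in>b ` {..card F}. (\<lambda>x. u w * w x)) = 0"
      using cfun.dependent_finite[of "b ` {..card F}"] by auto
    have "(\<Sum>i\<le>card F. u (b i) * b i x) = 0" for x
    proof -
      have "(\<Sum>i\<le>card F. u (b i) * b i x) = (\<Sum>w\<in>b ` {..card F}. u w * w x)"
        by (simp add: sum.reindex[OF True])
      also have "\<dots> = (\<Sum>w\<in>b ` {..card F}. (\<lambda>x. u w * w x)) x" by (simp add: sum_apply')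
      also have "\<dots> = 0" by (simp add: u(2))
      finally show ?thesis .
    qed
    then show ?thesis using u(1) by (intro exI[of _ "\<lambda>i. u (b i)"]) auto
  qed
  then obtain c where c: "\<exists>i\<le>card F. c i \<noteq> 0" "\<And>x. (\<Sum>i\<le>card F. c i * b i x) = 0" by blast
  have "(\<lambda>x. \<Sum>i\<le>card F. c i * f i x) = (\<Sum>i\<le>card F. (\<lambda>x. c i * v i x))"
  proof
    fix x
    have "(\<Sum>i\<le>card F. c i * f i x) = (\<Sum>i\<le>card F. c i * v i x + c i * b i x)"
      by (rule sum.cong) (use vb in \<open>auto simp: distrib_left\<close>)
    also have "\<dots> = (\<Sum>i\<le>card F. c i * v i x)" by (simp add: sum.distrib c(2))
    finally show "(\<Sum>i\<le>card F. c i * f i x) = (\<Sum>i\<le>card F. (\<lambda>x. c i * v i x)) x" by (simp add: sum_apply)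
  qed
  moreover have "(\<Sum>i\<le>card F. (\<lambda>x. c i * v i x)) \<in> V"
    by (rule cfun.subspace_sum[OF V], rule cfun.subspace_scale[OF V]) (use vb in auto)
  ultimately show ?thesis using that c(1) by simp
qed

lemma H20_subset_Domain_L_min: "H20 \<subseteq> Domain (L_min \<alpha>)"
proof
  fix f assume "f \<in> H20"
  then obtain h where "f \<in> L2" "h \<in> L2" "dist_deriv2 f h" "(\<lambda>x. f x / of_real (x\<^sup>2)) \<in> L2" by (rule H20E)
  then show "f \<in> Domain (L_min \<alpha>)" using L_min_H20 by blast
qed

lemma op_restrict_iff: "(f, g) \<in> op_restrict T V \<longleftrightarrow> (f, g) \<in> T \<and> f \<in> V"
  by (simp add: op_restrict_def)

lemma Domain_H_op:
  assumes m: "Re m = 1" and xi: "\<xi> \<in> Ck_c_half 2" "one_near_0 \<xi>"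
  shows "Domain (H_op \<xi> m) = Domain (L_min (m\<^sup>2))"
proof (intro equalityI subsetI)
  fix f assume "f \<in> Domain (H_op \<xi> m)"
  then obtain f1 c where f1: "f1 \<in> Domain (L_min (m\<^sup>2))" and f: "f = f1 + (\<lambda>x. c * cutoff_power m \<xi> x)"
    unfolding H_op_def Domain_iff op_restrict_iff by blast
  obtain g1 k where "(f1, g1) \<in> L_min (m\<^sup>2)" "(cutoff_power m \<xi>, k) \<in> L_min (m\<^sup>2)"
    using f1 cutoff_power_in_L_min[OF m xi] by auto
  from L_min_linear[OF this, of c] show "f \<in> Domain (L_min (m\<^sup>2))"
    by (auto simp: f plus_fun_def)
next
  fix f assume "f \<in> Domain (L_min (m\<^sup>2))"
  then obtain g where fg: "(f, g) \<in> L_min (m\<^sup>2)" by blast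
  have "f = f + (\<lambda>x. 0 * cutoff_power m \<xi> x)" by (simp add: fun_eq_iff)
  moreover have "(f, g) \<in> L_max (m\<^sup>2)" using fg L_min_subset_L_max by blast
  ultimately show "f \<in> Domain (H_op \<xi> m)"
    unfolding H_op_def Domain_iff op_restrict_iff using fg by blast
qed

text \<open>At the start f / x^2 is only locally square integrable. It is therefore compared weakly,
  on test functions, with a candidate that is visibly in L2, and the fundamental lemma makes them
  equal almost everywhere.\<close>

lemma Domain_L_max_inter_subset_H20:
  assumes "\<alpha> \<noteq> \<alpha>'" "f \<in> Domain (L_max \<alpha>)" "f \<in> Domain (L_max \<alpha>')"
  shows "f \<in> H20"
proof -
  obtain g g' where f: "f \<in> L2" and g: "g \<in> L2" "dist_L \<alpha> f g" "g' \<in> L2" "dist_L \<alpha>' f g'"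
    using assms by (auto simp: L_max_def)
  define w where "w x = f x / of_real (x\<^sup>2)" for x
  have wloc: "L2loc w"
  proof -
    have "continuous_on {0<..} (\<lambda>x. 1 / complex_of_real (x\<^sup>2))" by (intro continuous_intros) auto
    from L2loc_mult_continuous[OF L2loc_L2[OF f] this] show ?thesis by (simp add: w_def[abs_def])
  qed
  have split: "(LINT x|lebP. g x * \<phi> x) = (\<alpha> - 1/4) * (LINT x|lebP. w x * \<phi> x) - (LINT x|lebP. f x * deriv2 \<phi> x)"
    if d: "dist_L \<alpha> f g" and phi: "\<phi> \<in> test_fun" for \<alpha> g \<phi>
  proof -
    have p2: "deriv2 \<phi> \<in> test_fun" using phi by (rule test_fun_derivatives)
    note i = integrable_mult_right[OF L2loc_mult_test_fun_integrable[OF wloc phi], of "\<alpha> - 1/4"]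
      L2loc_mult_test_fun_integrable[OF L2loc_L2[OF f] p2]
    have "(LINT x|lebP. g x * \<phi> x) = (LINT x|lebP. f x * L_expr \<alpha> \<phi> (deriv2 \<phi>) x)"
      using d phi unfolding dist_L_iff by simp
    also have "\<dots> = (LINT x|lebP. (\<alpha> - 1/4) * (w x * \<phi> x) - f x * deriv2 \<phi> x)"
      by (rule Bochner_Integration.integral_cong) (auto simp: L_expr_def w_def right_diff_distrib)
    finally show ?thesis
      using Bochner_Integration.integral_diff[OF i] by (simp only: integral_mult_right_zero)
  qed
  \<comment> \<open>Subtracting the two expressions eliminates f'' and leaves \<alpha> - \<alpha>'
    times f / x^2.\<close>
  define z where "z x = (1 / (\<alpha> - \<alpha>')) * (g x - g' x)" for x
  have zL: "z \<in> L2" unfolding z_def by (intro L2_cmult L2_diff g)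
  have "AE x in lebP. w x - z x = 0"
  proof (rule fundamental_lemma_variations[OF L2loc_diff[OF wloc L2loc_L2[OF zL]]])
    fix \<phi> assume phi: "\<phi> \<in> test_fun"
    note i = L2loc_mult_test_fun_integrable[OF L2loc_L2[OF g(1)] phi] L2loc_mult_test_fun_integrable[OF L2loc_L2[OF g(3)] phi]
      L2loc_mult_test_fun_integrable[OF wloc phi] L2loc_mult_test_fun_integrable[OF L2loc_L2[OF zL] phi]
    have "(LINT x|lebP. z x * \<phi> x) = (1 / (\<alpha> - \<alpha>')) * ((LINT x|lebP. g x * \<phi> x) - (LINT x|lebP. g' x * \<phi> x))"
      unfolding z_def mult.assoc left_diff_distrib using i(1,2) by simp
    also have "\<dots> = (1 / (\<alpha> - \<alpha>')) * ((\<alpha> - \<alpha>') * (LINT x|lebP. w x * \<phi> x))"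
      unfolding split[OF g(2) phi] split[OF g(4) phi] by (simp add: algebra_simps)
    also have "\<dots> = (LINT x|lebP. w x * \<phi> x)" using assms(1) by simp
    finally show "(LINT x|lebP. (w x - z x) * \<phi> x) = 0"
      unfolding left_diff_distrib using i by simp
  qed
  then have ae: "AE x in lebP. w x = z x" by eventually_elim simp
  have wL: "w \<in> L2"
    by (rule L2_AE(1)[OF zL L2loc_measurable[OF wloc] ae])
  \<comment> \<open>The first expression solved for f''.\<close>
  define h where "h x = (\<alpha> - 1/4) * w x - g x" for x
  have hL: "h \<in> L2" unfolding h_def by (intro L2_diff L2_cmult wL g)
  have "dist_deriv2 f h" unfolding dist_deriv2_def
  proof
    fix \<phi> assume phi: "\<phi> \<in> test_fun"
    note i = integrable_mult_right[OF L2loc_mult_test_fun_integrable[OF wloc phi], of "\<alpha> - 1/4"]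
      L2loc_mult_test_fun_integrable[OF L2loc_L2[OF g(1)] phi]
    show "(LINT x|lebP. f x * deriv2 \<phi> x) = (LINT x|lebP. h x * \<phi> x)"
      unfolding h_def left_diff_distrib[of _ _ "\<phi> _"] mult.assoc
      using Bochner_Integration.integral_diff[OF i] split[OF g(2) phi] by (simp only: integral_mult_right_zero) simp
  qed
  from H20I(1)[OF f hL this] wL show ?thesis by (simp add: w_def[abs_def])
qed

text \<open>The approximants are test functions, supplied by the definition of \<open>L_min\<close>.
  An element of \<open>H_op\<close> may carry another representative of the image than the one found
  in \<open>L_min\<close>; \<open>L_max_unique\<close> bridges the two.\<close>

lemma graph_dense_H20:
  assumes m: "Re m = 1" and xi: "\<xi> \<in> Ck_c_half 2" "one_near_0 \<xi>"
  shows "graph_dense H20 (H_op \<xi> m)"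
  unfolding graph_dense_def
proof (intro conjI ballI allI impI)
  show "H20 \<subseteq> Domain (H_op \<xi> m)" using H20_subset_Domain_L_min Domain_H_op[OF m xi] by simp
  fix p and e :: real assume p: "p \<in> H_op \<xi> m" and e: "0 < e"
  obtain f g where fg: "p = (f, g)" by (cases p)
  have max: "(f, g) \<in> L_max (m\<^sup>2)" using p by (simp add: fg H_op_def op_restrict_def)
  have "f \<in> Domain (L_min (m\<^sup>2))" using p Domain_H_op[OF m xi] fg by blast
  then obtain g' where g': "(f, g') \<in> L_min (m\<^sup>2)" by blast
  have ae: "AE x in lebP. g x = g' x"
    using L_max_unique[OF max] g' L_min_subset_L_max by blast
  have "0 < e\<^sup>2 / 2" using e by simp
  from op_closureD[OF g'[unfolded L_min_def] this] obtain \<phi> k where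
    q: "(\<phi>, k) \<in> op_restrict (L_max (m\<^sup>2)) test_fun" "L2_sq (\<lambda>x. f x - \<phi> x) < e\<^sup>2 / 2" "L2_sq (\<lambda>x. g' x - k x) < e\<^sup>2 / 2"
    by blast
  have qm: "(\<phi>, k) \<in> L_max (m\<^sup>2)" and phi: "\<phi> \<in> H20" using q(1) test_fun_H20(1) by (auto simp: op_restrict_def)
  have L: "g \<in> L2" "g' \<in> L2" "k \<in> L2" using max g' qm L_min_subset_L_max by (auto simp: L_max_def)
  have "L2_sq (\<lambda>x. g x - k x) = L2_sq (\<lambda>x. g' x - k x)"
    by (rule L2_sq_cong_AE[OF L2_diff[OF L(1,3)] L2_diff[OF L(2,3)]]) (use ae in eventually_elim, simp)
  then have "graph_norm (p - (\<phi>, k)) < e"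
    unfolding graph_norm_less_iff[OF e] fg using q by simp
  moreover have "(\<phi>, k) \<in> H_op \<xi> m"
  proof -
    have "\<phi> \<in> Domain (H_op \<xi> m)" using phi H20_subset_Domain_L_min Domain_H_op[OF m xi] by blast
    then show ?thesis using qm unfolding H_op_def Domain_iff op_restrict_iff by blast
  qed
  ultimately show "\<exists>q\<in>H_op \<xi> m. fst q \<in> H20 \<and> graph_norm (p - q) < e"
    using phi by (intro bexI[of _ "(\<phi>, k)"]) auto
qed

lemma infinite_codim_H20:
  assumes m: "Re m = 1" shows "infinite_codim H20 (Domain (L_min (m\<^sup>2)))"
  unfolding infinite_codim_def
proof
  assume "\<exists>F. finite F \<and> F \<subseteq> Domain (L_min (m\<^sup>2)) \<and> Domain (L_min (m\<^sup>2)) \<subseteq> cfun.span (H20 \<union> F)"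
  then obtain F where F: "finite F" "Domain (L_min (m\<^sup>2)) \<subseteq> cfun.span (H20 \<union> F)" by blast
  obtain \<kappa> \<kappa>' \<kappa>'' :: "real \<Rightarrow> complex" where k: "\<And>x. (\<kappa> has_vector_derivative \<kappa>' x) (at x)"
    "\<And>x. (\<kappa>' has_vector_derivative \<kappa>'' x) (at x)"
    "\<kappa>' \<in> test_fun" "\<kappa>'' \<in> test_fun" "\<And>x. 2 \<le> x \<Longrightarrow> \<kappa> x = 1" "\<And>x. cmod (1 - \<kappa> x) \<le> 1"
    "\<And>x. x \<notin> {1..2} \<Longrightarrow> \<kappa>' x = 0" "\<And>x. x \<notin> {1..2} \<Longrightarrow> \<kappa>'' x = 0" and k0: "\<And>x. x \<le> 1 \<Longrightarrow> \<kappa> x = 0"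
    by (rule smooth_step_derivatives) blast
  \<comment> \<open>The exponents s i with i <= \<open>card F\<close> then all lie in [0,1/4], where
    non-trivial combinations stay outside \<open>H20\<close>.\<close>
  define s where "s = 1 / (4 * (real (card F) + 1))"
  define f where "f i = log_power (\<lambda>x. 1 - \<kappa> x) m (s * real i)" for i
  have span: "f i \<in> cfun.span (H20 \<union> F)" if "i \<le> card F" for i
  proof -
    have "s * real i \<le> s * (real (card F) + 1)" using that by (intro mult_left_mono) (auto simp: s_def)
    also have "\<dots> = 1/4" by (simp add: s_def)
    finally have "f i \<in> Domain (L_min (m\<^sup>2))"
      unfolding f_def by (intro log_power_in_L_min[OF m _ _ k]) (auto simp: s_def)
    then show ?thesis using F(2) by blast
  qed
  obtain c where c: "\<exists>i\<le>card F. c i \<noteq> 0" "(\<lambda>x. \<Sum>i\<le>card F. c i * f i x) \<in> H20"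
    by (rule finite_codim_relation[where f=f, OF H20_subspace F(1) span])
  show False
    using log_power_combination_not_H20[OF m k0 c(1)] c(2) unfolding f_def s_def by (rule notE)
qed

theorem theorem7p1:
  fixes m :: complex and \<xi>\<^sub>0 :: "real \<Rightarrow> complex"
  assumes "Re m = 1" and "\<xi>\<^sub>0 \<in> Cinf_c_half" and "one_near_0 \<xi>\<^sub>0"
  shows "(cfun.subspace H20 \<and> graph_dense H20 (H_op \<xi>\<^sub>0 m) \<and>
          infinite_codim H20 (Domain (H_op \<xi>\<^sub>0 m))) \<and>
         (\<forall>\<xi>. \<xi> \<in> Ck_c_half 2 \<and> one_near_0 \<xi> \<longrightarrow>
            cutoff_power m \<xi> \<in> Domain (H_op \<xi>\<^sub>0 m) \<and> cutoff_power m \<xi> \<notin> H20) \<and>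
         (\<forall>m' \<xi>\<^sub>0'. Re m' = 1 \<and> m \<noteq> m' \<and> \<xi>\<^sub>0' \<in> Cinf_c_half \<and> one_near_0 \<xi>\<^sub>0' \<longrightarrow>
            Domain (H_op \<xi>\<^sub>0 m) \<inter> Domain (H_op \<xi>\<^sub>0' m') = H20)"
proof -
  have C2: "\<xi> \<in> Ck_c_half 2" if "\<xi> \<in> Cinf_c_half" for \<xi> using that by (simp add: Cinf_c_half_def)
  note dom = Domain_H_op[OF assms(1) C2[OF assms(2)] assms(3)]
  have "Domain (H_op \<xi>\<^sub>0 m) \<inter> Domain (H_op \<xi>\<^sub>0' m') = H20"
    if m': "Re m' = 1" "m \<noteq> m'" "\<xi>\<^sub>0' \<in> Cinf_c_half" "one_near_0 \<xi>\<^sub>0'" for m' \<xi>\<^sub>0'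
  proof -
    \<comment> \<open>Both real parts are 1, which excludes m' = -m; hence the squares, and with
      them the two differential expressions, differ.\<close>
    have "m \<noteq> - m'" using assms(1) m'(1) by auto
    then have "m\<^sup>2 \<noteq> m'\<^sup>2" using m'(2) by (simp add: power2_eq_iff)
    moreover have "Domain (L_min \<alpha>) \<subseteq> Domain (L_max \<alpha>)" for \<alpha> using L_min_subset_L_max by blast
    ultimately show ?thesis
      unfolding dom Domain_H_op[OF m'(1) C2[OF m'(3)] m'(4)]
      using Domain_L_max_inter_subset_H20 H20_subset_Domain_L_min by blast
  qed
  moreover have "cutoff_power m \<xi> \<in> Domain (H_op \<xi>\<^sub>0 m) \<and> cutoff_power m \<xi> \<notin> H20"
    if "\<xi> \<in> Ck_c_half 2" "one_near_0 \<xi>" for \<xi>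
    unfolding dom using cutoff_power_in_L_min[OF assms(1) that] cutoff_power_not_H20[OF assms(1) that(2)] by blast
  moreover have "infinite_codim H20 (Domain (H_op \<xi>\<^sub>0 m))"
    unfolding dom by (rule infinite_codim_H20[OF assms(1)])
  ultimately show ?thesis
    using H20_subspace graph_dense_H20[OF assms(1) C2[OF assms(2)] assms(3)] by blast
qed

end
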